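(* Let $M$ be a surface whose fundamental group is infinite cyclic. Then $M$ has no transitive foliation, i.e. no foliation of $M$ has a dense leaf.
   Context: A surface is a connected Hausdorff topological $2$-manifold without boundary, NOT assumed metrizable or second countable (and not assumed orientable). A foliation of a surface is a $C^0$ one-dimensional foliation (locally modelled on the partition of $\mathbb R^2$ into parallel lines); it is not assumed orientable. *)

theory Defs
  imports "HOL-Analysis.Analysis" "HOL-Algebra.Elementary_Groups"
begin

subsection \<open>Surfaces\<close>

text \<open>No countability or metrizability is required.\<close>

definition surface :: "'a topology \<Rightarrow> bool" where
  "surface X \<longleftrightarrow>
     connected_space X \<and> Hausdorff_space X \<and>
     (\<forall>p\<in>topspace X. \<exists>U. openin X U \<and> p \<in> U \<and>
        subtopology X U homeomorphic_space (euclidean :: (real \<times> real) topology))"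


subsection \<open>The fundamental group\<close>

text \<open>As everywhere in the library, a path is a function on all of \<open>real\<close> of which only the
  restriction to \<open>{0..1}\<close> matters: two loops that agree on \<open>{0..1}\<close> are
  homotopic, so the homotopy classes below do not see the values elsewhere. Both arguments of
  \<open>homotopic_loops_at X x\<close> are automatically continuous loops in \<open>X\<close>
  based at \<open>x\<close>, and the homotopy is relative to the base point.\<close>

definition homotopic_loops_at :: "'a topology \<Rightarrow> 'a \<Rightarrow> (real \<Rightarrow> 'a) \<Rightarrow> (real \<Rightarrow> 'a) \<Rightarrow> bool" where
  "homotopic_loops_at X x =
     homotopic_with (\<lambda>r. r 0 = x \<and> r 1 = x) (top_of_set {0..1}) X"

definition loops_at :: "'a topology \<Rightarrow> 'a \<Rightarrow> (real \<Rightarrow> 'a) set" where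
  "loops_at X x = {p. pathin X p \<and> p 0 = x \<and> p 1 = x}"

text \<open>The library's \<open>joinpaths\<close> without its type class constraint.\<close>

definition concat_loops :: "(real \<Rightarrow> 'a) \<Rightarrow> (real \<Rightarrow> 'a) \<Rightarrow> real \<Rightarrow> 'a" where
  "concat_loops p q = (\<lambda>t. if t \<le> 1/2 then p (2 * t) else q (2 * t - 1))"

definition fundamental_group :: "'a topology \<Rightarrow> 'a \<Rightarrow> (real \<Rightarrow> 'a) set monoid" where
  "fundamental_group X x =
     \<lparr>carrier = loops_at X x // {(p, q). homotopic_loops_at X x p q},
      monoid.mult = (\<lambda>A B. {r. \<exists>p\<in>A. \<exists>q\<in>B. homotopic_loops_at X x (concat_loops p q) r}),
      one = {r. homotopic_loops_at X x (\<lambda>_. x) r}\<rparr>"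


subsection \<open>Foliations\<close>

text \<open>A foliation is presented by an atlas of charts onto the plane whose coordinate changes are
  locally of the form \<open>(x, y) \<mapsto> (f (x, y), g y)\<close>; nothing is required of
  \<open>f\<close>. As the condition is imposed on every ordered pair of charts, the local
  transverse map \<open>g\<close> has a local inverse of the same kind and is a homeomorphism near
  the second coordinate of each point. The atlas need not be maximal; passing to the maximal atlas
  does not change the leaves.\<close>

type_synonym 'a chart = "'a set \<times> ('a \<Rightarrow> real \<times> real)"

definition planar_chart :: "'a topology \<Rightarrow> 'a chart \<Rightarrow> bool" where
  "planar_chart X = (\<lambda>(U, \<phi>). openin X U \<and> homeomorphic_map (subtopology X U) euclidean \<phi>)"

definition foliated_compatible :: "'a topology \<Rightarrow> 'a chart \<Rightarrow> 'a chart \<Rightarrow> bool" where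
  "foliated_compatible X = (\<lambda>(U, \<phi>) (V, \<psi>).
     \<forall>p\<in>U \<inter> V. \<exists>W g. openin X W \<and> p \<in> W \<and> W \<subseteq> U \<inter> V \<and>
        (\<forall>q\<in>W. snd (\<psi> q) = g (snd (\<phi> q))))"

definition foliation :: "'a topology \<Rightarrow> 'a chart set \<Rightarrow> bool" where
  "foliation X F \<longleftrightarrow>
     (\<forall>c\<in>F. planar_chart X c) \<and>
     \<Union> (fst ` F) = topspace X \<and>
     (\<forall>c\<in>F. \<forall>d\<in>F. foliated_compatible X c d)"

definition plaques :: "'a chart set \<Rightarrow> 'a set set" where
  "plaques F = {{p \<in> U. snd (\<phi> p) = y} | U \<phi> y. (U, \<phi>) \<in> F}"

text \<open>Two points lie on the same leaf iff a finite chain of successively intersecting plaques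
  joins them; equivalently, the leaves are the components of the topology generated by the
  relatively open subsets of plaques.\<close>

definition same_leaf :: "'a chart set \<Rightarrow> ('a \<times> 'a) set" where
  "same_leaf F = {(p, q). \<exists>P\<in>plaques F. p \<in> P \<and> q \<in> P}\<^sup>+"

definition leaves :: "'a topology \<Rightarrow> 'a chart set \<Rightarrow> 'a set set" where
  "leaves X F = topspace X // same_leaf F"

definition transitive_foliation :: "'a topology \<Rightarrow> 'a chart set \<Rightarrow> bool" where
  "transitive_foliation X F \<longleftrightarrow>
     foliation X F \<and> (\<exists>L\<in>leaves X F. X closure_of L = topspace X)"

end

theory Submission
  imports Defs
begin

text \<open>A dense leaf is studied on the four-fold cover that orients the leaves and the
  transversals. There some lift of the leaf is dense in a transversal segment \<open>T\<close>, so it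
  runs from a point of \<open>T\<close> to another one and later returns to \<open>T\<close> strictly between the
  two. The two leaf arcs, closed up along \<open>T\<close>, are simple two-sided closed curves; each loop
  can be pushed off its own curve but crosses the other curve exactly once. Cutting along the
  curves gives two double covers whose monodromy separates the two loops, hence two finite covers
  of \<open>M\<close> whose monodromy cannot factor through an infinite cyclic group: the exponents of the
  two loops with respect to a common root would have contradictory parities. Passing to the cover is
  essential, since on the sphere with four punctures all intersection numbers mod 2 vanish although
  it carries transitive foliations that are not orientable.\<close>

subsection \<open>Local systems and lifts\<close>

text \<open>The covers built by cutting live over the orientation cover; composed with its
  projection they become covers of \<open>M\<close> with up to eight sheets. In the fibre over the
  base point only two points are known to be permuted by both loops, and a generator of the
  fundamental group may move these two to other points. This is why the parities refer to a common
  root of the two loops: the root is a product of powers of the loops and permutes the two points as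
  they do. A merely continuous foliation carries no flow along its leaves. Its place is taken by
  paths whose first coordinate increases strictly in the charts, together with a determinism
  principle: of two such paths with a common end, one contains the start of the other. This yields
  the order along a leaf, the simplicity of the two curves and the fact that they do not meet
  elsewhere. \<open>M\<close> need not be second countable, so finiteness is always local: a compact
  leaf arc returns to a transversal segment finitely often, and there are only four sheets of
  orientations over each point.\<close>

lemma locally_constant_on_connected:
  assumes "connected Y" "y \<in> Y" "z \<in> Y"
    and loc: "\<And>w. w \<in> Y \<Longrightarrow> \<exists>T. open T \<and> w \<in> T \<and> (\<forall>v\<in>T \<inter> Y. P v = P w)"
  shows "P y = P z"
proof -
  have *: "openin (top_of_set Y) {w \<in> Y. P w = b}" for b
  proof (subst openin_subopen, rule ballI)
    fix w assume "w \<in> {w \<in> Y. P w = b}"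
    then have w: "w \<in> Y" "P w = b" by auto
    obtain T where "open T" "w \<in> T" "\<forall>v\<in>T \<inter> Y. P v = P w" using loc[OF w(1)] by metis
    then have "openin (top_of_set Y) (Y \<inter> T)" "w \<in> Y \<inter> T" "Y \<inter> T \<subseteq> {w \<in> Y. P w = b}"
      using w by (auto simp: openin_open_Int)
    then show "\<exists>T. openin (top_of_set Y) T \<and> w \<in> T \<and> T \<subseteq> {w \<in> Y. P w = b}" by metis
  qed
  have "openin (top_of_set Y) (\<Union>b\<in>-{P y}. {w \<in> Y. P w = b})" using * by (intro openin_Union) auto
  moreover have "(\<Union>b\<in>-{P y}. {w \<in> Y. P w = b}) = {w \<in> Y. P w \<noteq> P y}" by auto
  ultimately have "openin (top_of_set Y) {w \<in> Y. P w \<noteq> P y}" by metis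
  moreover have "Y \<subseteq> {w \<in> Y. P w = P y} \<union> {w \<in> Y. P w \<noteq> P y}"
    "{w \<in> Y. P w = P y} \<inter> {w \<in> Y. P w \<noteq> P y} = {}" by auto
  ultimately have "{w \<in> Y. P w = P y} = {} \<or> {w \<in> Y. P w \<noteq> P y} = {}"
    using *[of "P y"] assms(1) unfolding connected_openin by metis
  moreover have "y \<in> {w \<in> Y. P w = P y}" using assms(2) by simp
  ultimately have "z \<notin> {w \<in> Y. P w \<noteq> P y}" by (metis empty_iff)
  then show ?thesis using assms(3) by simp
qed

text \<open>A covering space is given by its local sections: a pair \<open>(N, \<sigma>)\<close> is a section over
  the open set \<open>N\<close>, with \<open>\<sigma>\<close> naming a point of the fibre. Two sections agree on an open
  set and differ on an open set.\<close>

definition evenly_covers :: "('a set \<times> ('a \<Rightarrow> 'f)) set \<Rightarrow> 'a set \<Rightarrow> bool" where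
  "evenly_covers S N \<longleftrightarrow> (\<forall>N1 \<sigma>1 m. (N1, \<sigma>1) \<in> S \<longrightarrow> m \<in> N1 \<inter> N \<longrightarrow>
     (\<exists>N2 \<sigma>2. (N2, \<sigma>2) \<in> S \<and> N \<subseteq> N2 \<and> \<sigma>2 m = \<sigma>1 m))"

text \<open>The total space is never formed: a point of it is a base point \<open>m\<close> with a
  name \<open>\<sigma> m\<close>, meaningful only over \<open>m\<close>. Open agreement sets make
  two sections through a common point coincide nearby, open disagreement sets separate the points of
  a fibre and so give uniqueness of lifts, and \<open>evenly_covers\<close> gives their
  existence.\<close>

definition local_system :: "'a topology \<Rightarrow> ('a set \<times> ('a \<Rightarrow> 'f)) set \<Rightarrow> bool" where
  "local_system X S \<longleftrightarrow>
     (\<forall>N \<sigma>. (N, \<sigma>) \<in> S \<longrightarrow> openin X N) \<and>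
     (\<forall>N \<sigma> N' \<sigma>'. (N, \<sigma>) \<in> S \<longrightarrow> (N', \<sigma>') \<in> S \<longrightarrow>
        openin X {m \<in> N \<inter> N'. \<sigma> m = \<sigma>' m} \<and> openin X {m \<in> N \<inter> N'. \<sigma> m \<noteq> \<sigma>' m}) \<and>
     (\<forall>m\<in>topspace X. \<exists>N. openin X N \<and> m \<in> N \<and> evenly_covers S N)"

lemma local_system_open: "local_system X S \<Longrightarrow> (N, \<sigma>) \<in> S \<Longrightarrow> openin X N"
  unfolding local_system_def by metis

lemma local_system_eq:
  "local_system X S \<Longrightarrow> (N, \<sigma>) \<in> S \<Longrightarrow> (N', \<sigma>') \<in> S \<Longrightarrow> openin X {m \<in> N \<inter> N'. \<sigma> m = \<sigma>' m}"
  unfolding local_system_def by simp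

lemma local_system_neq:
  "local_system X S \<Longrightarrow> (N, \<sigma>) \<in> S \<Longrightarrow> (N', \<sigma>') \<in> S \<Longrightarrow> openin X {m \<in> N \<inter> N'. \<sigma> m \<noteq> \<sigma>' m}"
  unfolding local_system_def by simp

lemma local_system_even:
  assumes "local_system X S" "m \<in> topspace X"
  obtains N where "openin X N" "m \<in> N" "evenly_covers S N"
  using assms unfolding local_system_def by metis

lemma evenly_coversE:
  assumes "evenly_covers S N" "(N1, \<sigma>1) \<in> S" "m \<in> N1" "m \<in> N"
  obtains N2 \<sigma>2 where "(N2, \<sigma>2) \<in> S" "N \<subseteq> N2" "\<sigma>2 m = \<sigma>1 m"
  using assms unfolding evenly_covers_def by (metis IntI)

text \<open>Factoring locally through a section stands for continuity of the lift
  \<open>y \<mapsto> (f y, l y)\<close>, so that no topology on the total space is involved.\<close>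

definition lift_on :: "('a set \<times> ('a \<Rightarrow> 'f)) set \<Rightarrow> 'y::topological_space set \<Rightarrow> ('y \<Rightarrow> 'a) \<Rightarrow> ('y \<Rightarrow> 'f) \<Rightarrow> bool" where
  "lift_on S Y f l \<longleftrightarrow> (\<forall>y\<in>Y. \<exists>N \<sigma> T. (N, \<sigma>) \<in> S \<and> open T \<and> y \<in> T \<and>
      (\<forall>z\<in>T \<inter> Y. f z \<in> N \<and> l z = \<sigma> (f z)))"

lemma lift_onE:
  assumes "lift_on S Y f l" "y \<in> Y"
  obtains N \<sigma> T where "(N, \<sigma>) \<in> S" "open T" "y \<in> T"
    "\<And>z. z \<in> T \<Longrightarrow> z \<in> Y \<Longrightarrow> f z \<in> N" "\<And>z. z \<in> T \<Longrightarrow> z \<in> Y \<Longrightarrow> l z = \<sigma> (f z)"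
proof -
  from assms(1)[unfolded lift_on_def, rule_format, OF assms(2)]
  show thesis by (elim exE conjE) (rule that, assumption+, simp_all)
qed

lemma lift_onI:
  assumes "\<And>y. y \<in> Y \<Longrightarrow> \<exists>N \<sigma> T. (N, \<sigma>) \<in> S \<and> open T \<and> y \<in> T \<and>
      (\<forall>z\<in>T \<inter> Y. f z \<in> N \<and> l z = \<sigma> (f z))"
  shows "lift_on S Y f l"
  unfolding lift_on_def by (rule ballI) (rule assms)

lemma lift_on_subset: "lift_on S Y f l \<Longrightarrow> Z \<subseteq> Y \<Longrightarrow> lift_on S Z f l"
proof (rule lift_onI)
  fix y assume *: "lift_on S Y f l" "Z \<subseteq> Y" "y \<in> Z"
  then have "y \<in> Y" by auto
  then obtain N \<sigma> T where 1: "(N, \<sigma>) \<in> S" "open T" "y \<in> T"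
      "\<And>z. z \<in> T \<Longrightarrow> z \<in> Y \<Longrightarrow> f z \<in> N" "\<And>z. z \<in> T \<Longrightarrow> z \<in> Y \<Longrightarrow> l z = \<sigma> (f z)"
    using lift_onE[OF *(1)] by metis
  show "\<exists>N \<sigma> T. (N, \<sigma>) \<in> S \<and> open T \<and> y \<in> T \<and> (\<forall>z\<in>T \<inter> Z. f z \<in> N \<and> l z = \<sigma> (f z))"
    using 1 *(2) by (intro exI[of _ N] exI[of _ \<sigma>] exI[of _ T]) auto
qed

lemma lift_on_cong:
  assumes "lift_on S Y f l" "\<And>y. y \<in> Y \<Longrightarrow> f y = f' y" "\<And>y. y \<in> Y \<Longrightarrow> l y = l' y"
  shows "lift_on S Y f' l'"
  unfolding lift_on_def
proof
  fix y assume "y \<in> Y"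
  with assms(1) obtain N \<sigma> T where *: "(N, \<sigma>) \<in> S" "open T" "y \<in> T" "\<forall>z\<in>T \<inter> Y. f z \<in> N \<and> l z = \<sigma> (f z)"
    by (elim lift_onE) auto
  then have "\<forall>z\<in>T \<inter> Y. f' z \<in> N \<and> l' z = \<sigma> (f' z)" using assms(2,3) by auto
  with *(1-3) show "\<exists>N \<sigma> T. (N, \<sigma>) \<in> S \<and> open T \<and> y \<in> T \<and> (\<forall>z\<in>T \<inter> Y. f' z \<in> N \<and> l' z = \<sigma> (f' z))"
    by (intro exI conjI)
qed

lemma lift_on_compose:
  assumes l: "lift_on S Y f l" and g: "continuous_on Z g" "g ` Z \<subseteq> Y"
  shows "lift_on S Z (f \<circ> g) (l \<circ> g)"
  unfolding lift_on_def
proof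
  fix z assume z: "z \<in> Z"
  then have "g z \<in> Y" using g(2) by auto
  with l obtain N \<sigma> T where *: "(N, \<sigma>) \<in> S" "open T" "g z \<in> T" "\<forall>w\<in>T \<inter> Y. f w \<in> N \<and> l w = \<sigma> (f w)"
    by (elim lift_onE) auto
  obtain T' where T': "open T'" "T' \<inter> Z = g -` T \<inter> Z"
    using g(1) *(2) by (meson continuous_on_open_invariant)
  show "\<exists>N \<sigma> T. (N, \<sigma>) \<in> S \<and> open T \<and> z \<in> T \<and> (\<forall>z\<in>T \<inter> Z. (f \<circ> g) z \<in> N \<and> (l \<circ> g) z = \<sigma> ((f \<circ> g) z))"
  proof (intro exI conjI ballI)
    show "(N, \<sigma>) \<in> S" "open T'" by fact+
    show "z \<in> T'" using T' * z by auto
    fix w assume "w \<in> T' \<inter> Z"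
    then have "g w \<in> T \<inter> Y" using T' g(2) by auto
    then show "(f \<circ> g) w \<in> N" "(l \<circ> g) w = \<sigma> ((f \<circ> g) w)" using * by auto
  qed
qed

lemma continuous_map_open_preimage:
  assumes "continuous_map (top_of_set Y) X f" "openin X N"
  obtains T where "open T" "T \<inter> Y = {y \<in> Y. f y \<in> N}"
proof -
  have "openin (top_of_set Y) {y \<in> topspace (top_of_set Y). f y \<in> N}"
    using assms by (rule openin_continuous_map_preimage)
  then have "openin (top_of_set Y) {y \<in> Y. f y \<in> N}" by simp
  then show ?thesis using that by (metis inf_commute openin_open)
qed

lemma lift_on_section:
  assumes "continuous_map (top_of_set Y) X f" "local_system X S" "(N, \<sigma>) \<in> S" "f ` Y \<subseteq> N"
  shows "lift_on S Y f (\<sigma> \<circ> f)"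
  unfolding lift_on_def
proof
  fix y assume "y \<in> Y"
  show "\<exists>N \<sigma>' T. (N, \<sigma>') \<in> S \<and> open T \<and> y \<in> T \<and> (\<forall>z\<in>T \<inter> Y. f z \<in> N \<and> (\<sigma> \<circ> f) z = \<sigma>' (f z))"
    using assms(3,4) by (intro exI[of _ N] exI[of _ \<sigma>] exI[of _ UNIV]) auto
qed

lemma lift_on_eq_open:
  assumes LS: "local_system X S" and f: "continuous_map (top_of_set Y) X f"
    and l: "lift_on S Y f l" and k: "lift_on S Y f k" and y: "y \<in> Y"
  shows "\<exists>T. open T \<and> y \<in> T \<and> (\<forall>z\<in>T \<inter> Y. (l z = k z) = (l y = k y))"
proof -
  obtain N \<sigma> T where 1: "(N, \<sigma>) \<in> S" "open T" "y \<in> T" "\<forall>z\<in>T \<inter> Y. f z \<in> N \<and> l z = \<sigma> (f z)"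
    using lift_onE[OF l y] by (metis IntE)
  obtain N' \<sigma>' T' where 2: "(N', \<sigma>') \<in> S" "open T'" "y \<in> T'" "\<forall>z\<in>T' \<inter> Y. f z \<in> N' \<and> k z = \<sigma>' (f z)"
    using lift_onE[OF k y] by (metis IntE)
  define A where "A = {m \<in> N \<inter> N'. (\<sigma> m = \<sigma>' m) = (l y = k y)}"
  have "openin X A"
  proof (cases "l y = k y")
    case True
    then have "A = {m \<in> N \<inter> N'. \<sigma> m = \<sigma>' m}" by (auto simp: A_def)
    then show ?thesis using local_system_eq[OF LS 1(1) 2(1)] by simp
  next
    case False
    then have "A = {m \<in> N \<inter> N'. \<sigma> m \<noteq> \<sigma>' m}" by (auto simp: A_def)
    then show ?thesis using local_system_neq[OF LS 1(1) 2(1)] by simp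
  qed
  then obtain R where R: "open R" "R \<inter> Y = {z \<in> Y. f z \<in> A}"
    using continuous_map_open_preimage[OF f] by blast
  have "f y \<in> A" using 1 2 y by (auto simp: A_def)
  then have "y \<in> R" using R y by auto
  show ?thesis
  proof (intro exI conjI ballI)
    show "open (R \<inter> T \<inter> T')" using R 1 2 by auto
    show "y \<in> R \<inter> T \<inter> T'" using \<open>y \<in> R\<close> 1 2 by auto
    fix z assume z: "z \<in> R \<inter> T \<inter> T' \<inter> Y"
    then have "f z \<in> A" "l z = \<sigma> (f z)" "k z = \<sigma>' (f z)" using R 1 2 by auto
    then show "(l z = k z) = (l y = k y)" by (auto simp: A_def)
  qed
qed

lemma lift_on_unique:
  assumes LS: "local_system X S" and f: "continuous_map (top_of_set Y) X f"
    and l: "lift_on S Y f l" and k: "lift_on S Y f k"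
    and Y: "connected Y" "y \<in> Y" "z \<in> Y" and eq: "l y = k y"
  shows "l z = k z"
proof -
  have "(l y = k y) = (l z = k z)"
    by (rule locally_constant_on_connected[OF Y, of "\<lambda>w. l w = k w"])
      (rule lift_on_eq_open[OF LS f l k])
  then show ?thesis using eq by simp
qed

text \<open>At a point with \<open>g y = c\<close> the sections that represent \<open>l\<close> and
  \<open>k\<close> have the same value, hence agree on an open set; near \<open>y\<close> the
  section of \<open>l\<close> therefore represents both halves.\<close>

lemma lift_on_glue:
  fixes c :: real
  assumes LS: "local_system X S" and f: "continuous_map (top_of_set Y) X f"
    and g: "continuous_on UNIV g"
    and l: "lift_on S {y \<in> Y. g y \<le> c} f l" and k: "lift_on S {y \<in> Y. c \<le> g y} f k"
    and eq: "\<And>y. y \<in> Y \<Longrightarrow> g y = c \<Longrightarrow> l y = k y"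
  shows "lift_on S Y f (\<lambda>y. if g y \<le> c then l y else k y)"
  unfolding lift_on_def
proof
  fix y assume y: "y \<in> Y"
  consider "g y < c" | "g y > c" | "g y = c" by linarith
  then show "\<exists>N \<sigma> T. (N, \<sigma>) \<in> S \<and> open T \<and> y \<in> T \<and>
      (\<forall>z\<in>T \<inter> Y. f z \<in> N \<and> (if g z \<le> c then l z else k z) = \<sigma> (f z))"
  proof cases
    case 1
    then obtain N \<sigma> T where *: "(N, \<sigma>) \<in> S" "open T" "y \<in> T" "\<forall>z\<in>T \<inter> {y \<in> Y. g y \<le> c}. f z \<in> N \<and> l z = \<sigma> (f z)"
      using lift_onE[OF l, of y] y by (metis (mono_tags, lifting) IntE less_imp_le mem_Collect_eq)
    have "open {z. g z < c}" using g by (intro open_Collect_less) auto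
    with * 1 have "open (T \<inter> {z. g z < c}) \<and> y \<in> T \<inter> {z. g z < c} \<and> (\<forall>z\<in>T \<inter> {z. g z < c} \<inter> Y. f z \<in> N \<and> (if g z \<le> c then l z else k z) = \<sigma> (f z))"
      by auto
    then show ?thesis using *(1) by metis
  next
    case 2
    then obtain N \<sigma> T where *: "(N, \<sigma>) \<in> S" "open T" "y \<in> T" "\<forall>z\<in>T \<inter> {y \<in> Y. c \<le> g y}. f z \<in> N \<and> k z = \<sigma> (f z)"
      using lift_onE[OF k, of y] y by (metis (mono_tags, lifting) IntE less_imp_le mem_Collect_eq)
    have "open {z. c < g z}" using g by (intro open_Collect_less) auto
    with * 2 have "open (T \<inter> {z. c < g z}) \<and> y \<in> T \<inter> {z. c < g z} \<and> (\<forall>z\<in>T \<inter> {z. c < g z} \<inter> Y. f z \<in> N \<and> (if g z \<le> c then l z else k z) = \<sigma> (f z))"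
      by auto
    then show ?thesis using *(1) by metis
  next
    case 3
    obtain N \<sigma> T where 1: "(N, \<sigma>) \<in> S" "open T" "y \<in> T" "\<forall>z\<in>T \<inter> {y \<in> Y. g y \<le> c}. f z \<in> N \<and> l z = \<sigma> (f z)"
      using lift_onE[OF l, of y] y 3 by (metis (mono_tags, lifting) IntE order_refl mem_Collect_eq)
    obtain N' \<sigma>' T' where 2: "(N', \<sigma>') \<in> S" "open T'" "y \<in> T'" "\<forall>z\<in>T' \<inter> {y \<in> Y. c \<le> g y}. f z \<in> N' \<and> k z = \<sigma>' (f z)"
      using lift_onE[OF k, of y] y 3 by (metis (mono_tags, lifting) IntE order_refl mem_Collect_eq)
    define A where "A = {m \<in> N \<inter> N'. \<sigma> m = \<sigma>' m}"
    obtain R where R: "open R" "R \<inter> Y = {z \<in> Y. f z \<in> A}"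
      using continuous_map_open_preimage[OF f] local_system_eq[OF LS 1(1) 2(1)] unfolding A_def by blast
    have "f y \<in> A" using 1 2 3 y eq unfolding A_def by fastforce
    then have "y \<in> R" using R y by auto
    show ?thesis
    proof (intro exI conjI ballI)
      show "(N, \<sigma>) \<in> S" by fact
      show "open (R \<inter> T \<inter> T')" using R 1 2 by auto
      show "y \<in> R \<inter> T \<inter> T'" using \<open>y \<in> R\<close> 1 2 by auto
      fix z assume z: "z \<in> R \<inter> T \<inter> T' \<inter> Y"
      then have A: "f z \<in> A" using R by auto
      then show "f z \<in> N" by (auto simp: A_def)
      show "(if g z \<le> c then l z else k z) = \<sigma> (f z)"
        using A z 1 2 by (auto simp: A_def)
    qed
  qed
qed

text \<open>The parameter \<open>s\<close> makes the same induction along \<open>t\<close> yield both path lifting and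
  the local constancy needed for homotopy invariance.\<close>

lemma lift_on_tube:
  fixes h :: "real \<times> real \<Rightarrow> 'a"
  assumes LS: "local_system X S" and h: "continuous_map (top_of_set ({0..1} \<times> {0..1})) X h"
    and s0: "s0 \<in> {0..1}" and N0: "(N0, \<sigma>0) \<in> S" "h (s0, 0) \<in> N0" "\<sigma>0 (h (s0, 0)) = v"
  shows "\<exists>\<delta>>0. \<exists>l. lift_on S (({0..1} \<inter> ball s0 \<delta>) \<times> {0..1}) h l \<and> l (s0, 0) = v"
proof -
  define J where "J \<delta> = {0..1} \<inter> ball s0 \<delta>" for \<delta>
  \<comment> \<open>The width \<delta> may depend on \<open>t\<close>, so every extension of the
    lift is free to narrow the strip.\<close>
  define good where "good t \<longleftrightarrow> (\<exists>\<delta>>0. \<exists>l. lift_on S (J \<delta> \<times> {0..t}) h l \<and> l (s0, 0) = v)" for t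
  have J0: "s0 \<in> J \<delta>" if "\<delta> > 0" for \<delta> using that s0 by (auto simp: J_def)
  have Jconn: "connected (J \<delta>)" for \<delta>
    unfolding J_def by (intro convex_connected convex_Int) auto
  have Jsub: "J \<delta> \<subseteq> J \<delta>'" if "\<delta> \<le> \<delta>'" for \<delta> \<delta>' using that by (auto simp: J_def)
  have contJ: "continuous_map (top_of_set (J \<delta> \<times> {a..b})) X h" if "0 \<le> a" "b \<le> 1" for \<delta> a b
    using h that by (rule_tac continuous_map_from_subtopology_mono) (auto simp: J_def)
  have contJ': "continuous_map (top_of_set (J \<delta> \<times> {t})) X h" if "t \<in> {0..1}" for \<delta> t
    using contJ[of t t \<delta>] that by auto
  have local: "\<exists>N \<epsilon>. openin X N \<and> \<epsilon> > 0 \<and>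
        h ` (J \<epsilon> \<times> ({0..1} \<inter> ball t \<epsilon>)) \<subseteq> N \<and>
        evenly_covers S N"
    if t: "t \<in> {0..1}" for t
  proof -
    have "h (s0, t) \<in> topspace X" using h s0 t by (auto simp: continuous_map_def)
    then obtain N where N: "openin X N" "h (s0, t) \<in> N" "evenly_covers S N"
      using local_system_even[OF LS] by metis
    obtain T where T: "open T" "T \<inter> ({0..1} \<times> {0..1}) = {y \<in> {0..1} \<times> {0..1}. h y \<in> N}"
      using continuous_map_open_preimage[OF h N(1)] by blast
    have "(s0, t) \<in> T" using T N(2) s0 t by auto
    then obtain A B where AB: "open A" "open B" "s0 \<in> A" "t \<in> B" "A \<times> B \<subseteq> T"
      using T(1) by (metis SigmaE2 open_prod_def mem_Times_iff fst_conv snd_conv)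
    obtain e1 where e1: "e1 > 0" "ball s0 e1 \<subseteq> A" using AB openE by blast
    obtain e2 where e2: "e2 > 0" "ball t e2 \<subseteq> B" using AB openE by blast
    have "h ` (J (min e1 e2) \<times> ({0..1} \<inter> ball t (min e1 e2))) \<subseteq> N"
    proof clarify
      fix a b assume ab: "a \<in> J (min e1 e2)" "b \<in> {0..1}" "b \<in> ball t (min e1 e2)"
      then have "(a, b) \<in> T \<inter> ({0..1} \<times> {0..1})" using AB e1 e2 by (auto simp: J_def subset_iff)
      then show "h (a, b) \<in> N" using T by auto
    qed
    then show ?thesis using N e1 e2 by (intro exI[of _ N] exI[of _ "min e1 e2"]) auto
  qed
  have step: "good t''" if tt: "0 \<le> t'" "t' \<le> t''" "t'' \<le> 1" "good t'"
    and N: "openin X N" "\<epsilon> > 0" "h ` (J \<epsilon> \<times> {t'..t''}) \<subseteq> N"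
    and even: "evenly_covers S N"
    for t' t'' N \<epsilon>
  proof -
    obtain \<delta> l where l: "\<delta> > 0" "lift_on S (J \<delta> \<times> {0..t'}) h l" "l (s0, 0) = v"
      using tt(4) unfolding good_def by blast
    have "(s0, t') \<in> J \<delta> \<times> {0..t'}" using l J0 tt by auto
    then obtain N1 \<sigma>1 where 1: "(N1, \<sigma>1) \<in> S" "h (s0, t') \<in> N1" "l (s0, t') = \<sigma>1 (h (s0, t'))"
      using lift_onE[OF l(2)] by metis
    have "h (s0, t') \<in> N" using N(3) J0[OF N(2)] tt by auto
    \<comment> \<open>Since \<open>N\<close> is evenly covered, some section over all of
      \<open>N\<close> has the value of the lift at \<open>(s0, t')\<close>; it continues the lift
      up to \<open>t''\<close>.\<close>
    then obtain N2 \<sigma>2 where 2: "(N2, \<sigma>2) \<in> S" "N \<subseteq> N2" "\<sigma>2 (h (s0, t')) = \<sigma>1 (h (s0, t'))"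
      using evenly_coversE[OF even 1(1,2)] by metis
    define d where "d = min \<delta> \<epsilon>"
    have d: "d > 0" "d \<le> \<delta>" "d \<le> \<epsilon>" using l N by (auto simp: d_def)
    define Y where "Y = J d \<times> {0..t''}"
    have hY: "continuous_map (top_of_set Y) X h" unfolding Y_def using contJ tt by auto
    have 3: "lift_on S {y \<in> Y. snd y \<le> t'} h l"
      by (rule lift_on_subset[OF l(2)]) (use Jsub[OF d(2)] in \<open>auto simp: Y_def\<close>)
    have sub: "{y \<in> Y. t' \<le> snd y} \<subseteq> J \<epsilon> \<times> {t'..t''}" using Jsub[OF d(3)] by (auto simp: Y_def)
    have 4: "lift_on S {y \<in> Y. t' \<le> snd y} h (\<sigma>2 \<circ> h)"
    proof (rule lift_on_section[OF _ LS 2(1)])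
      show "continuous_map (top_of_set {y \<in> Y. t' \<le> snd y}) X h"
        using hY by (rule continuous_map_from_subtopology_mono) auto
      show "h ` {y \<in> Y. t' \<le> snd y} \<subseteq> N2" using sub N(3) 2(2) by blast
    qed
    \<comment> \<open>Agreement at the one point \<open>(s0, t')\<close> spreads along the seam,
      because \<open>J d \<times> {t'}\<close> is connected.\<close>
    have "l y = (\<sigma>2 \<circ> h) y" if y: "y \<in> J d \<times> {t'}" for y
    proof (rule lift_on_unique[OF LS contJ'[of t' d]])
      show "t' \<in> {0..1}" using tt by auto
      show "lift_on S (J d \<times> {t'}) h l"
        by (rule lift_on_subset[OF 3]) (use tt in \<open>auto simp: Y_def\<close>)
      show "lift_on S (J d \<times> {t'}) h (\<sigma>2 \<circ> h)"
        by (rule lift_on_subset[OF 4]) (use tt in \<open>auto simp: Y_def\<close>)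
      show "connected (J d \<times> {t'})" by (intro connected_Times Jconn) auto
      show "(s0, t') \<in> J d \<times> {t'}" using J0 d by auto
      show "l (s0, t') = (\<sigma>2 \<circ> h) (s0, t')" using 1 2 by auto
    qed (use y in auto)
    then have "lift_on S Y h (\<lambda>y. if snd y \<le> t' then l y else (\<sigma>2 \<circ> h) y)"
      by (intro lift_on_glue[OF LS hY _ 3 4]) (auto simp: Y_def intro!: continuous_intros)
    moreover have "(if snd (s0, 0) \<le> t' then l (s0, 0) else (\<sigma>2 \<circ> h) (s0, 0)) = v" using l tt by auto
    ultimately show ?thesis using d(1) unfolding good_def Y_def by blast
  qed
  have good0: "good 0"
  proof -
    obtain T where T: "open T" "T \<inter> ({0..1} \<times> {0..1}) = {y \<in> {0..1} \<times> {0..1}. h y \<in> N0}"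
      using continuous_map_open_preimage[OF h local_system_open[OF LS N0(1)]] by blast
    have "(s0, 0) \<in> T" using T N0(2) s0 by auto
    then obtain A B where AB: "open A" "open B" "s0 \<in> A" "0 \<in> B" "A \<times> B \<subseteq> T"
      using T(1) by (metis SigmaE2 open_prod_def mem_Times_iff fst_conv snd_conv)
    obtain e1 where e1: "e1 > 0" "ball s0 e1 \<subseteq> A" using AB openE by blast
    have "lift_on S (J e1 \<times> {0..0}) h (\<sigma>0 \<circ> h)"
    proof (rule lift_on_section[OF _ LS N0(1)])
      show "continuous_map (top_of_set (J e1 \<times> {0..0})) X h" using contJ[of 0 0 e1] by simp
      show "h ` (J e1 \<times> {0..0}) \<subseteq> N0"
      proof clarify
        fix a b :: real assume ab: "a \<in> J e1" "b \<in> {0..0}"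
        then have "(a, b) \<in> T \<inter> ({0..1} \<times> {0..1})" using AB e1 by (auto simp: J_def subset_iff)
        then show "h (a, b) \<in> N0" using T by auto
      qed
    qed
    then show ?thesis using e1 N0 unfolding good_def by (metis comp_apply)
  qed
  have "good 1"
  proof -
    have mono: "good t'" if "good t" "t' \<le> t" for t t'
    proof -
      obtain \<delta> l where l: "\<delta> > 0" "lift_on S (J \<delta> \<times> {0..t}) h l" "l (s0, 0) = v"
        using \<open>good t\<close> unfolding good_def by metis
      moreover have "J \<delta> \<times> {0..t'} \<subseteq> J \<delta> \<times> {0..t}" using that by auto
      ultimately show ?thesis unfolding good_def by (metis lift_on_subset)
    qed
    \<comment> \<open>Connectedness of the interval replaces a subdivision: near each
      \<open>t\<close> the property passes downwards by restriction and upwards by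
      \<open>step\<close> inside one evenly covered set.\<close>
    have "good 0 = good 1"
    proof (rule locally_constant_on_connected[of "{0..1}" 0 1 good])
      show "connected {0..1::real}" by simp
      fix t :: real assume t: "t \<in> {0..1}"
      obtain N \<epsilon> where N: "openin X N" "\<epsilon> > 0" "h ` (J \<epsilon> \<times> ({0..1} \<inter> ball t \<epsilon>)) \<subseteq> N"
        and even: "evenly_covers S N"
        using local[OF t] by auto
      have ext: "good c" if "b \<in> {0..1} \<inter> ball t \<epsilon>" "c \<in> {0..1} \<inter> ball t \<epsilon>" "good b" for b c
      proof (cases "b \<le> c")
        case True
        have "{b..c} \<subseteq> {0..1} \<inter> ball t \<epsilon>" using that by (auto simp: dist_real_def)
        then have "h ` (J \<epsilon> \<times> {b..c}) \<subseteq> N" using N(3) by blast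
        then show ?thesis using True that step[OF _ _ _ \<open>good b\<close> N(1,2) _ even] by auto
      next
        case False
        then show ?thesis using mono that by auto
      qed
      have "t \<in> {0..1} \<inter> ball t \<epsilon>" using t N by auto
      then have "\<forall>v\<in>ball t \<epsilon> \<inter> {0..1}. good v = good t" using ext by blast
      then show "\<exists>T. open T \<and> t \<in> T \<and> (\<forall>v\<in>T \<inter> {0..1}. good v = good t)"
        using N(2) by (intro exI[of _ "ball t \<epsilon>"]) auto
    qed auto
    then show ?thesis using good0 by simp
  qed
  then show ?thesis unfolding good_def J_def by blast
qed

subsection \<open>Transport and the fundamental group\<close>

text \<open>Monodromy as a relation between fibre names: total on the fibre by
  \<open>transport_exists\<close>, single-valued and injective by uniqueness of lifts.\<close>

definition transport :: "('a set \<times> ('a \<Rightarrow> 'f)) set \<Rightarrow> (real \<Rightarrow> 'a) \<Rightarrow> 'f \<Rightarrow> 'f \<Rightarrow> bool" where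
  "transport S p v w \<longleftrightarrow> (\<exists>l. lift_on S {0..1} p l \<and> l 0 = v \<and> l 1 = w)"

definition fibre :: "('a set \<times> ('a \<Rightarrow> 'f)) set \<Rightarrow> 'a \<Rightarrow> 'f set" where
  "fibre S m = {v. \<exists>N \<sigma>. (N, \<sigma>) \<in> S \<and> m \<in> N \<and> \<sigma> m = v}"

lemma lift_on_fibre:
  assumes "lift_on S Y f l" "y \<in> Y"
  shows "l y \<in> fibre S (f y)"
proof -
  obtain N \<sigma> T where "(N, \<sigma>) \<in> S" "y \<in> T"
    "\<And>z. z \<in> T \<Longrightarrow> z \<in> Y \<Longrightarrow> f z \<in> N" "\<And>z. z \<in> T \<Longrightarrow> z \<in> Y \<Longrightarrow> l z = \<sigma> (f z)"
    using lift_onE[OF assms] by metis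
  then show ?thesis using assms(2) unfolding fibre_def by auto
qed

lemma transport_fibre1: "transport S p v w \<Longrightarrow> v \<in> fibre S (p 0)"
  unfolding transport_def using lift_on_fibre[of S "{0..1}" p _ 0] by auto

lemma transport_fibre2: "transport S p v w \<Longrightarrow> w \<in> fibre S (p 1)"
  unfolding transport_def using lift_on_fibre[of S "{0..1}" p _ 1] by auto

lemma lift_on_const:
  assumes "v \<in> fibre S m" "\<And>y. y \<in> Y \<Longrightarrow> f y = m"
  shows "lift_on S Y f (\<lambda>_. v)"
proof (rule lift_onI)
  fix y assume "y \<in> Y"
  obtain N \<sigma> where N: "(N, \<sigma>) \<in> S" "m \<in> N" "\<sigma> m = v" using assms(1) unfolding fibre_def by blast
  then show "\<exists>N \<sigma> T. (N, \<sigma>) \<in> S \<and> open T \<and> y \<in> T \<and> (\<forall>z\<in>T \<inter> Y. f z \<in> N \<and> v = \<sigma> (f z))"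
    using assms(2) by (intro exI[of _ N] exI[of _ \<sigma>] exI[of _ UNIV]) auto
qed

lemma transport_unique:
  assumes "local_system X S" "pathin X p" "transport S p v w" "transport S p v w'"
  shows "w = w'"
proof -
  obtain l where l: "lift_on S {0..1} p l" "l 0 = v" "l 1 = w"
    using assms unfolding transport_def by blast
  obtain k where k: "lift_on S {0..1} p k" "k 0 = v" "k 1 = w'"
    using assms unfolding transport_def by blast
  have "l 1 = k 1"
    using lift_on_unique[OF assms(1) _ l(1) k(1), of 0 1] assms(2) l k unfolding pathin_def by auto
  then show ?thesis using l k by simp
qed

lemma transport_unique':
  assumes "local_system X S" "pathin X p" "transport S p v w" "transport S p v' w"
  shows "v = v'"
proof -
  obtain l where l: "lift_on S {0..1} p l" "l 0 = v" "l 1 = w"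
    using assms unfolding transport_def by blast
  obtain k where k: "lift_on S {0..1} p k" "k 0 = v'" "k 1 = w"
    using assms unfolding transport_def by blast
  have "l 0 = k 0"
    using lift_on_unique[OF assms(1) _ l(1) k(1), of 1 0] assms(2) l k unfolding pathin_def by auto
  then show ?thesis using l k by simp
qed

lemma lift_slice:
  assumes "lift_on S (J \<times> {0..1}) h l" "s \<in> J"
  shows "transport S (\<lambda>t. h (s, t)) (l (s, 0)) (l (s, 1))"
proof -
  have "lift_on S {0..1} (h \<circ> Pair s) (l \<circ> Pair s)"
    by (rule lift_on_compose[OF assms(1)]) (use assms(2) in \<open>auto intro!: continuous_intros\<close>)
  then show ?thesis unfolding transport_def comp_def by (intro exI[of _ "\<lambda>t. l (s, t)"]) auto
qed

text \<open>The strip lemma is applied to \<open>h (s, t) = p t\<close>, which does not depend on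
  \<open>s\<close>; the slice \<open>s = 0\<close> is the desired lift.\<close>

lemma transport_exists:
  assumes LS: "local_system X S" and p: "pathin X p" and v: "v \<in> fibre S (p 0)"
  shows "\<exists>w. transport S p v w"
proof -
  define h where "h = p \<circ> (snd :: real \<times> real \<Rightarrow> real)"
  have h: "continuous_map (top_of_set ({0..1} \<times> {0..1})) X h"
    unfolding h_def using p unfolding pathin_def
    by (intro continuous_map_compose[of _ "top_of_set {0..1}"])
      (auto intro!: continuous_map_into_subtopology continuous_intros)
  obtain N \<sigma> where N: "(N, \<sigma>) \<in> S" "h (0, 0) \<in> N" "\<sigma> (h (0, 0)) = v"
    using v unfolding fibre_def h_def by auto
  obtain \<delta> l where l: "\<delta> > 0" "lift_on S (({0..1} \<inter> ball 0 \<delta>) \<times> {0..1}) h l" "l (0, 0) = v"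
    using lift_on_tube[OF LS h _ N] by auto
  have "transport S (\<lambda>t. h (0, t)) (l (0, 0)) (l (0, 1))"
    using lift_slice[OF l(2), of 0] l(1) by simp
  then show ?thesis using l(3) by (auto simp: h_def)
qed

lemma transport_reverse:
  assumes "transport S p v w"
  shows "transport S (\<lambda>t. p (1 - t)) w v"
proof -
  obtain l where l: "lift_on S {0..1} p l" "l 0 = v" "l 1 = w"
    using assms unfolding transport_def by blast
  have "lift_on S {0..1} (p \<circ> (\<lambda>t. 1 - t)) (l \<circ> (\<lambda>t. 1 - t))"
    by (rule lift_on_compose[OF l(1)]) (auto intro!: continuous_intros)
  then show ?thesis unfolding transport_def comp_def using l
    by (intro exI[of _ "\<lambda>t. l (1 - t)"]) auto
qed

lemma pathin_reverse: "pathin X p \<Longrightarrow> pathin X (\<lambda>t. p (1 - t))"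
  unfolding pathin_def
  by (rule continuous_map_compose[of _ "top_of_set {0..1}" "\<lambda>t. 1 - t" X p, unfolded comp_def])
     (auto intro!: continuous_map_into_subtopology continuous_intros)

lemma pathin_concat_loops:
  assumes "pathin X p" "pathin X q" "p 1 = q 0"
  shows "pathin X (concat_loops p q)"
proof -
  have "continuous_map (top_of_set {0..1}) X (\<lambda>t. if t \<le> 1/2 then (p \<circ> (\<lambda>t. 2 * t)) t else (q \<circ> (\<lambda>t. 2 * t - 1)) t)"
  proof (rule continuous_map_cases_le)
    show "continuous_map (top_of_set {0..1}) euclideanreal (\<lambda>t::real. t)" by (auto intro!: continuous_intros)
    show "continuous_map (subtopology (top_of_set {0..1}) {x \<in> topspace (top_of_set {0..1}). x \<le> 1/2}) X (p \<circ> (\<lambda>t. 2 * t))"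
      by (rule continuous_map_compose[OF _ assms(1)[unfolded pathin_def]])
        (auto simp: subtopology_subtopology intro!: continuous_map_into_subtopology continuous_intros)
    show "continuous_map (subtopology (top_of_set {0..1}) {x \<in> topspace (top_of_set {0..1}). 1/2 \<le> x}) X (q \<circ> (\<lambda>t. 2 * t - 1))"
      by (rule continuous_map_compose[OF _ assms(2)[unfolded pathin_def]])
        (auto simp: subtopology_subtopology intro!: continuous_map_into_subtopology continuous_intros)
    fix t :: real assume "t \<in> topspace (top_of_set {0..1})" "t = 1/2"
    then have "2 * t = 1" "2 * t - 1 = 0" by simp_all
    then show "(p \<circ> (\<lambda>t. 2 * t)) t = (q \<circ> (\<lambda>t. 2 * t - 1)) t" using assms(3) by (simp only: comp_apply)
  qed auto
  then show ?thesis unfolding pathin_def concat_loops_def comp_def .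
qed

lemma transport_concat:
  assumes LS: "local_system X S" and p: "pathin X p" and q: "pathin X q" and pq: "p 1 = q 0"
    and t1: "transport S p u v" and t2: "transport S q v w"
  shows "transport S (concat_loops p q) u w"
proof -
  obtain l where l: "lift_on S {0..1} p l" "l 0 = u" "l 1 = v"
    using t1 unfolding transport_def by blast
  obtain k where k: "lift_on S {0..1} q k" "k 0 = v" "k 1 = w"
    using t2 unfolding transport_def by blast
  let ?c = "concat_loops p q"
  have c: "continuous_map (top_of_set {0..1}) X ?c"
    using pathin_concat_loops[OF p q pq] unfolding pathin_def .
  have 1: "lift_on S {y \<in> {0..1}. y \<le> 1/2} ?c (\<lambda>t. l (2 * t))"
  proof (rule lift_on_cong)
    show "lift_on S {y \<in> {0..1}. y \<le> 1/2} (p \<circ> (\<lambda>t. 2 * t)) (l \<circ> (\<lambda>t. 2 * t))"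
      by (rule lift_on_compose[OF l(1)]) (auto intro!: continuous_intros)
  qed (auto simp: concat_loops_def)
  have 2: "lift_on S {y \<in> {0..1}. 1/2 \<le> y} ?c (\<lambda>t. k (2 * t - 1))"
  proof (rule lift_on_cong)
    show "lift_on S {y \<in> {0..1}. 1/2 \<le> y} (q \<circ> (\<lambda>t. 2 * t - 1)) (k \<circ> (\<lambda>t. 2 * t - 1))"
      by (rule lift_on_compose[OF k(1)]) (auto intro!: continuous_intros)
    fix y :: real assume y: "y \<in> {y \<in> {0..1}. 1/2 \<le> y}"
    show "(q \<circ> (\<lambda>t. 2 * t - 1)) y = concat_loops p q y"
    proof (cases "y = 1/2")
      case True
      then have "2 * y = 1" "2 * y - 1 = 0" "y \<le> 1/2" by simp_all
      then show ?thesis using pq by (simp only: comp_apply concat_loops_def if_True)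
    next
      case False
      then show ?thesis using y by (simp add: concat_loops_def)
    qed
  qed auto
  have "lift_on S {0..1} ?c (\<lambda>y. if y \<le> 1/2 then l (2 * y) else k (2 * y - 1))"
  proof (rule lift_on_glue[OF LS c _ 1 2])
    fix y :: real assume "y = 1/2"
    then have "2 * y = 1" "2 * y - 1 = 0" by simp_all
    then show "l (2 * y) = k (2 * y - 1)" using l k by simp
  qed (auto intro!: continuous_intros)
  then show ?thesis unfolding transport_def using l k
    by (intro exI[of _ "\<lambda>y. if y \<le> 1/2 then l (2 * y) else k (2 * y - 1)"] conjI) auto
qed

section \<open>Homotopy invariance of transport\<close>

lemma homotopic_loops_at_iff:
  "homotopic_loops_at X x p q \<longleftrightarrow> (\<exists>h. continuous_map (top_of_set ({0..1} \<times> {0..1} :: (real \<times> real) set)) X h \<and>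
     (\<forall>t. h (0, t) = p t) \<and> (\<forall>t. h (1, t) = q t) \<and> (\<forall>s\<in>{0..1}. h (s, 0) = x \<and> h (s, 1) = x))"
  unfolding homotopic_loops_at_def homotopic_with_def by simp

lemma homotopic_loops_at_concat:
  assumes "homotopic_loops_at X x p p'" "homotopic_loops_at X x q q'"
  shows "homotopic_loops_at X x (concat_loops p q) (concat_loops p' q')"
proof -
  let ?I = "top_of_set ({0..1} \<times> {0..1::real}) :: (real \<times> real) topology"
  obtain h where h: "continuous_map ?I X h"
    and h01: "\<And>t. h (0, t) = p t" "\<And>t. h (1, t) = p' t"
    and hx: "\<And>s. s \<in> {0..1} \<Longrightarrow> h (s, 0) = x \<and> h (s, 1) = x"
    using assms(1) unfolding homotopic_loops_at_iff by metis
  obtain k where k: "continuous_map ?I X k"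
    and k01: "\<And>t. k (0, t) = q t" "\<And>t. k (1, t) = q' t"
    and kx: "\<And>s. s \<in> {0..1} \<Longrightarrow> k (s, 0) = x \<and> k (s, 1) = x"
    using assms(2) unfolding homotopic_loops_at_iff by metis
  define c where "c z = (if snd z \<le> 1/2 then (h \<circ> (\<lambda>z. (fst z, 2 * snd z))) z
     else (k \<circ> (\<lambda>z. (fst z, 2 * snd z - 1))) z)" for z
  have "continuous_map ?I X c"
    unfolding c_def
  proof (rule continuous_map_cases_le)
    show "continuous_map ?I euclideanreal snd" by (auto intro!: continuous_intros)
    show "continuous_map (subtopology ?I {z \<in> topspace ?I. snd z \<le> 1/2}) X (h \<circ> (\<lambda>z. (fst z, 2 * snd z)))"
      by (rule continuous_map_compose[OF _ h])
        (auto simp: subtopology_subtopology intro!: continuous_map_into_subtopology continuous_intros)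
    show "continuous_map (subtopology ?I {z \<in> topspace ?I. 1/2 \<le> snd z}) X (k \<circ> (\<lambda>z. (fst z, 2 * snd z - 1)))"
      by (rule continuous_map_compose[OF _ k])
        (auto simp: subtopology_subtopology intro!: continuous_map_into_subtopology continuous_intros)
    fix z :: "real \<times> real" assume z: "z \<in> topspace ?I" "snd z = 1/2"
    then have "2 * snd z = 1" "2 * snd z - 1 = 0" "fst z \<in> {0..1}" by auto
    then show "(h \<circ> (\<lambda>z. (fst z, 2 * snd z))) z = (k \<circ> (\<lambda>z. (fst z, 2 * snd z - 1))) z"
      using hx kx by (simp only: comp_apply)
  qed auto
  moreover have "c (0, t) = concat_loops p q t" "c (1, t) = concat_loops p' q' t" for t
    by (auto simp: c_def concat_loops_def h01 k01)
  moreover have "c (s, 0) = x" "c (s, 1) = x" if "s \<in> {0..1}" for s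
    using that hx kx by (auto simp: c_def)
  ultimately show ?thesis unfolding homotopic_loops_at_iff by (intro exI[of _ c]) auto
qed

text \<open>The result of transport is locally constant in the homotopy parameter. Over a narrow
  strip the homotopy lifts; on the edges \<open>t = 0\<close> and \<open>t = 1\<close> it is
  constantly \<open>x\<close>, so the lift is constant there by uniqueness. Hence all nearby slices
  carry \<open>v\<close> to the same end.\<close>

lemma transport_homotopic:
  assumes LS: "local_system X S" and hom: "homotopic_loops_at X x p q" and tr: "transport S p v w"
  shows "transport S q v w"
proof -
  obtain h where h: "continuous_map (top_of_set ({0..1} \<times> {0..1} :: (real \<times> real) set)) X h"
    and h01: "\<And>t. h (0, t) = p t" "\<And>t. h (1, t) = q t"
    and hx: "\<And>s. s \<in> {0..1} \<Longrightarrow> h (s, 0) = x \<and> h (s, 1) = x"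
    using hom unfolding homotopic_loops_at_iff by metis
  have vx: "v \<in> fibre S x" using transport_fibre1[OF tr] h01 hx by (metis atLeastAtMost_iff order_refl zero_le_one)
  define P where "P s = transport S (\<lambda>t. h (s, t)) v w" for s
  have "P 0 = P 1"
  proof (rule locally_constant_on_connected[of "{0..1}" 0 1 P])
    fix s0 :: real assume s0: "s0 \<in> {0..1}"
    obtain N \<sigma> where N: "(N, \<sigma>) \<in> S" "h (s0, 0) \<in> N" "\<sigma> (h (s0, 0)) = v"
      using vx hx s0 unfolding fibre_def by auto
    obtain \<delta> l where l: "\<delta> > 0" "lift_on S (({0..1} \<inter> ball s0 \<delta>) \<times> {0..1}) h l" "l (s0, 0) = v"
      using lift_on_tube[OF LS h s0 N] by auto
    define J where "J = {0..1} \<inter> ball s0 \<delta>"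
    have J: "connected J" "s0 \<in> J" "J \<subseteq> {0..1}"
      unfolding J_def using s0 l(1) by (auto intro!: convex_connected convex_Int)
    have lJ: "lift_on S (J \<times> {0..1}) h l" using l(2) by (simp add: J_def)
    have side: "l (s, t) = l (s0, t)" if t: "t = 0 \<or> t = 1" and s: "s \<in> J" for s t
    proof (rule lift_on_unique[OF LS, where k = "\<lambda>_. l (s0, t)" and f = h and Y = "J \<times> {t}" and y = "(s0, t)"])
      show "continuous_map (top_of_set (J \<times> {t})) X h"
        using h by (rule continuous_map_from_subtopology_mono) (use J t in auto)
      show lt: "lift_on S (J \<times> {t}) h l" by (rule lift_on_subset[OF lJ]) (use t in auto)
      have "l (s0, t) \<in> fibre S (h (s0, t))" using lift_on_fibre[OF lt, of "(s0, t)"] J by auto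
      then have "l (s0, t) \<in> fibre S x" using t hx s0 by auto
      then show "lift_on S (J \<times> {t}) h (\<lambda>_. l (s0, t))"
        by (rule lift_on_const) (use t hx J in auto)
      show "connected (J \<times> {t})" using J by (intro connected_Times) auto
    qed (use s J in auto)
    have ends: "transport S (\<lambda>t. h (s, t)) v (l (s0, 1))" if "s \<in> J" for s
      using lift_slice[OF lJ that] side[of 0 s] side[of 1 s] that l(3) by auto
    have pin: "pathin X (\<lambda>t. h (s, t))" if "s \<in> J" for s
    proof -
      have "continuous_map (top_of_set {0..1}) (top_of_set ({0..1} \<times> {0..1})) (Pair s)"
        using that J by (auto intro!: continuous_intros)
      from continuous_map_compose[OF this h] show ?thesis unfolding pathin_def comp_def .
    qed
    have "P s = (w = l (s0, 1))" if "s \<in> J" for s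
      using transport_unique[OF LS pin[OF that] ends[OF that]] ends[OF that] unfolding P_def by metis
    then have "\<forall>s\<in>ball s0 \<delta> \<inter> {0..1}. P s = P s0" using J by (simp add: J_def)
    then show "\<exists>T. open T \<and> s0 \<in> T \<and> (\<forall>s\<in>T \<inter> {0..1}. P s = P s0)"
      using l(1) by (intro exI[of _ "ball s0 \<delta>"]) auto
  qed auto
  moreover have "P 0" using tr h01 unfolding P_def by simp
  ultimately show ?thesis using h01 unfolding P_def by simp
qed

text \<open>Write the exponents of \<alpha> and \<beta> as \<open>a' * e\<close> and
  \<open>b' * e\<close> with \<open>e\<close> their gcd, and let the bit \<open>y\<close> tell
  whether loops of class \<open>e\<close> swap the two points named by \<open>f1\<close> or
  \<open>f2\<close>. Then \<alpha> swaps them iff \<open>a'\<close> is odd and \<open>y\<close>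
  holds, and likewise \<beta> with \<open>b'\<close>. The first system makes \<open>a'\<close> even,
  the second makes it odd.\<close>

lemma infinite_cyclic_parity:
  fixes X :: "'a topology" and S1 S2 :: "('a set \<times> ('a \<Rightarrow> 'f)) set"
  assumes iso: "fundamental_group X x \<cong> integer_group"
    and LS: "local_system X S1" "local_system X S2"
    and \<alpha>: "pathin X \<alpha>" "\<alpha> 0 = x" "\<alpha> 1 = x" and \<beta>: "pathin X \<beta>" "\<beta> 0 = x" "\<beta> 1 = x"
    and f1: "inj f1" "\<And>w. transport S1 \<alpha> (f1 w) (f1 w)" "\<And>w. transport S1 \<beta> (f1 w) (f1 (\<not> w))"
    and f2: "inj f2" "\<And>w. transport S2 \<alpha> (f2 w) (f2 (\<not> w))" "\<And>w. transport S2 \<beta> (f2 w) (f2 w)"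
  shows False
proof -
  let ?G = "fundamental_group X x"
  obtain \<theta> where \<theta>: "\<theta> \<in> iso ?G integer_group" using iso unfolding is_iso_def by blast
  define cl where "cl n = inv_into (carrier ?G) \<theta> n" for n
  have bij: "bij_betw \<theta> (carrier ?G) UNIV" using \<theta> by (auto simp: iso_def integer_group_def)
  have clc: "cl n \<in> carrier ?G" for n unfolding cl_def using bij by (metis UNIV_I bij_betw_imp_surj_on inv_into_into)
  have th: "\<theta> (cl n) = n" for n unfolding cl_def using bij by (metis UNIV_I bij_betw_imp_surj_on f_inv_into_f)
  have sym: "homotopic_loops_at X x q p" if "homotopic_loops_at X x p q" for p q
    using that unfolding homotopic_loops_at_def by (rule homotopic_with_symD)
  have trans: "homotopic_loops_at X x p r" if "homotopic_loops_at X x p q" "homotopic_loops_at X x q r" for p q r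
    using that unfolding homotopic_loops_at_def by (rule homotopic_with_trans)
  have refl: "homotopic_loops_at X x p p" if "p \<in> loops_at X x" for p
    using that unfolding homotopic_loops_at_def loops_at_def pathin_def by auto
  have loop: "p \<in> loops_at X x \<and> q \<in> loops_at X x" if "homotopic_loops_at X x p q" for p q
    using homotopic_with_imp_continuous_maps[OF that[unfolded homotopic_loops_at_def]]
      homotopic_with_imp_property[OF that[unfolded homotopic_loops_at_def]]
    unfolding loops_at_def pathin_def by auto
  have cc: "concat_loops p q \<in> loops_at X x" if "p \<in> loops_at X x" "q \<in> loops_at X x" for p q
    using that pathin_concat_loops[of X p q] unfolding loops_at_def
    by (simp add: concat_loops_def)
  have car: "A \<in> carrier ?G \<longleftrightarrow> (\<exists>p\<in>loops_at X x. A = {q. homotopic_loops_at X x p q})" for A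
    unfolding fundamental_group_def quotient_def by auto
  have hom_cl: "homotopic_loops_at X x p q" if "p \<in> cl n" "q \<in> cl n" for p q n
    using clc[of n] that sym trans unfolding car by blast
  have loop_cl: "p \<in> loops_at X x" if "p \<in> cl n" for p n
    using clc[of n] that loop unfolding car by blast
  have ne_cl: "\<exists>p. p \<in> cl n" for n using clc[of n] refl unfolding car by blast
  have mult: "cl (m + n) = {r. \<exists>p\<in>cl m. \<exists>q\<in>cl n. homotopic_loops_at X x (concat_loops p q) r}" for m n
  proof -
    have hom: "\<theta> \<in> hom ?G integer_group" using \<theta> by (simp add: iso_def)
    obtain p q where pq: "p \<in> cl m" "q \<in> cl n" using ne_cl by metis
    let ?M = "{r. \<exists>p\<in>cl m. \<exists>q\<in>cl n. homotopic_loops_at X x (concat_loops p q) r}"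
    have "?M = {r. homotopic_loops_at X x (concat_loops p q) r}"
    proof (intro Collect_cong iffI)
      fix r assume "\<exists>p\<in>cl m. \<exists>q\<in>cl n. homotopic_loops_at X x (concat_loops p q) r"
      then obtain p' q' where p': "p' \<in> cl m" and q': "q' \<in> cl n" and r: "homotopic_loops_at X x (concat_loops p' q') r"
        by blast
      show "homotopic_loops_at X x (concat_loops p q) r"
        using trans[OF homotopic_loops_at_concat[OF hom_cl[OF pq(1) p'] hom_cl[OF pq(2) q']] r] .
    qed (use pq in blast)
    then have "?M \<in> carrier ?G" using cc pq loop_cl unfolding car by blast
    moreover have "?M = cl m \<otimes>\<^bsub>?G\<^esub> cl n" unfolding fundamental_group_def by simp
    moreover have "\<theta> (cl m \<otimes>\<^bsub>?G\<^esub> cl n) = m + n"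
      using hom_mult[OF hom clc clc] th by simp
    ultimately have "\<theta> (cl (m + n)) = \<theta> ?M" "?M \<in> carrier ?G" using th by simp_all
    then show ?thesis by (rule inj_onD[OF bij_betw_imp_inj_on[OF bij] _ clc])
  qed
  have mem_mult: "concat_loops p q \<in> cl (m + n)" if "p \<in> cl m" "q \<in> cl n" for p q m n
    using that mult[of m n] refl[OF cc[OF loop_cl loop_cl, OF that]] by auto
  have ex_cl: "\<exists>n. \<gamma> \<in> cl n" if "\<gamma> \<in> loops_at X x" for \<gamma>
  proof -
    let ?A = "{q. homotopic_loops_at X x \<gamma> q}"
    have "?A \<in> carrier ?G" using that unfolding car by blast
    then have "cl (\<theta> ?A) = ?A" using bij clc th by (metis bij_betw_imp_inj_on inj_onD)
    then show ?thesis using refl[OF that] by blast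
  qed
  obtain a b where ab: "\<alpha> \<in> cl a" "\<beta> \<in> cl b"
    using ex_cl \<alpha> \<beta> unfolding loops_at_def by blast
  \<comment> \<open>Being a combination of \<open>a\<close> and \<open>b\<close>, the class
    \<open>e\<close> permutes the two chosen fibre points. The class 1 may carry them elsewhere in
    the fibre.\<close>
  define e where "e = gcd a b"
  obtain u v where uv: "u * a + v * b = e" unfolding e_def using bezout_int by metis
  obtain a' b' where a'b': "a = a' * e" "b = b' * e" unfolding e_def by (metis dvd_def gcd_dvd1 gcd_dvd2 mult.commute)
  have key: "\<exists>y. i = (odd a' \<and> y) \<and> j = (odd b' \<and> y)"
    if S: "local_system X S" and f: "inj f" and i: "\<And>w. transport S \<alpha> (f w) (f (w \<noteq> i))"
      and j: "\<And>w. transport S \<beta> (f w) (f (w \<noteq> j))" for S f i j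
  proof -
    \<comment> \<open>The bit \<open>y\<close> tells whether loops of class \<open>n\<close> swap
      the two chosen points; inequality on \<open>bool\<close> is addition mod 2.\<close>
    define Q where "Q n y \<longleftrightarrow> (\<forall>p\<in>cl n. \<forall>w. transport S p (f w) (f (w \<noteq> y)))" for n y
    have pin: "pathin X p \<and> p 0 = x \<and> p 1 = x" if "p \<in> cl n" for p n
      using loop_cl[OF that] unfolding loops_at_def by simp
    have tr: "transport S q c d" if "transport S p c d" "p \<in> cl n" "q \<in> cl n" for p q n c d
      using transport_homotopic[OF S hom_cl that(1)] that(2,3) by blast
    have Qa: "Q a i" "Q b j" using i j tr ab unfolding Q_def by blast+
    have Qadd: "Q (m + n) (y \<noteq> z)" if y: "Q m y" and z: "Q n z" for m n y z
      unfolding Q_def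
    proof (intro ballI allI)
      fix r w assume r: "r \<in> cl (m + n)"
      obtain p q where pq: "p \<in> cl m" "q \<in> cl n" using ne_cl by metis
      have "transport S (concat_loops p q) (f w) (f ((w \<noteq> y) \<noteq> z))"
        by (rule transport_concat[OF S, of p q _ "f (w \<noteq> y)"])
          (use pin pq y z in \<open>auto simp: Q_def\<close>)
      moreover have "((w \<noteq> y) \<noteq> z) = (w \<noteq> (y \<noteq> z))" by auto
      ultimately have "transport S (concat_loops p q) (f w) (f (w \<noteq> (y \<noteq> z)))" by (simp only:)
      then show "transport S r (f w) (f (w \<noteq> (y \<noteq> z)))"
        by (rule tr[OF _ mem_mult[OF pq] r])
    qed
    have fx: "f w \<in> fibre S x" for w
      using transport_fibre1[OF i] \<alpha> by simp
    \<comment> \<open>Both \<open>p\<close> and \<open>p\<close> followed by itself have class 0, so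
      transport along \<open>p\<close> is idempotent; being injective as well, it fixes every
      point.\<close>
    have zero: "c = d" if p: "p \<in> cl 0" and t: "transport S p c d" for p c d
    proof -
      have px: "pathin X p" "p 0 = x" "p 1 = x" using pin[OF p] by auto
      have "d \<in> fibre S (p 0)" using transport_fibre2[OF t] px by simp
      then obtain d' where d': "transport S p d d'" using transport_exists[OF S px(1)] by blast
      have "transport S (concat_loops p p) c d'"
        using transport_concat[OF S px(1) px(1) _ t d'] px by simp
      then have "transport S p c d'" using tr[OF _ mem_mult[OF p p]] p by simp
      then have "d' = d" using transport_unique[OF S px(1)] t by blast
      then show ?thesis using transport_unique'[OF S px(1) t] d' by blast
    qed
    have Q0: "Q 0 False"
      unfolding Q_def
    proof (intro ballI allI)
      fix p w assume p: "p \<in> cl 0"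
      obtain d where "transport S p (f w) d"
        using transport_exists[OF S, of p "f w"] pin[OF p] fx by auto
      then show "transport S p (f w) (f (w \<noteq> False))" using zero[OF p] by auto
    qed
    have Quniq: "y = z" if "Q n y" "Q n z" for n y z
    proof -
      obtain p where p: "p \<in> cl n" using ne_cl by metis
      have "f (True \<noteq> y) = f (True \<noteq> z)"
        using transport_unique[OF S] pin[OF p] that p unfolding Q_def by blast
      then show ?thesis using f by (auto dest: injD)
    qed
    \<comment> \<open>A loop of class \<open>n\<close> followed by one of class \<open>- n\<close>
      acts trivially, and mod 2 adding \<open>y\<close> is its own inverse.\<close>
    have Qneg: "Q (- n) y" if "Q n y" for n y
      unfolding Q_def
    proof (intro ballI allI)
      fix q w assume q: "q \<in> cl (- n)"
      obtain p where p: "p \<in> cl n" using ne_cl by metis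
      have "transport S p (f (w \<noteq> y)) (f ((w \<noteq> y) \<noteq> y))"
        using that p unfolding Q_def by blast
      moreover have "((w \<noteq> y) \<noteq> y) = w" by auto
      ultimately have t1: "transport S p (f (w \<noteq> y)) (f w)" by (simp only:)
      obtain d where d: "transport S q (f w) d"
        using transport_exists[OF S, of q "f w"] pin[OF q] fx by auto
      have "transport S (concat_loops p q) (f (w \<noteq> y)) d"
        using transport_concat[OF S _ _ _ t1 d] pin[OF p] pin[OF q] by simp
      then have "f (w \<noteq> y) = d" using zero[of "concat_loops p q"] mem_mult[OF p q] by simp
      then show "transport S q (f w) (f (w \<noteq> y))" using d by simp
    qed
    have Qnat: "Q (int k * n) (odd k \<and> y)" if "Q n y" for k n y
    proof (induction k)
      case 0
      then show ?case using Q0 by simp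
    next
      case (Suc k)
      have "Q (int k * n + n) ((odd k \<and> y) \<noteq> y)" using Qadd[OF Suc that] .
      moreover have "((odd k \<and> y) \<noteq> y) = (odd (Suc k) \<and> y)" by auto
      ultimately show ?case by (simp add: algebra_simps)
    qed
    have Qint: "Q (k * n) (odd k \<and> y)" if "Q n y" for k n y
    proof (cases "k \<ge> 0")
      case True
      then show ?thesis using Qnat[OF that, of "nat k"] by (simp add: even_nat_iff)
    next
      case False
      then show ?thesis using Qneg[OF Qnat[OF that, of "nat (- k)"]] by (simp add: even_nat_iff)
    qed
    have "Q e ((odd u \<and> i) \<noteq> (odd v \<and> j))"
      using Qadd[OF Qint[OF Qa(1), of u] Qint[OF Qa(2), of v]] uv by simp
    then show ?thesis using Qint Qa Quniq a'b' by metis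
  qed
  obtain y where "\<not> (odd a' \<and> y)" "odd b' \<and> y" using key[OF LS(1) f1(1), of False True] f1 by auto
  moreover obtain z where "odd a' \<and> z" using key[OF LS(2) f2(1), of True False] f2 by auto
  ultimately show False by simp
qed

subsection \<open>Charts preserving the orders of both coordinates\<close>

abbreviation px :: "'a chart \<Rightarrow> 'a \<Rightarrow> real" where "px c q \<equiv> fst (snd c q)"
abbreviation py :: "'a chart \<Rightarrow> 'a \<Rightarrow> real" where "py c q \<equiv> snd (snd c q)"

definition pt :: "'a chart \<Rightarrow> real \<times> real \<Rightarrow> 'a" where
  "pt c = inv_into (fst c) (snd c)"

lemma planar_chart_open: "planar_chart X c \<Longrightarrow> openin X (fst c)"
  unfolding planar_chart_def by (auto simp: case_prod_unfold)

lemma planar_chart_bij: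
  assumes "planar_chart X c" shows "bij_betw (snd c) (fst c) UNIV"
proof -
  have "homeomorphic_map (subtopology X (fst c)) euclidean (snd c)" "openin X (fst c)"
    using assms unfolding planar_chart_def by (auto simp: case_prod_unfold)
  then show ?thesis
    using homeomorphic_imp_injective_map[of "subtopology X (fst c)" euclidean "snd c"]
      homeomorphic_imp_surjective_map[of "subtopology X (fst c)" euclidean "snd c"]
      openin_subset[of X "fst c"]
    by (simp add: bij_betw_def Int_absorb1)
qed

lemma pt_in [simp]: "planar_chart X c \<Longrightarrow> pt c z \<in> fst c"
  unfolding pt_def using planar_chart_bij by (metis UNIV_I bij_betw_imp_surj_on inv_into_into)

lemma snd_pt [simp]: "planar_chart X c \<Longrightarrow> snd c (pt c z) = z"
  unfolding pt_def using planar_chart_bij by (metis UNIV_I bij_betw_imp_surj_on f_inv_into_f)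

lemma pt_snd: "planar_chart X c \<Longrightarrow> q \<in> fst c \<Longrightarrow> pt c (snd c q) = q"
  unfolding pt_def using planar_chart_bij by (metis bij_betw_imp_inj_on inv_into_f_f)

lemma planar_chart_inj: "planar_chart X c \<Longrightarrow> q \<in> fst c \<Longrightarrow> r \<in> fst c \<Longrightarrow> px c q = px c r \<Longrightarrow> py c q = py c r \<Longrightarrow> q = r"
  by (metis pt_snd prod.expand)

lemma planar_chart_preimage_open:
  assumes "planar_chart X c" "open A"
  shows "openin X {q \<in> fst c. snd c q \<in> A}"
proof -
  have hm: "homeomorphic_map (subtopology X (fst c)) euclidean (snd c)" and o: "openin X (fst c)"
    using assms unfolding planar_chart_def by (auto simp: case_prod_unfold)
  have "openin (subtopology X (fst c)) {q \<in> topspace (subtopology X (fst c)). snd c q \<in> A}"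
    using homeomorphic_imp_continuous_map[OF hm] assms(2) by (intro openin_continuous_map_preimage) auto
  moreover have "topspace (subtopology X (fst c)) = fst c" using openin_subset[OF o] by (simp add: Int_absorb1)
  ultimately show ?thesis using openin_open_subtopology[OF o] by (simp only:)
qed

lemma continuous_map_pt:
  assumes "planar_chart X c" shows "continuous_map euclidean X (pt c)"
proof -
  have hm: "homeomorphic_map (subtopology X (fst c)) euclidean (snd c)"
    using assms unfolding planar_chart_def by (auto simp: case_prod_unfold)
  obtain g where g: "homeomorphic_maps (subtopology X (fst c)) euclidean (snd c) g"
    using hm unfolding homeomorphic_map_maps by blast
  then have gc: "continuous_map euclidean (subtopology X (fst c)) g" and "\<forall>z. snd c (g z) = z"
    unfolding homeomorphic_maps_def by auto
  have "g z \<in> fst c" for z using gc by (auto simp: continuous_map_in_subtopology)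
  then have "g z = pt c z" for z
    using \<open>\<forall>z. snd c (g z) = z\<close> pt_snd[OF assms] by metis
  then have "g = pt c" by auto
  then show ?thesis using gc by (simp add: continuous_map_in_subtopology)
qed

lemma planar_chart_image_open:
  assumes "planar_chart X c" "open A"
  shows "openin X (pt c ` A)"
proof -
  have "pt c ` A = {q \<in> fst c. snd c q \<in> A}"
    using assms(1) pt_snd[OF assms(1)] by (auto simp: image_iff) (metis)
  then show ?thesis using planar_chart_preimage_open[OF assms] by simp
qed

lemma planar_chart_continuous:
  assumes c: "planar_chart X c" and a: "continuous_map (top_of_set I) X a" and sub: "\<And>t. t \<in> I \<Longrightarrow> a t \<in> fst c"
  shows "continuous_on I (\<lambda>t. px c (a t))" "continuous_on I (\<lambda>t. py c (a t))"
proof -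
  have hm: "homeomorphic_map (subtopology X (fst c)) euclidean (snd c)"
    using c unfolding planar_chart_def by (auto simp: case_prod_unfold)
  have "continuous_map (top_of_set I) (subtopology X (fst c)) a"
    using a sub by (auto simp: continuous_map_in_subtopology)
  then have "continuous_map (top_of_set I) euclidean (snd c \<circ> a)"
    using homeomorphic_imp_continuous_map[OF hm] by (rule continuous_map_compose)
  then have "continuous_on I (\<lambda>t. snd c (a t))" by (simp add: comp_def)
  then show "continuous_on I (\<lambda>t. px c (a t))" "continuous_on I (\<lambda>t. py c (a t))"
    by (auto intro!: continuous_intros)
qed

text \<open>The order of \<open>y\<close> records the transverse orientation, and the order of \<open>x\<close>
  along the plaques the orientation of the leaves.\<close>

definition same_order :: "'a chart \<Rightarrow> 'a chart \<Rightarrow> 'a set \<Rightarrow> bool" where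
  "same_order c d W \<longleftrightarrow> (\<forall>q\<in>W. \<forall>r\<in>W. (py c q < py c r \<longleftrightarrow> py d q < py d r) \<and>
        (py c q = py c r \<longrightarrow> (px c q < px c r \<longleftrightarrow> px d q < px d r)))"

lemma same_orderD:
  assumes "same_order c d W" "q \<in> W" "r \<in> W"
  shows "py c q < py c r \<longleftrightarrow> py d q < py d r"
    "py c q = py c r \<longleftrightarrow> py d q = py d r"
    "py c q = py c r \<Longrightarrow> px c q < px c r \<longleftrightarrow> px d q < px d r"
proof -
  have *: "py c q < py c r \<longleftrightarrow> py d q < py d r" "py c r < py c q \<longleftrightarrow> py d r < py d q"
    using assms unfolding same_order_def by simp_all
  show "py c q < py c r \<longleftrightarrow> py d q < py d r" by (rule *)
  show "py c q = py c r \<longleftrightarrow> py d q = py d r"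
  proof -
    have "py c q = py c r \<longleftrightarrow> \<not> py c q < py c r \<and> \<not> py c r < py c q" by auto
    moreover have "py d q = py d r \<longleftrightarrow> \<not> py d q < py d r \<and> \<not> py d r < py d q" by auto
    ultimately show ?thesis using * by blast
  qed
  show "py c q = py c r \<Longrightarrow> px c q < px c r \<longleftrightarrow> px d q < px d r"
    using assms unfolding same_order_def by simp
qed

lemma same_order_sym:
  assumes "same_order c d W" shows "same_order d c W"
  unfolding same_order_def
proof (intro ballI)
  fix q r assume "q \<in> W" "r \<in> W"
  note * = same_orderD[OF assms this]
  show "(py d q < py d r) = (py c q < py c r) \<and> (py d q = py d r \<longrightarrow> (px d q < px d r) = (px c q < px c r))"
    using * by blast
qed

lemma same_order_trans:
  assumes "same_order c d W" "same_order d e V" shows "same_order c e (W \<inter> V)"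
  unfolding same_order_def
proof (intro ballI)
  fix q r assume "q \<in> W \<inter> V" "r \<in> W \<inter> V"
  then have qr: "q \<in> W" "r \<in> W" "q \<in> V" "r \<in> V" by auto
  note a = same_orderD[OF assms(1) qr(1,2)] and b = same_orderD[OF assms(2) qr(3,4)]
  show "(py c q < py c r) = (py e q < py e r) \<and> (py c q = py c r \<longrightarrow> (px c q < px c r) = (px e q < px e r))"
    using a b by blast
qed

lemma same_order_refl: "same_order c c W"
  unfolding same_order_def by (intro ballI conjI impI) (rule refl)+

lemma same_order_flip:
  assumes "same_order c d W" "e1 = 1 \<or> e1 = -1" "e2 = 1 \<or> e2 = -1"
  shows "same_order (fst c, \<lambda>q. (e1 * px c q, e2 * py c q)) (fst d, \<lambda>q. (e1 * px d q, e2 * py d q)) W"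
  unfolding same_order_def
proof (intro ballI)
  fix q r assume qr: "q \<in> W" "r \<in> W"
  note a = same_orderD[OF assms(1) qr] and b = same_orderD[OF assms(1) qr(2,1)]
  show "(py (fst c, \<lambda>q. (e1 * px c q, e2 * py c q)) q < py (fst c, \<lambda>q. (e1 * px c q, e2 * py c q)) r) =
     (py (fst d, \<lambda>q. (e1 * px d q, e2 * py d q)) q < py (fst d, \<lambda>q. (e1 * px d q, e2 * py d q)) r) \<and>
     (py (fst c, \<lambda>q. (e1 * px c q, e2 * py c q)) q = py (fst c, \<lambda>q. (e1 * px c q, e2 * py c q)) r \<longrightarrow>
     (px (fst c, \<lambda>q. (e1 * px c q, e2 * py c q)) q < px (fst c, \<lambda>q. (e1 * px c q, e2 * py c q)) r) =
     (px (fst d, \<lambda>q. (e1 * px d q, e2 * py d q)) q < px (fst d, \<lambda>q. (e1 * px d q, e2 * py d q)) r))"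
    using assms(2,3) by (elim disjE; simp; use a(1,2) a(3) b(1) b(3)[OF sym] in blast)
qed

text \<open>Equality of germs of orientations at \<open>p\<close>, for leaves and transversals
  together. It is an equivalence relation on charts at \<open>p\<close>, and its classes are going
  to be the points of the orientation cover.\<close>

definition order_compatible_at :: "'a topology \<Rightarrow> 'a \<Rightarrow> 'a chart \<Rightarrow> 'a chart \<Rightarrow> bool" where
  "order_compatible_at X p c d \<longleftrightarrow>
     (\<exists>W. openin X W \<and> p \<in> W \<and> W \<subseteq> fst c \<inter> fst d \<and> same_order c d W)"

lemma order_compatible_at_sym: "order_compatible_at X p c d \<Longrightarrow> order_compatible_at X p d c"
  unfolding order_compatible_at_def using same_order_sym by blast

lemma order_compatible_at_trans:
  assumes "order_compatible_at X p c d" "order_compatible_at X p d e"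
  shows "order_compatible_at X p c e"
proof -
  obtain W where W: "openin X W" "p \<in> W" "W \<subseteq> fst c \<inter> fst d" "same_order c d W"
    using assms(1) unfolding order_compatible_at_def by blast
  obtain V where V: "openin X V" "p \<in> V" "V \<subseteq> fst d \<inter> fst e" "same_order d e V"
    using assms(2) unfolding order_compatible_at_def by blast
  have "openin X (W \<inter> V)" "p \<in> W \<inter> V" "W \<inter> V \<subseteq> fst c \<inter> fst e" using W V by auto
  then show ?thesis unfolding order_compatible_at_def using same_order_trans[OF W(4) V(4)] by blast
qed

lemma order_compatible_at_refl: "openin X (fst c) \<Longrightarrow> p \<in> fst c \<Longrightarrow> order_compatible_at X p c c"
  unfolding order_compatible_at_def using same_order_refl by (intro exI[of _ "fst c"] conjI) blast+

lemma order_compatible_at_nhd: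
  assumes "order_compatible_at X p c d"
  shows "\<exists>W. openin X W \<and> p \<in> W \<and> (\<forall>q\<in>W. order_compatible_at X q c d)"
  using assms unfolding order_compatible_at_def by blast

section \<open>Sign changes of the two coordinates\<close>

definition flip :: "real \<Rightarrow> real \<Rightarrow> 'a chart \<Rightarrow> 'a chart" where
  "flip e1 e2 c = (fst c, \<lambda>q. (e1 * px c q, e2 * py c q))"

lemma flip_simps [simp]: "fst (flip e1 e2 c) = fst c" "px (flip e1 e2 c) q = e1 * px c q" "py (flip e1 e2 c) q = e2 * py c q"
  by (auto simp: flip_def)

lemma flip_flip: "flip e1 e2 (flip d1 d2 c) = flip (e1 * d1) (e2 * d2) c"
  by (auto simp: flip_def)

lemma flip_1_1 [simp]: "flip 1 1 c = c"
  by (auto simp: flip_def prod_eq_iff)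

definition unit_sign :: "real set" where "unit_sign = {1, -1}"

lemma unit_sign_cases: "e \<in> unit_sign \<Longrightarrow> (e = 1 \<Longrightarrow> P) \<Longrightarrow> (e = -1 \<Longrightarrow> P) \<Longrightarrow> P"
  by (auto simp: unit_sign_def)

lemma planar_chart_flip:
  assumes "planar_chart X c" "e1 \<in> unit_sign" "e2 \<in> unit_sign"
  shows "planar_chart X (flip e1 e2 c)"
proof -
  have hm: "homeomorphic_map (subtopology X (fst c)) euclidean (snd c)" and o: "openin X (fst c)"
    using assms unfolding planar_chart_def by (auto simp: case_prod_unfold)
  define f where "f z = (e1 * fst z, e2 * snd z)" for z :: "real \<times> real"
  have "f (f z) = z" for z using assms(2,3) by (auto simp: f_def unit_sign_def)
  moreover have "continuous_on UNIV f" unfolding f_def by (auto intro!: continuous_intros)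
  ultimately have "homeomorphic_maps euclidean euclidean f f" by (simp add: homeomorphic_maps_def)
  then have "homeomorphic_map euclidean euclidean f" using homeomorphic_map_maps by blast
  then have "homeomorphic_map (subtopology X (fst c)) euclidean (f \<circ> snd c)"
    using hm homeomorphic_map_compose by blast
  moreover have "f \<circ> snd c = snd (flip e1 e2 c)" by (auto simp: f_def flip_def)
  ultimately show ?thesis using o unfolding planar_chart_def by (auto simp: case_prod_unfold)
qed

lemma order_compatible_at_flip:
  assumes "order_compatible_at X p c d" "e1 \<in> unit_sign" "e2 \<in> unit_sign"
  shows "order_compatible_at X p (flip e1 e2 c) (flip e1 e2 d)"
  using assms same_order_flip[of c d _ e1 e2]
  unfolding order_compatible_at_def flip_def unit_sign_def by (auto; blast)

section \<open>Oriented foliations and their leaf paths\<close>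

definition runs :: "'a chart \<Rightarrow> (real \<Rightarrow> 'a) \<Rightarrow> real set \<Rightarrow> bool" where
  "runs c a I \<longleftrightarrow> (\<forall>r\<in>I. a r \<in> fst c) \<and> (\<forall>r\<in>I. \<forall>s\<in>I. py c (a r) = py c (a s)) \<and>
     (\<forall>r\<in>I. \<forall>s\<in>I. r < s \<longrightarrow> px c (a r) < px c (a s))"

lemma runs_subset: "runs c a I \<Longrightarrow> J \<subseteq> I \<Longrightarrow> runs c a J"
  unfolding runs_def by (meson subsetD)

lemma runsD:
  assumes "runs c a I"
  shows "r \<in> I \<Longrightarrow> a r \<in> fst c" "r \<in> I \<Longrightarrow> s \<in> I \<Longrightarrow> py c (a r) = py c (a s)"
    "r \<in> I \<Longrightarrow> s \<in> I \<Longrightarrow> r < s \<Longrightarrow> px c (a r) < px c (a s)"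
  using assms unfolding runs_def by blast+

lemma runsI:
  assumes "\<And>r. r \<in> I \<Longrightarrow> a r \<in> fst c"
    and "\<And>r s. r \<in> I \<Longrightarrow> s \<in> I \<Longrightarrow> r < s \<Longrightarrow> py c (a r) = py c (a s)"
    and "\<And>r s. r \<in> I \<Longrightarrow> s \<in> I \<Longrightarrow> r < s \<Longrightarrow> px c (a r) < px c (a s)"
  shows "runs c a I"
  unfolding runs_def
proof (intro conjI ballI impI)
  fix r s assume "r \<in> I" "s \<in> I"
  then show "py c (a r) = py c (a s)"
  proof (cases r s rule: linorder_cases)
    case less
    show ?thesis by (rule assms(2)) fact+
  next
    case greater
    show ?thesis by (rule assms(2)[symmetric]) fact+
  qed simp
qed (use assms in blast)+

lemma runs_cong:
  assumes "runs c a I" "\<And>t. t \<in> I \<Longrightarrow> a t = b t"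
  shows "runs c b I"
proof (rule runsI)
  fix r assume r: "r \<in> I"
  show "b r \<in> fst c" using runsD(1)[OF assms(1) r] assms(2)[OF r] by (simp only:)
  fix s assume s: "s \<in> I"
  show "py c (b r) = py c (b s)"
    using runsD(2)[OF assms(1) r s] assms(2)[OF r] assms(2)[OF s] by (simp only:)
  assume "r < s"
  then show "px c (b r) < px c (b s)"
    using runsD(3)[OF assms(1) r s] assms(2)[OF r] assms(2)[OF s] by (simp only:)
qed

text \<open>Instantiated by the orientation cover, and again by the same charts with one coordinate
  negated. Statements are thus proved for one direction of the leaves or transversals and
  transferred to the other by \<open>flip_oriented\<close>.\<close>

locale oriented_foliation =
  fixes X :: "'a topology" and F :: "'a chart set"
  assumes Hausdorff: "Hausdorff_space X"
    and planar: "c \<in> F \<Longrightarrow> planar_chart X c"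
    and cover: "\<Union> (fst ` F) = topspace X"
    and oriented: "c \<in> F \<Longrightarrow> d \<in> F \<Longrightarrow> p \<in> fst c \<Longrightarrow> p \<in> fst d \<Longrightarrow> order_compatible_at X p c d"
begin

definition pos :: "(real \<Rightarrow> 'a) \<Rightarrow> real \<Rightarrow> real \<Rightarrow> bool" where
  "pos a u v \<longleftrightarrow> u \<le> v \<and> continuous_map (top_of_set {u..v}) X a \<and>
     (\<forall>t\<in>{u..v}. \<exists>c\<in>F. \<exists>\<epsilon>>0. runs c a ({u..v} \<inter> ball t \<epsilon>))"

lemma flip_oriented:
  assumes "e1 \<in> unit_sign" "e2 \<in> unit_sign"
  shows "oriented_foliation X (flip e1 e2 ` F)"
proof
  show "Hausdorff_space X" by (rule Hausdorff)
  show "planar_chart X c" if "c \<in> flip e1 e2 ` F" for c using that planar planar_chart_flip[OF _ assms] by blast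
  show "\<Union> (fst ` flip e1 e2 ` F) = topspace X" using cover by auto
  show "order_compatible_at X p c d" if cd: "c \<in> flip e1 e2 ` F" "d \<in> flip e1 e2 ` F" "p \<in> fst c" "p \<in> fst d" for p c d
  proof -
    obtain c' d' where "c' \<in> F" "c = flip e1 e2 c'" "d' \<in> F" "d = flip e1 e2 d'" using cd by blast
    then show ?thesis using cd oriented[of c' d' p] order_compatible_at_flip[OF _ assms] by simp
  qed
qed

lemma chart_at: "p \<in> topspace X \<Longrightarrow> \<exists>c\<in>F. p \<in> fst c"
  using cover by auto

text \<open>The definition of \<open>pos\<close> offers some chart at each time; order compatibility
  turns the run in it into a run in any prescribed chart at that point.\<close>

lemma pos_runs:
  assumes a: "pos a u v" and t: "t \<in> {u..v}" and d: "d \<in> F" "a t \<in> fst d" and N: "openin X N" "a t \<in> N"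
  obtains \<epsilon> where "\<epsilon> > 0" "runs d a ({u..v} \<inter> ball t \<epsilon>)" "a ` ({u..v} \<inter> ball t \<epsilon>) \<subseteq> N"
proof -
  obtain c e where c: "c \<in> F" "e > 0" "runs c a ({u..v} \<inter> ball t e)"
    using a t unfolding pos_def by blast
  have cont: "continuous_map (top_of_set {u..v}) X a" using a unfolding pos_def by blast
  have "a t \<in> fst c" using runsD(1)[OF c(3)] t c(2) by auto
  then obtain W where W: "openin X W" "a t \<in> W" "W \<subseteq> fst c \<inter> fst d" "same_order c d W"
    using oriented[OF c(1) d(1)] d(2) unfolding order_compatible_at_def by blast
  have "openin (top_of_set {u..v}) {s \<in> topspace (top_of_set {u..v}). a s \<in> W \<inter> N}"
    using W N by (intro openin_continuous_map_preimage[OF cont]) auto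
  moreover have "t \<in> {s \<in> topspace (top_of_set {u..v}). a s \<in> W \<inter> N}" using t W N by auto
  ultimately obtain e' where e': "e' > 0" "ball t e' \<inter> {u..v} \<subseteq> {s \<in> topspace (top_of_set {u..v}). a s \<in> W \<inter> N}"
    unfolding openin_contains_ball by (metis (no_types, lifting))
  show ?thesis
  proof (rule that[of "min e e'"])
    let ?I = "{u..v} \<inter> ball t (min e e')"
    have sub: "?I \<subseteq> {u..v} \<inter> ball t e" "?I \<subseteq> ball t e' \<inter> {u..v}" by auto
    have aW: "a s \<in> W \<inter> N" if "s \<in> ?I" for s using that e' sub(2) by blast
    have rc: "runs c a ?I" using runs_subset[OF c(3) sub(1)] .
    show "runs d a ?I" unfolding runs_def
    proof (intro conjI ballI impI)
      fix r s assume rs: "r \<in> ?I" "s \<in> ?I"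
      then have "a r \<in> W" "a s \<in> W" using aW by blast+
      note o = same_orderD[OF W(4) this]
      show "a r \<in> fst d" using \<open>a r \<in> W\<close> W(3) by blast
      show "py d (a r) = py d (a s)" using o(2) runsD(2)[OF rc rs] by blast
      assume "r < s"
      then show "px d (a r) < px d (a s)" using o(3)[OF runsD(2)[OF rc rs]] runsD(3)[OF rc rs] by blast
    qed
    show "a ` ?I \<subseteq> N" using aW by blast
  qed (use c e' in auto)
qed

lemma pos_in: "pos a u v \<Longrightarrow> t \<in> {u..v} \<Longrightarrow> a t \<in> topspace X"
  unfolding pos_def continuous_map_def by auto

lemma pos_sub:
  assumes "pos a u v" "u \<le> u'" "u' \<le> v'" "v' \<le> v"
  shows "pos a u' v'"
proof -
  have sub: "{u'..v'} \<subseteq> {u..v}" using assms by auto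
  show ?thesis unfolding pos_def
  proof (intro conjI ballI)
    show "continuous_map (top_of_set {u'..v'}) X a"
      using assms(1) sub unfolding pos_def by (meson continuous_map_from_subtopology_mono)
    fix t assume "t \<in> {u'..v'}"
    then have "t \<in> {u..v}" using sub by blast
    then obtain c e where "c \<in> F" "e > 0" "runs c a ({u..v} \<inter> ball t e)"
      using assms(1) unfolding pos_def by blast
    moreover have "{u'..v'} \<inter> ball t e \<subseteq> {u..v} \<inter> ball t e" using sub by blast
    ultimately show "\<exists>c\<in>F. \<exists>e>0. runs c a ({u'..v'} \<inter> ball t e)" using runs_subset by metis
  qed (use assms in auto)
qed

lemma pos_cong:
  assumes "pos a u v" "\<And>t. t \<in> {u..v} \<Longrightarrow> a t = b t"
  shows "pos b u v"
proof -
  have "continuous_map (top_of_set {u..v}) X b"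
    using assms unfolding pos_def by (auto intro: continuous_map_eq[of _ _ a])
  moreover have "runs c b ({u..v} \<inter> J)" if "runs c a ({u..v} \<inter> J)" for c J
    using runs_cong[OF that] assms(2) by blast
  ultimately show ?thesis using assms(1) unfolding pos_def by meson
qed

lemma pos_shift:
  assumes "pos a u v" shows "pos (\<lambda>t. a (t - k)) (u + k) (v + k)"
  unfolding pos_def
proof (intro conjI ballI)
  have "continuous_map (top_of_set {u+k..v+k}) X (a \<circ> (\<lambda>t. t - k))"
    by (rule continuous_map_compose[of _ "top_of_set {u..v}"])
      (use assms in \<open>auto simp: pos_def intro!: continuous_map_into_subtopology continuous_intros\<close>)
  then show "continuous_map (top_of_set {u+k..v+k}) X (\<lambda>t. a (t - k))" by (simp add: comp_def)
  fix t assume t: "t \<in> {u+k..v+k}"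
  then have "t - k \<in> {u..v}" by auto
  then obtain c e where c: "c \<in> F" "e > 0" "runs c a ({u..v} \<inter> ball (t - k) e)"
    using assms unfolding pos_def by blast
  have *: "s - k \<in> {u..v} \<inter> ball (t - k) e" if "s \<in> {u+k..v+k} \<inter> ball t e" for s
    using that by (auto simp: dist_real_def)
  have "runs c (\<lambda>t. a (t - k)) ({u+k..v+k} \<inter> ball t e)"

  proof (rule runsI)
    fix r assume r: "r \<in> {u+k..v+k} \<inter> ball t e"
    show "a (r - k) \<in> fst c" by (rule runsD(1)[OF c(3) *[OF r]])
    fix s assume s: "s \<in> {u+k..v+k} \<inter> ball t e"
    show "py c (a (r - k)) = py c (a (s - k))" by (rule runsD(2)[OF c(3) *[OF r] *[OF s]])
    assume "r < s"
    then show "px c (a (r - k)) < px c (a (s - k))" by (intro runsD(3)[OF c(3) *[OF r] *[OF s]]) simp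
  qed
  then show "\<exists>c\<in>F. \<exists>e>0. runs c (\<lambda>t. a (t - k)) ({u+k..v+k} \<inter> ball t e)" using c by blast
qed (use assms in \<open>auto simp: pos_def\<close>)

lemma pos_flip:
  assumes "pos a u v" "e2 \<in> unit_sign"
  shows "oriented_foliation.pos X (flip 1 e2 ` F) a u v"
    "oriented_foliation.pos X (flip (-1) e2 ` F) (\<lambda>t. a (- t)) (- v) (- u)"
proof -
  interpret A: oriented_foliation X "flip 1 e2 ` F" using assms by (intro flip_oriented) (auto simp: unit_sign_def)
  interpret B: oriented_foliation X "flip (-1) e2 ` F" using assms by (intro flip_oriented) (auto simp: unit_sign_def)
  have e2: "e2 \<noteq> 0" using assms(2) by (auto simp: unit_sign_def)
  show "A.pos a u v" unfolding A.pos_def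
  proof (intro conjI ballI)
    fix t assume "t \<in> {u..v}"
    then obtain c e where c: "c \<in> F" "e > 0" "runs c a ({u..v} \<inter> ball t e)"
      using assms unfolding pos_def by blast
    have "runs (flip 1 e2 c) a ({u..v} \<inter> ball t e)"

    proof (rule runsI)
      fix r assume r: "r \<in> {u..v} \<inter> ball t e"
      show "a r \<in> fst (flip 1 e2 c)" using runsD(1)[OF c(3) r] by simp
      fix s assume s: "s \<in> {u..v} \<inter> ball t e"
      show "py (flip 1 e2 c) (a r) = py (flip 1 e2 c) (a s)" using runsD(2)[OF c(3) r s] by simp
      assume "r < s"
      then show "px (flip 1 e2 c) (a r) < px (flip 1 e2 c) (a s)" using runsD(3)[OF c(3) r s] by simp
    qed
    then show "\<exists>c\<in>flip 1 e2 ` F. \<exists>e>0. runs c a ({u..v} \<inter> ball t e)" using c by blast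
  qed (use assms in \<open>auto simp: pos_def\<close>)
  show "B.pos (\<lambda>t. a (- t)) (- v) (- u)" unfolding B.pos_def
  proof (intro conjI ballI)
    have "continuous_map (top_of_set {-v..-u}) X (a \<circ> uminus)"
      by (rule continuous_map_compose[of _ "top_of_set {u..v}"])
        (use assms in \<open>auto simp: pos_def intro!: continuous_map_into_subtopology continuous_intros\<close>)
    then show "continuous_map (top_of_set {-v..-u}) X (\<lambda>t. a (- t))" by (simp add: comp_def)
    fix t assume t: "t \<in> {-v..-u}"
    then have "- t \<in> {u..v}" by auto
    then obtain c e where c: "c \<in> F" "e > 0" "runs c a ({u..v} \<inter> ball (- t) e)"
      using assms unfolding pos_def by blast
    have *: "- s \<in> {u..v} \<inter> ball (- t) e" if "s \<in> {-v..-u} \<inter> ball t e" for s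
      using that by (auto simp: dist_real_def)
    have "runs (flip (-1) e2 c) (\<lambda>t. a (- t)) ({-v..-u} \<inter> ball t e)"
    proof (rule runsI)
      fix r assume r: "r \<in> {-v..-u} \<inter> ball t e"
      show "a (- r) \<in> fst (flip (-1) e2 c)" using runsD(1)[OF c(3) *[OF r]] by simp
      fix s assume s: "s \<in> {-v..-u} \<inter> ball t e"
      show "py (flip (-1) e2 c) (a (- r)) = py (flip (-1) e2 c) (a (- s))"
        using runsD(2)[OF c(3) *[OF r] *[OF s]] by simp
      assume "r < s"
      then show "px (flip (-1) e2 c) (a (- r)) < px (flip (-1) e2 c) (a (- s))"
        using runsD(3)[OF c(3) *[OF s] *[OF r]] by simp
    qed
    then show "\<exists>c\<in>flip (-1) e2 ` F. \<exists>e>0. runs c (\<lambda>t. a (- t)) ({-v..-u} \<inter> ball t e)" using c by blast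
  qed (use assms in \<open>auto simp: pos_def\<close>)
qed

end

subsection \<open>Positive leaf paths\<close>

context oriented_foliation
begin

lemma pos_cont: "pos a u v \<Longrightarrow> continuous_map (top_of_set {u..v}) X a"
  unfolding pos_def by blast

lemma pos_le: "pos a u v \<Longrightarrow> u \<le> v"
  unfolding pos_def by blast

lemma pos_image_compact: "pos a u v \<Longrightarrow> compactin X (a ` {u..v})"
  by (rule image_compactin[OF _ pos_cont]) (auto simp: compactin_subtopology)

lemma pos_image_closed: "pos a u v \<Longrightarrow> closedin X (a ` {u..v})"
  using pos_image_compact compactin_imp_closedin[OF Hausdorff] by blast

lemma pos_nhd:
  assumes "pos a u v" "openin X N" "t \<in> {u..v}" "a t \<in> N"
  obtains e where "e > 0" "\<And>s. s \<in> {u..v} \<Longrightarrow> \<bar>s - t\<bar> < e \<Longrightarrow> a s \<in> N"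
proof -
  have "openin (top_of_set {u..v}) {s \<in> topspace (top_of_set {u..v}). a s \<in> N}"
    using assms by (intro openin_continuous_map_preimage[OF pos_cont]) auto
  moreover have "t \<in> {s \<in> topspace (top_of_set {u..v}). a s \<in> N}" using assms by auto
  ultimately obtain e where "e > 0" "ball t e \<inter> {u..v} \<subseteq> {s \<in> topspace (top_of_set {u..v}). a s \<in> N}"
    unfolding openin_contains_ball by (metis (no_types, lifting))
  moreover have "s \<in> ball t e" if "\<bar>s - t\<bar> < e" for s using that by (simp add: dist_real_def abs_minus_commute)
  ultimately show ?thesis using that[of e] by blast
qed

lemma pos_local_run:
  assumes a: "pos a u v" and t: "t \<in> {u..v}" and d: "d \<in> F" "a t \<in> fst d" and N: "openin X N" "a t \<in> N"
  obtains e where "e > 0" "\<And>r s. u \<le> r \<Longrightarrow> s \<le> v \<Longrightarrow> t - e < r \<Longrightarrow> s < t + e \<Longrightarrow> runs d a {r..s}"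
    "\<And>s. s \<in> {u..v} \<Longrightarrow> \<bar>s - t\<bar> < e \<Longrightarrow> a s \<in> N"
proof -
  obtain e where e: "e > 0" "runs d a ({u..v} \<inter> ball t e)" "a ` ({u..v} \<inter> ball t e) \<subseteq> N"
    using pos_runs[OF a t d N] by metis
  show ?thesis
  proof (rule that[OF e(1)])
    fix r s assume rs: "u \<le> r" "s \<le> v" "t - e < r" "s < t + e"
    have "{r..s} \<subseteq> {u..v} \<inter> ball t e" using rs by (auto simp: dist_real_def)
    then show "runs d a {r..s}" by (rule runs_subset[OF e(2)])
  next
    fix s assume "s \<in> {u..v}" "\<bar>s - t\<bar> < e"
    then have "s \<in> {u..v} \<inter> ball t e" by (auto simp: dist_real_def abs_minus_commute)
    then show "a s \<in> N" using e(3) by blast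
  qed
qed

text \<open>Only the joint needs care. There both runs are taken in one chart at \<open>a v\<close>;
  they share the plaque and the value of \<open>px\<close> at that point, so they form one
  run.\<close>

lemma pos_join:
  assumes a: "pos a u v" and b: "pos a v w"
  shows "pos a u w"
  unfolding pos_def
proof (intro conjI ballI)
  have uvw: "u \<le> v" "v \<le> w" using a b pos_le by auto
  then show "u \<le> w" by simp
  have "continuous_map (top_of_set {u..w}) X (\<lambda>t. if t \<le> v then a t else a t)"
  proof (rule continuous_map_cases_le)
    show "continuous_map (top_of_set {u..w}) euclideanreal (\<lambda>t::real. t)" by (auto intro!: continuous_intros)
    have "{u..w} \<inter> {t \<in> topspace (top_of_set {u..w}). t \<le> v} = {u..v}"
      "{u..w} \<inter> {t \<in> topspace (top_of_set {u..w}). v \<le> t} = {v..w}" using uvw by auto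
    then show "continuous_map (subtopology (top_of_set {u..w}) {t \<in> topspace (top_of_set {u..w}). t \<le> v}) X a"
      "continuous_map (subtopology (top_of_set {u..w}) {t \<in> topspace (top_of_set {u..w}). v \<le> t}) X a"
      using pos_cont[OF a] pos_cont[OF b] by (simp_all only: subtopology_subtopology)
  qed auto
  then show "continuous_map (top_of_set {u..w}) X a" by simp
  fix t assume t: "t \<in> {u..w}"
  have tX: "a t \<in> topspace X" using pos_in[OF a, of t] pos_in[OF b, of t] t by (cases "t \<le> v") auto
  then obtain d where d: "d \<in> F" "a t \<in> fst d" using chart_at by blast
  have "\<exists>e>0. \<forall>r s. u \<le> r \<longrightarrow> s \<le> w \<longrightarrow> t - e < r \<longrightarrow> s < t + e \<longrightarrow> runs d a {r..s}"
  proof (cases t v rule: linorder_cases)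
    case less
    then have t': "t \<in> {u..v}" using t by auto
    obtain e where e: "e > 0" "\<And>r s. u \<le> r \<Longrightarrow> s \<le> v \<Longrightarrow> t - e < r \<Longrightarrow> s < t + e \<Longrightarrow> runs d a {r..s}"
      using pos_local_run[OF a t' d openin_topspace tX] by metis
    show ?thesis by (rule exI[of _ "min e (v - t)"]) (use e less in auto)
  next
    case greater
    then have t': "t \<in> {v..w}" using t by auto
    obtain e where e: "e > 0" "\<And>r s. v \<le> r \<Longrightarrow> s \<le> w \<Longrightarrow> t - e < r \<Longrightarrow> s < t + e \<Longrightarrow> runs d a {r..s}"
      using pos_local_run[OF b t' d openin_topspace tX] by metis
    show ?thesis by (rule exI[of _ "min e (t - v)"]) (use e greater in auto)
  next
    case equal
    have t': "t \<in> {u..v}" "t \<in> {v..w}" using equal uvw by auto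
    obtain e where e: "e > 0" "\<And>r s. u \<le> r \<Longrightarrow> s \<le> v \<Longrightarrow> t - e < r \<Longrightarrow> s < t + e \<Longrightarrow> runs d a {r..s}"
      using pos_local_run[OF a t'(1) d openin_topspace tX] by metis
    obtain e' where e': "e' > 0" "\<And>r s. v \<le> r \<Longrightarrow> s \<le> w \<Longrightarrow> t - e' < r \<Longrightarrow> s < t + e' \<Longrightarrow> runs d a {r..s}"
      using pos_local_run[OF b t'(2) d openin_topspace tX] by metis
    show ?thesis
    proof (intro exI[of _ "min e e'"] conjI allI impI)
      show "0 < min e e'" using e e' by simp
      fix r s assume rs: "u \<le> r" "s \<le> w" "t - min e e' < r" "s < t + min e e'"
      have 1: "runs d a {r..t}" if "r \<le> t" using e(2)[of r t] rs equal e(1) by auto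
      have 2: "runs d a {t..s}" if "t \<le> s" using e'(2)[of t s] rs equal e'(1) by auto
      show "runs d a {r..s}"
      proof (rule runsI)
        fix x assume x: "x \<in> {r..s}"
        show "a x \<in> fst d" using runsD(1)[OF 1, of x] runsD(1)[OF 2, of x] x by (cases "x \<le> t") auto
        fix y assume y: "y \<in> {r..s}" and "x < y"
        show "py d (a x) = py d (a y)"
        proof (cases "y \<le> t \<or> t \<le> x")
          case True
          then show ?thesis using runsD(2)[OF 1, of x y] runsD(2)[OF 2, of x y] x y \<open>x < y\<close> by auto
        next
          case False
          then have "py d (a x) = py d (a t)" "py d (a t) = py d (a y)"
            using runsD(2)[OF 1, of x t] runsD(2)[OF 2, of t y] x y by auto
          then show ?thesis by (rule trans)
        qed
        show "px d (a x) < px d (a y)"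
        proof (cases "y \<le> t \<or> t \<le> x")
          case True
          then show ?thesis using runsD(3)[OF 1, of x y] runsD(3)[OF 2, of x y] x y \<open>x < y\<close> by auto
        next
          case False
          then have "px d (a x) < px d (a t)" "px d (a t) < px d (a y)"
            using runsD(3)[OF 1, of x t] runsD(3)[OF 2, of t y] x y by auto
          then show ?thesis by (rule less_trans)
        qed
      qed
    qed
  qed
  then obtain e where e: "e > 0" "\<And>r s. u \<le> r \<Longrightarrow> s \<le> w \<Longrightarrow> t - e < r \<Longrightarrow> s < t + e \<Longrightarrow> runs d a {r..s}"
    by blast
  have "runs d a {max u (t - e/2)..min w (t + e/2)}" using e(1) by (intro e(2)) auto
  then have "runs d a ({u..w} \<inter> ball t (e/2))"
    by (rule runs_subset) (auto simp: dist_real_def abs_real_def split: if_splits)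
  then show "\<exists>c\<in>F. \<exists>\<epsilon>>0. runs c a ({u..w} \<inter> ball t \<epsilon>)" using d e(1) by (intro bexI[of _ d] exI[of _ "e/2"]) auto
qed

lemma pos_concat:
  assumes a: "pos a u v" and b: "pos b u' v'" and ab: "a v = b u'"
  obtains c w where "pos c u w" "c u = a u" "c w = b v'"
proof -
  define c where "c t = (if t \<le> v then a t else b (t - (v - u')))" for t
  have "u' + (v - u') = v" by simp
  then have b': "pos (\<lambda>t. b (t - (v - u'))) v (v' + (v - u'))" using pos_shift[OF b, of "v - u'"] by (simp only:)
  have 1: "pos c u v" by (rule pos_cong[OF a]) (simp add: c_def)
  have 2: "pos c v (v' + (v - u'))"
  proof (rule pos_cong[OF b'])
    fix t assume t: "t \<in> {v..v' + (v - u')}"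
    show "b (t - (v - u')) = c t" using t ab by (cases "t = v") (auto simp: c_def)
  qed
  show ?thesis
  proof (rule that[OF pos_join[OF 1 2]])
    show "c u = a u" using pos_le[OF a] by (simp add: c_def)
    show "c (v' + (v - u')) = b v'"
      using pos_le[OF b] ab by (cases "u' = v'") (auto simp: c_def)
  qed
qed

text \<open>Intermediate value theorem for \<open>px\<close>, which determines a point within its
  plaque.\<close>

lemma run_cover:
  assumes c: "c \<in> F" and r: "runs c a {r..s}" and cont: "continuous_map (top_of_set {r..s}) X a" and "r \<le> s"
    and q: "q \<in> fst c" "py c q = py c (a r)" "px c (a r) \<le> px c q" "px c q \<le> px c (a s)"
  shows "\<exists>t\<in>{r..s}. a t = q"
proof -
  have "continuous_on {r..s} (\<lambda>t. px c (a t))"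
    using planar_chart_continuous(1)[OF planar[OF c] cont] runsD(1)[OF r] by blast
  then obtain t where t: "r \<le> t" "t \<le> s" "px c (a t) = px c q"
    using IVT'[of "\<lambda>t. px c (a t)" r "px c q" s] q assms(4) by blast
  have "py c (a t) = py c (a r)" by (rule runsD(2)[OF r]) (use t assms(4) in auto)
  then have "a t = q" using planar_chart_inj[OF planar[OF c], of "a t" q] runsD(1)[OF r, of t] t q by auto
  then show ?thesis using t by auto
qed

text \<open>Followed backwards from a common point, two positive leaf paths stay on the same plaque for
  a while, so a final piece of one is covered by the other.\<close>

lemma back_overlap:
  assumes a: "pos a u v" and b: "pos b u' v'" and s: "u \<le> s'" "s' < s" "s \<le> v"
    and w: "u' \<le> w'" "w' < w" "w \<le> v'" and eq: "a s = b w"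
  shows "\<exists>r\<in>{s'..<s}. a ` {r..s} \<subseteq> b ` {w'..w}"
proof -
  have s_in: "s \<in> {u..v}" and w_in: "w \<in> {u'..v'}" using s w by auto
  have X: "a s \<in> topspace X" "b w \<in> topspace X" using pos_in[OF a s_in] eq by auto
  then obtain d where d: "d \<in> F" "a s \<in> fst d" "b w \<in> fst d" using chart_at eq by metis
  obtain e where e: "e > 0" "\<And>r s''. u \<le> r \<Longrightarrow> s'' \<le> v \<Longrightarrow> s - e < r \<Longrightarrow> s'' < s + e \<Longrightarrow> runs d a {r..s''}"
    using pos_local_run[OF a s_in d(1,2) openin_topspace X(1)] by metis
  obtain e' where e': "e' > 0" "\<And>r s''. u' \<le> r \<Longrightarrow> s'' \<le> v' \<Longrightarrow> w - e' < r \<Longrightarrow> s'' < w + e' \<Longrightarrow> runs d b {r..s''}"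
    using pos_local_run[OF b w_in d(1,3) openin_topspace X(2)] by metis
  define s1 where "s1 = max s' (s - e/2)"
  define w1 where "w1 = max w' (w - e'/2)"
  have s1: "s' \<le> s1" "s1 < s" "u \<le> s1" using s e by (auto simp: s1_def)
  have w1: "w' \<le> w1" "w1 < w" "u' \<le> w1" using w e' by (auto simp: w1_def)
  have ra: "runs d a {s1..s}" using e s s1 by (intro e(2)) (auto simp: s1_def)
  have rb: "runs d b {w1..w}" using e' w w1 by (intro e'(2)) (auto simp: w1_def)
  have ca: "continuous_map (top_of_set {s1..s}) X a"
    by (rule pos_cont, rule pos_sub[OF a]) (use s s1 in auto)
  have cb: "continuous_map (top_of_set {w1..w}) X b"
    by (rule pos_cont, rule pos_sub[OF b]) (use w w1 in auto)
  have pya: "py d (a r) = py d (a s)" if "r \<in> {s1..s}" for r using runsD(2)[OF ra that, of s] s1 by auto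
  have pyb: "py d (b r) = py d (b w)" if "r \<in> {w1..w}" for r using runsD(2)[OF rb that, of w] w1 by auto
  have mono: "px d (a r) \<le> px d (a r')" if "r \<in> {s1..s}" "r' \<in> {s1..s}" "r \<le> r'" for r r'
    using runsD(3)[OF ra that(1,2)] that(3) by (cases "r = r'") auto
  have cover: "a r \<in> b ` {w'..w}" if r: "r \<in> {s1..s}" "px d (b w1) \<le> px d (a r)" for r
  proof -
    have "\<exists>t\<in>{w1..w}. b t = a r"
    proof (rule run_cover[OF d(1) rb cb])
      show "a r \<in> fst d" by (rule runsD(1)[OF ra r(1)])
      show "py d (a r) = py d (b w1)" using pya[OF r(1)] pyb[of w1] eq w1 by simp
      show "px d (a r) \<le> px d (b w)" using mono[of r s] r s1 eq by simp
    qed (use w1 r in auto)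
    then obtain t where "t \<in> {w1..w}" "b t = a r" by blast
    then show ?thesis using w1 by (intro image_eqI[of _ _ t]) auto
  qed
  \<comment> \<open>On the common plaque either \<open>b\<close> reaches back at least as far as
    \<open>a\<close>, or \<open>a\<close> is cut at the time when it passes
    \<open>b w1\<close>.\<close>
  show ?thesis
  proof (cases "px d (b w1) \<le> px d (a s1)")
    case True
    have "a ` {s1..s} \<subseteq> b ` {w'..w}"
    proof (rule image_subsetI)
      fix r assume "r \<in> {s1..s}"
      then show "a r \<in> b ` {w'..w}" using cover[of r] mono[of s1 r] True s1 by auto
    qed
    then show ?thesis using s1 by (intro bexI[of _ s1]) auto
  next
    case False
    have lt: "px d (b w1) < px d (b w)" by (rule runsD(3)[OF rb]) (use w1 in auto)
    have "\<exists>t\<in>{s1..s}. a t = b w1"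
    proof (rule run_cover[OF d(1) ra ca])
      show "b w1 \<in> fst d" by (rule runsD(1)[OF rb]) (use w1 in auto)
      show "py d (b w1) = py d (a s1)" using pya[of s1] pyb[of w1] eq w1 s1 by simp
      show "px d (b w1) \<le> px d (a s)" using lt eq by simp
    qed (use s1 False in auto)
    then obtain t where t: "t \<in> {s1..s}" "a t = b w1" by blast
    have "t \<noteq> s" using t(2) lt eq by auto
    have "a ` {t..s} \<subseteq> b ` {w'..w}"
    proof (rule image_subsetI)
      fix r assume "r \<in> {t..s}"
      then show "a r \<in> b ` {w'..w}" using cover[of r] mono[of t r] t by auto
    qed
    then show ?thesis using t s1 \<open>t \<noteq> s\<close> by (intro bexI[of _ t]) auto
  qed
qed

text \<open>Suppose neither start lies on the other path. The image of \<open>b\<close> is compact,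
  hence closed, so at the supremum \<open>s\<close> of the times when \<open>a\<close> is off it,
  \<open>a\<close> is already on it, at a point other than the start of \<open>b\<close>. By
  \<open>back_overlap\<close> a piece of \<open>a\<close> before \<open>s\<close> lies on
  \<open>b\<close> too, against the choice of \<open>s\<close>.\<close>

lemma backward_determinism:
  assumes a: "pos a u v" and b: "pos b u' v'" and ab: "a v = b v'"
  shows "a u \<in> b ` {u'..v'} \<or> b u' \<in> a ` {u..v}"
proof (rule ccontr)
  assume neg: "\<not> ?thesis"
  define B where "B = b ` {u'..v'}"
  define K where "K = {t \<in> {u..v}. a t \<notin> B}"
  have uv: "u \<le> v" "u' \<le> v'" using pos_le a b by auto
  have oB: "openin X (topspace X - B)" unfolding B_def using pos_image_closed[OF b] by blast
  have "u \<in> K" using neg uv unfolding K_def B_def by auto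
  have Kb: "bdd_above K" unfolding K_def by (rule bdd_aboveI[of _ v]) auto
  define s where "s = Sup K"
  have su: "u \<le> s" unfolding s_def by (rule cSup_upper[OF \<open>u \<in> K\<close> Kb])
  have sv: "s \<le> v" unfolding s_def by (rule cSup_least) (use \<open>u \<in> K\<close> in \<open>auto simp: K_def\<close>)
  have vB: "a v \<in> B" unfolding B_def ab using uv by auto
  have sK: "s \<notin> K"
  proof
    assume "s \<in> K"
    then have "s \<noteq> v" using vB by (auto simp: K_def)
    have "a s \<in> topspace X - B" using \<open>s \<in> K\<close> pos_in[OF a] by (auto simp: K_def)
    then obtain e where e: "e > 0" "\<And>t. t \<in> {u..v} \<Longrightarrow> \<bar>t - s\<bar> < e \<Longrightarrow> a t \<in> topspace X - B"
      using pos_nhd[OF a oB, of s] su sv by auto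
    define t where "t = min v (s + e/2)"
    have t: "t \<in> {u..v}" "\<bar>t - s\<bar> < e" "s < t" using e(1) su sv \<open>s \<noteq> v\<close> by (auto simp: t_def)
    then have "t \<in> K" using e(2)[of t] by (auto simp: K_def)
    then have "t \<le> s" unfolding s_def by (rule cSup_upper[OF _ Kb])
    then show False using t by simp
  qed
  then have "u < s" using su \<open>u \<in> K\<close> by (cases "u = s") auto
  have "a s \<in> B" using sK su sv by (auto simp: K_def)
  then obtain w where w: "w \<in> {u'..v'}" "a s = b w" by (auto simp: B_def)
  have "w \<noteq> u'" using neg w su sv by force
  then obtain r where r: "r \<in> {u..<s}" "a ` {r..s} \<subseteq> b ` {u'..w}"
    using back_overlap[OF a b order_refl \<open>u < s\<close> sv order_refl _ _ w(2)] w(1) by auto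
  have "t \<le> r" if "t \<in> K" for t
  proof (rule ccontr)
    assume "\<not> t \<le> r"
    moreover have "t \<le> s" unfolding s_def by (rule cSup_upper[OF that Kb])
    ultimately have "a t \<in> b ` {u'..w}" using r(2) by auto
    then show False using that w(1) by (auto simp: K_def B_def)
  qed
  then have "s \<le> r" unfolding s_def by (intro cSup_least) (use \<open>u \<in> K\<close> in auto)
  then show False using r by auto
qed

lemma forward_determinism:
  assumes a: "pos a u v" and b: "pos b u' v'" and ab: "a u = b u'"
  shows "a v \<in> b ` {u'..v'} \<or> b v' \<in> a ` {u..v}"
proof -
  have s1: "1 \<in> unit_sign" "-1 \<in> unit_sign" by (auto simp: unit_sign_def)
  interpret B: oriented_foliation X "flip (-1) 1 ` F" by (rule flip_oriented[OF s1(2,1)])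
  have im: "(\<lambda>t. f (- t)) ` {-y..-x} = f ` {x..y}" for f :: "real \<Rightarrow> 'a" and x y
  proof -
    have "uminus ` {-y..-x} = {x..y}" by auto
    then show ?thesis by (metis (no_types, lifting) image_cong image_image)
  qed
  have "a (- (- v)) \<in> (\<lambda>t. b (- t)) ` {-v'..-u'} \<or> b (- (- v')) \<in> (\<lambda>t. a (- t)) ` {-v..-u}"
    by (rule B.backward_determinism[OF pos_flip(2)[OF a s1(1)] pos_flip(2)[OF b s1(1)]]) (simp add: ab)
  then show ?thesis by (simp only: im minus_minus)
qed

section \<open>The order along a leaf\<close>

definition reach :: "'a \<Rightarrow> 'a \<Rightarrow> bool" where
  "reach p q \<longleftrightarrow> (\<exists>a u v. pos a u v \<and> a u = p \<and> a v = q)"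

lemma reach_trans: "reach p q \<Longrightarrow> reach q r \<Longrightarrow> reach p r"
  unfolding reach_def by (metis pos_concat)

lemma pos_reach:
  assumes "pos a u v" "u \<le> s" "s \<le> t" "t \<le> v" shows "reach (a s) (a t)"
  unfolding reach_def using pos_sub[OF assms] by blast

lemma reach_back: "reach p z \<Longrightarrow> reach q z \<Longrightarrow> reach p q \<or> reach q p"
proof -
  assume "reach p z" "reach q z"
  then obtain a u v b u' v' where a: "pos a u v" "a u = p" "a v = z" and b: "pos b u' v'" "b u' = q" "b v' = z"
    unfolding reach_def by blast
  have "p \<in> b ` {u'..v'} \<or> q \<in> a ` {u..v}"
    using backward_determinism[OF a(1) b(1)] a b by simp
  then show ?thesis using pos_reach[OF a(1) order_refl] pos_reach[OF b(1) order_refl] a b by auto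
qed

lemma reach_forth: "reach z p \<Longrightarrow> reach z q \<Longrightarrow> reach p q \<or> reach q p"
proof -
  assume "reach z p" "reach z q"
  then obtain a u v b u' v' where a: "pos a u v" "a u = z" "a v = p" and b: "pos b u' v'" "b u' = z" "b v' = q"
    unfolding reach_def by blast
  have "p \<in> b ` {u'..v'} \<or> q \<in> a ` {u..v}"
    using forward_determinism[OF a(1) b(1)] a b by simp
  then show ?thesis using pos_reach[OF a(1) _ _ order_refl] pos_reach[OF b(1) _ _ order_refl] a b by auto
qed

lemma plaque_pos:
  assumes c: "c \<in> F" and "x \<le> x'"
  shows "pos (\<lambda>t. pt c (t, y)) x x'"
  unfolding pos_def
proof (intro conjI ballI)
  have "continuous_map (top_of_set {x..x'}) X (pt c \<circ> (\<lambda>t. (t, y)))"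
    by (rule continuous_map_compose[OF _ continuous_map_pt[OF planar[OF c]]]) (auto intro!: continuous_intros)
  then show "continuous_map (top_of_set {x..x'}) X (\<lambda>t. pt c (t, y))" by (simp add: comp_def)
  fix t
  have "runs c (\<lambda>t. pt c (t, y)) ({x..x'} \<inter> ball t 1)"
    by (rule runsI) (simp_all add: pt_in[OF planar[OF c]] snd_pt[OF planar[OF c]])
  then show "\<exists>c'\<in>F. \<exists>\<epsilon>>0. runs c' (\<lambda>t. pt c (t, y)) ({x..x'} \<inter> ball t \<epsilon>)"
    using c by (intro bexI[of _ c] exI[of _ 1]) auto
qed (use assms in auto)

lemma plaque_reach:
  assumes c: "c \<in> F" and p: "p \<in> fst c" "q \<in> fst c" "py c p = py c q" "px c p \<le> px c q"
  shows "reach p q"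
proof -
  have "pt c (px c p, py c p) = p" "pt c (px c q, py c p) = q"
    using pt_snd[OF planar[OF c] p(1)] pt_snd[OF planar[OF c] p(2)] p(3) by (metis prod.collapse)+
  then show ?thesis unfolding reach_def using plaque_pos[OF c p(4), of "py c p"] by blast
qed

text \<open>The points of a plaque are comparable under \<open>reach\<close>. Comparability passes
  along a chain of plaques because two points that reach a common point, or are reached from one,
  are comparable by determinism.\<close>

lemma same_leaf_reach:
  assumes "(p, q) \<in> same_leaf F"
  shows "reach p q \<or> reach q p"
proof -
  have step: "reach p q \<or> reach q p" if "\<exists>P\<in>plaques F. p \<in> P \<and> q \<in> P" for p q
  proof -
    obtain U \<phi> y where c: "(U, \<phi>) \<in> F" "p \<in> U" "q \<in> U" "snd (\<phi> p) = y" "snd (\<phi> q) = y"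
      using \<open>\<exists>P\<in>plaques F. p \<in> P \<and> q \<in> P\<close> unfolding plaques_def by auto
    show ?thesis using plaque_reach[OF c(1), of p q] plaque_reach[OF c(1), of q p] c
      by (cases "fst (\<phi> p) \<le> fst (\<phi> q)") auto
  qed
  show ?thesis
    using assms unfolding same_leaf_def
  proof (induction rule: trancl_induct)
    case (base q)
    then show ?case using step by blast
  next
    case (step q r)
    then have "reach q r \<or> reach r q" using \<open>\<And>p q. \<exists>P\<in>plaques F. p \<in> P \<and> q \<in> P \<Longrightarrow> reach p q \<or> reach q p\<close> by blast
    then show ?case using step.IH reach_trans reach_back reach_forth by blast
  qed
qed

section \<open>Transversal segments and return times\<close>

definition seg :: "'a chart \<Rightarrow> real \<Rightarrow> real \<Rightarrow> 'a set" where
  "seg c y1 y2 = (\<lambda>y. pt c (0, y)) ` {y1..y2}"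

lemma seg_closed: "c \<in> F \<Longrightarrow> closedin X (seg c y1 y2)"
proof -
  assume c: "c \<in> F"
  have "continuous_map (top_of_set {y1..y2}) X (pt c \<circ> (\<lambda>y. (0, y)))"
    by (rule continuous_map_compose[OF _ continuous_map_pt[OF planar[OF c]]]) (auto intro!: continuous_intros)
  then have "compactin X ((pt c \<circ> (\<lambda>y. (0, y))) ` {y1..y2})"
    by (intro image_compactin) (auto simp: compactin_subtopology)
  then show ?thesis unfolding seg_def using compactin_imp_closedin[OF Hausdorff] by (simp add: image_image comp_def)
qed

lemma seg_iff: "c \<in> F \<Longrightarrow> q \<in> seg c y1 y2 \<longleftrightarrow> q \<in> fst c \<and> px c q = 0 \<and> py c q \<in> {y1..y2}"
proof -
  assume c: "c \<in> F"
  have "q = pt c (0, py c q)" if "q \<in> fst c" "px c q = 0"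
    using pt_snd[OF planar[OF c] that(1)] that(2) by (metis prod.collapse)
  then show ?thesis unfolding seg_def using planar[OF c] by auto
qed

text \<open>Return times cannot accumulate at \<open>t\<close>: if \<open>a t\<close> is on the
  segment, \<open>px\<close> vanishes at \<open>t\<close> and is strictly monotone nearby; otherwise
  \<open>a\<close> avoids the closed segment near \<open>t\<close>. Finiteness is what makes first
  and last returns available.\<close>

lemma finite_returns:
  assumes a: "pos a u v" and c: "c \<in> F"
  shows "finite {t \<in> {u..v}. a t \<in> seg c y1 y2}" (is "finite ?H")
proof (rule ccontr)
  assume "infinite ?H"
  then obtain t where t: "t \<in> {u..v}" "t islimpt ?H"
    using compact_eq_Bolzano_Weierstrass[of "{u..v}"] by (metis (no_types, lifting) compact_Icc mem_Collect_eq subsetI)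
  have tX: "a t \<in> topspace X" using pos_in[OF a t(1)] .
  show False
  proof (cases "a t \<in> seg c y1 y2")
    case True
    then have tc: "a t \<in> fst c" "px c (a t) = 0" using seg_iff[OF c] by auto
    obtain e where e: "e > 0" "\<And>r s. u \<le> r \<Longrightarrow> s \<le> v \<Longrightarrow> t - e < r \<Longrightarrow> s < t + e \<Longrightarrow> runs c a {r..s}"
      using pos_local_run[OF a t(1) c tc(1) openin_topspace tX] by metis
    obtain s where s: "s \<in> ?H" "s \<noteq> t" "dist s t < e" using t(2) e(1) unfolding islimpt_approachable by blast
    then have "px c (a s) = 0" using seg_iff[OF c] by auto
    moreover have "px c (a s) \<noteq> px c (a t)"
    proof (cases "s < t")
      case True
      have "runs c a {s..t}" using s t by (intro e(2)) (use True e(1) in \<open>auto simp: dist_real_def\<close>)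
      then show ?thesis using runsD(3)[of c a "{s..t}" s t] True by auto
    next
      case False
      then have "t < s" using s by auto
      have "runs c a {t..s}" using s t by (intro e(2)) (use \<open>t < s\<close> e(1) in \<open>auto simp: dist_real_def\<close>)
      then show ?thesis using runsD(3)[of c a "{t..s}" t s] \<open>t < s\<close> by auto
    qed
    ultimately show False using tc by simp
  next
    case False
    have "openin X (topspace X - seg c y1 y2)" using seg_closed[OF c] by blast
    then obtain e where e: "e > 0" "\<And>s. s \<in> {u..v} \<Longrightarrow> \<bar>s - t\<bar> < e \<Longrightarrow> a s \<in> topspace X - seg c y1 y2"
      using pos_nhd[OF a _ t(1)] False tX by (metis Diff_iff)
    obtain s where s: "s \<in> ?H" "s \<noteq> t" "dist s t < e" using t(2) e(1) unfolding islimpt_approachable by blast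
    then show False using e(2)[of s] by (auto simp: dist_real_def)
  qed
qed

text \<open>The infimum of the times whose point is visited again later is attained, and
  \<open>back_overlap\<close> would move it further back unless it is \<open>u\<close>. Hence only
  returns to the start have to be excluded.\<close>

lemma pos_inj:
  assumes a: "pos a u v" and start: "a u \<notin> a ` {u<..v}"
  shows "inj_on a {u..v}"
proof (rule ccontr)
  assume "\<not> inj_on a {u..v}"
  define P where "P = {s \<in> {u..v}. \<exists>t\<in>{u..v}. s < t \<and> a s = a t}"
  have "P \<noteq> {}"
  proof -
    obtain s t where "s \<in> {u..v}" "t \<in> {u..v}" "s \<noteq> t" "a s = a t"
      using \<open>\<not> inj_on a {u..v}\<close> unfolding inj_on_def by blast
    then have "s \<in> P \<or> t \<in> P" unfolding P_def by (cases s t rule: linorder_cases) auto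
    then show ?thesis by blast
  qed
  have Pb: "bdd_below P" unfolding P_def by (rule bdd_belowI[of _ u]) auto
  define s where "s = Inf P"
  have us: "u \<le> s" unfolding s_def by (rule cInf_greatest[OF \<open>P \<noteq> {}\<close>]) (auto simp: P_def)
  obtain p0 where "p0 \<in> P" using \<open>P \<noteq> {}\<close> by blast
  have sv: "s \<le> v" using cInf_lower[OF \<open>p0 \<in> P\<close> Pb] \<open>p0 \<in> P\<close> by (auto simp: s_def P_def)
  have s_in: "s \<in> {u..v}" using us sv by simp
  have sX: "a s \<in> topspace X" using pos_in[OF a s_in] .
  then obtain d where d: "d \<in> F" "a s \<in> fst d" using chart_at by blast
  obtain e where e: "e > 0" "\<And>r t. u \<le> r \<Longrightarrow> t \<le> v \<Longrightarrow> s - e < r \<Longrightarrow> t < s + e \<Longrightarrow> runs d a {r..t}"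
    using pos_local_run[OF a s_in d openin_topspace sX] by metis
  have "s \<in> P"
  proof (rule ccontr)
    assume "s \<notin> P"
    \<comment> \<open>The points visited at least \<open>e/2\<close> after \<open>s\<close> form a
      closed set that misses \<open>a s\<close>. A time close to \<open>s\<close> can therefore be
      revisited only within the run around \<open>s\<close>, where \<open>px\<close> increases
      strictly.\<close>
    define B where "B = a ` {max u (s + e/2)..v}"
    have cB: "closedin X B"
    proof (cases "max u (s + e/2) \<le> v")
      case True
      then show ?thesis unfolding B_def by (intro pos_image_closed pos_sub[OF a]) auto
    next
      case False
      then show ?thesis by (simp add: B_def)
    qed
    have "a s \<notin> B" using \<open>s \<notin> P\<close> s_in e(1) unfolding B_def P_def by force
    then obtain e' where e': "e' > 0" "\<And>t. t \<in> {u..v} \<Longrightarrow> \<bar>t - s\<bar> < e' \<Longrightarrow> a t \<in> topspace X - B"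
      using pos_nhd[OF a _ s_in, of "topspace X - B"] cB sX by auto
    obtain p where p: "p \<in> P" "p < s + min e' (e/2)"
      using cInf_lessD[OF \<open>P \<noteq> {}\<close>, of "s + min e' (e/2)"] e e' by (auto simp: s_def)
    have "s \<le> p" unfolding s_def by (rule cInf_lower[OF p(1) Pb])
    then have "a p \<in> topspace X - B" using p e'(2)[of p] by (auto simp: P_def)
    obtain q where q: "q \<in> {u..v}" "p < q" "a p = a q" using p(1) by (auto simp: P_def)
    have "q < s + e/2" using \<open>a p \<in> topspace X - B\<close> q by (force simp: B_def)
    then have "runs d a {p..q}" using p(1) q \<open>s \<le> p\<close> e(1) by (intro e(2)) (auto simp: P_def)
    then have "px d (a p) < px d (a q)" by (rule runsD(3)) (use q in auto)
    then show False using q by simp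
  qed
  then obtain t where t: "t \<in> {u..v}" "s < t" "a s = a t" by (auto simp: P_def)
  have "u < s" using start t us by (cases "u = s") auto
  obtain r where r: "r \<in> {u..<s}" "a ` {r..s} \<subseteq> a ` {s..t}"
    using back_overlap[OF a a order_refl \<open>u < s\<close> sv us t(2) _ t(3)] t(1) by auto
  then have "a r \<in> a ` {s..t}" by auto
  then obtain q where q: "q \<in> {s..t}" "a r = a q" by blast
  then have "r \<in> P" using r(1) t sv by (auto simp: P_def intro!: bexI[of _ q])
  then have "s \<le> r" unfolding s_def by (rule cInf_lower[OF _ Pb])
  then show False using r by auto
qed

end

subsection \<open>Cutting along a two-sided curve\<close>

text \<open>\<open>P\<close> marks one side of \<open>C\<close> inside \<open>N\<close>. Both sides
  are open, and near each point \<open>z\<close> of \<open>C\<close> the marked side is the one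
  prescribed by the transverse orientation \<open>upper z\<close>, of which only the germ at
  \<open>z\<close> off \<open>C\<close> is seen. \<open>N\<close> may also miss \<open>C\<close>
  altogether.\<close>

definition side_chart :: "'a topology \<Rightarrow> 'a set \<Rightarrow> ('a \<Rightarrow> 'a set) \<Rightarrow> 'a set \<Rightarrow> 'a set \<Rightarrow> bool" where
  "side_chart X C upper N P \<longleftrightarrow> openin X N \<and> openin X (N \<inter> P - C) \<and> openin X (N - P - C) \<and>
     (\<forall>z\<in>N \<inter> C. \<exists>W. openin X W \<and> z \<in> W \<and> (\<forall>q\<in>W - C. q \<in> P \<longleftrightarrow> q \<in> upper z))"

definition two_sided :: "'a topology \<Rightarrow> 'a set \<Rightarrow> ('a \<Rightarrow> 'a set) \<Rightarrow> bool" where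
  "two_sided X C upper \<longleftrightarrow> closedin X C \<and> (\<forall>z\<in>C. \<exists>N P. z \<in> N \<and> side_chart X C upper N P)"

text \<open>In the double cover obtained by cutting along \<open>C\<close>, a point off \<open>C\<close> is labelled
  by its sheet, whereas a point of \<open>C\<close> is labelled by the sheet of its lower side. Crossing
  \<open>C\<close> therefore flips the label once.\<close>

definition side_label :: "'a set \<Rightarrow> 'a set \<Rightarrow> bool \<Rightarrow> 'a \<Rightarrow> bool" where
  "side_label C P w m = (if m \<in> C then w else (w \<noteq> (m \<in> P)))"

definition cut_system :: "'a topology \<Rightarrow> 'a set \<Rightarrow> ('a \<Rightarrow> 'a set) \<Rightarrow> ('a set \<times> ('a \<Rightarrow> bool)) set" where
  "cut_system X C upper = {(N, side_label C P w) | N P w. side_chart X C upper N P}"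

lemma cut_systemI: "side_chart X C upper N P \<Longrightarrow> (N, side_label C P w) \<in> cut_system X C upper"
  unfolding cut_system_def by blast

lemma side_chart_complement: "closedin X C \<Longrightarrow> side_chart X C upper (topspace X - C) {}"
  unfolding side_chart_def by auto

text \<open>On \<open>C\<close> the comparison reduces to \<open>w = w'\<close> and stays so nearby,
  because \<open>P\<close> and \<open>P'\<close> both follow \<open>upper z\<close>; off
  \<open>C\<close> both labels are locally constant.\<close>

lemma side_label_compare:
  assumes C: "closedin X C" and 1: "side_chart X C upper N P" and 2: "side_chart X C upper N' P'"
    and z: "z \<in> N" "z \<in> N'"
  shows "\<exists>W. openin X W \<and> z \<in> W \<and> W \<subseteq> N \<inter> N' \<and>
     (\<forall>q\<in>W. (side_label C P w q = side_label C P' w' q) = (side_label C P w z = side_label C P' w' z))"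
proof -
  have o: "openin X N" "openin X N'" "openin X (N \<inter> P - C)" "openin X (N - P - C)"
    "openin X (N' \<inter> P' - C)" "openin X (N' - P' - C)"
    using 1 2 unfolding side_chart_def by auto
  show ?thesis
  proof (cases "z \<in> C")
    case True
    obtain W where W: "openin X W" "z \<in> W" "\<forall>q\<in>W - C. q \<in> P \<longleftrightarrow> q \<in> upper z"
      using 1 z True unfolding side_chart_def by blast
    obtain W' where W': "openin X W'" "z \<in> W'" "\<forall>q\<in>W' - C. q \<in> P' \<longleftrightarrow> q \<in> upper z"
      using 2 z True unfolding side_chart_def by blast
    have "(side_label C P w q = side_label C P' w' q) = (w = w')" if "q \<in> W \<inter> W'" for q
      using W(3) W'(3) that unfolding side_label_def by auto
    moreover have "side_label C P w z = w" "side_label C P' w' z = w'" using True by (auto simp: side_label_def)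
    ultimately show ?thesis
      using o W W' z by (intro exI[of _ "W \<inter> W' \<inter> N \<inter> N'"]) auto
  next
    case False
    define A where "A = (if z \<in> P then N \<inter> P - C else N - P - C)"
    define B where "B = (if z \<in> P' then N' \<inter> P' - C else N' - P' - C)"
    have "openin X (A \<inter> B)" using o by (auto simp: A_def B_def)
    moreover have "z \<in> A \<inter> B" "A \<inter> B \<subseteq> N \<inter> N'" using z False by (auto simp: A_def B_def)
    moreover have "(side_label C P w q = side_label C P' w' q) = (side_label C P w z = side_label C P' w' z)"
      if "q \<in> A \<inter> B" for q
    proof -
      have "side_label C P w q = side_label C P w z" "side_label C P' w' q = side_label C P' w' z"
        using that False unfolding side_label_def A_def B_def by (auto split: if_splits)
      then show ?thesis by (simp only:)
    qed
    ultimately show ?thesis by blast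
  qed
qed

lemma local_system_cut:
  assumes ts: "two_sided X C upper"
  shows "local_system X (cut_system X C upper)"
proof -
  have C: "closedin X C" using ts unfolding two_sided_def by blast
  have cmp: "openin X {m \<in> N \<inter> N'. (\<sigma> m = \<sigma>' m) = b}"
    if m1: "(N, \<sigma>) \<in> cut_system X C upper" and m2: "(N', \<sigma>') \<in> cut_system X C upper" for N \<sigma> N' \<sigma>' b
  proof -
    obtain P w where 1: "side_chart X C upper N P" "\<sigma> = side_label C P w" using m1 unfolding cut_system_def by auto
    obtain P' w' where 2: "side_chart X C upper N' P'" "\<sigma>' = side_label C P' w'" using m2 unfolding cut_system_def by auto
    show ?thesis
    proof (subst openin_subopen, rule ballI)
      fix z assume "z \<in> {m \<in> N \<inter> N'. (\<sigma> m = \<sigma>' m) = b}"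
      then have z: "z \<in> N" "z \<in> N'" "(\<sigma> z = \<sigma>' z) = b" by auto
      obtain W where W: "openin X W" "z \<in> W" "W \<subseteq> N \<inter> N'"
        "\<forall>q\<in>W. (\<sigma> q = \<sigma>' q) = (\<sigma> z = \<sigma>' z)"
        using side_label_compare[OF C 1(1) 2(1) z(1,2), of w w'] 1(2) 2(2) by blast
      then show "\<exists>T. openin X T \<and> z \<in> T \<and> T \<subseteq> {m \<in> N \<inter> N'. (\<sigma> m = \<sigma>' m) = b}"
        using z(3) by (intro exI[of _ W]) auto
    qed
  qed
  have even: "evenly_covers (cut_system X C upper) N" if N: "side_chart X C upper N P" for N P
    unfolding evenly_covers_def
  proof (intro allI impI)
    fix N1 \<sigma>1 m
    show "\<exists>N2 \<sigma>2. (N2, \<sigma>2) \<in> cut_system X C upper \<and> N \<subseteq> N2 \<and> \<sigma>2 m = \<sigma>1 m"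
    proof (intro exI conjI)
      show "(N, side_label C P (if m \<in> C then \<sigma>1 m else (\<sigma>1 m \<noteq> (m \<in> P)))) \<in> cut_system X C upper"
        by (rule cut_systemI[OF N])
      show "side_label C P (if m \<in> C then \<sigma>1 m else (\<sigma>1 m \<noteq> (m \<in> P))) m = \<sigma>1 m"
        unfolding side_label_def by auto
    qed simp
  qed
  show ?thesis unfolding local_system_def
  proof (intro conjI allI impI ballI)
    fix N \<sigma> assume "(N, \<sigma>) \<in> cut_system X C upper"
    then show "openin X N" unfolding cut_system_def side_chart_def by auto
    fix N' \<sigma>' assume "(N', \<sigma>') \<in> cut_system X C upper"
    note cmp[OF \<open>(N, \<sigma>) \<in> cut_system X C upper\<close> this]
    from this[of True] this[of False]
    show "openin X {m \<in> N \<inter> N'. \<sigma> m = \<sigma>' m}" "openin X {m \<in> N \<inter> N'. \<sigma> m \<noteq> \<sigma>' m}" by simp_all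
  next
    fix m assume m: "m \<in> topspace X"
    show "\<exists>N. openin X N \<and> m \<in> N \<and> evenly_covers (cut_system X C upper) N"
    proof (cases "m \<in> C")
      case True
      then obtain N P where "m \<in> N" "side_chart X C upper N P" using ts unfolding two_sided_def by blast
      then show ?thesis using even unfolding side_chart_def by blast
    next
      case False
      then show ?thesis using even[OF side_chart_complement[OF C]] m C by (intro exI[of _ "topspace X - C"]) auto
    qed
  qed
qed

text \<open>Points of \<open>C\<close> carry the label of their lower side, so a section with
  parameter \<open>w\<close> takes the value \<open>w\<close> on \<open>C\<close> whatever its
  \<open>P\<close> is. This is how a loop is pushed off its own curve.\<close>

lemma cut_lift_inside:
  assumes ts: "two_sided X C upper" and f: "\<And>y. y \<in> Y \<Longrightarrow> f y \<in> C" and cont: "continuous_map (top_of_set Y) X f"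
  shows "lift_on (cut_system X C upper) Y f (\<lambda>_. w)"
proof (rule lift_onI)
  fix y assume y: "y \<in> Y"
  obtain N P where N: "f y \<in> N" "side_chart X C upper N P" using ts f[OF y] unfolding two_sided_def by blast
  obtain T where T: "open T" "T \<inter> Y = {y \<in> Y. f y \<in> N}"
    using continuous_map_open_preimage[OF cont, of N] N(2) unfolding side_chart_def by metis
  have "y \<in> T" using T N y by auto
  moreover have "\<forall>z\<in>T \<inter> Y. f z \<in> N \<and> w = side_label C P w (f z)"
    using T f by (auto simp: side_label_def)
  ultimately show "\<exists>N \<sigma> T. (N, \<sigma>) \<in> cut_system X C upper \<and> open T \<and> y \<in> T \<and>
      (\<forall>z\<in>T \<inter> Y. f z \<in> N \<and> w = \<sigma> (f z))"
    using cut_systemI[OF N(2), of w] T(1) by metis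
qed

text \<open>The bits \<open>i\<close> and \<open>j\<close> tell whether the path departs and arrives
  on the upper side. Departing upwards changes the label, arriving from above changes it once more;
  \<open>i \<noteq> j\<close> is the number of crossings mod 2.\<close>

lemma cut_lift_excursion:
  fixes u v :: real
  assumes ts: "two_sided X C upper" and uv: "u < v" and cont: "continuous_map (top_of_set {u..v}) X f"
    and ends: "f u \<in> C" "f v \<in> C" and out: "\<And>t. u < t \<Longrightarrow> t < v \<Longrightarrow> f t \<notin> C"
    and i: "e > 0" "\<And>t. u < t \<Longrightarrow> t < v \<Longrightarrow> t < u + e \<Longrightarrow> f t \<in> upper (f u) \<longleftrightarrow> i"
    and j: "e' > 0" "\<And>t. u < t \<Longrightarrow> t < v \<Longrightarrow> v - e' < t \<Longrightarrow> f t \<in> upper (f v) \<longleftrightarrow> j"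
  shows "lift_on (cut_system X C upper) {u..v} f
     (\<lambda>t. if t = u then w else if t = v then (w \<noteq> (i \<noteq> j)) else (w \<noteq> i))"
    (is "lift_on ?S _ _ ?l")
proof (rule lift_onI)
  have C: "closedin X C" using ts unfolding two_sided_def by blast
  fix y assume y: "y \<in> {u..v}"
  \<comment> \<open>At either end, \<open>k\<close> is the side on which the path runs and
    \<open>w'\<close> the label on \<open>C\<close>; the label in between has to be
    \<open>w' \<noteq> k\<close>.\<close>
  have germ: "\<exists>N \<sigma> T. (N, \<sigma>) \<in> ?S \<and> open T \<and> y \<in> T \<and> (\<forall>t\<in>T \<inter> {u..v}. f t \<in> N \<and> ?l t = \<sigma> (f t))"
    if yC: "f y \<in> C" and T0: "open T0" "y \<in> T0" and out': "\<And>t. t \<in> T0 \<Longrightarrow> t \<in> {u..v} \<Longrightarrow> t \<noteq> y \<Longrightarrow> u < t \<and> t < v \<and> (f t \<in> upper (f y) \<longleftrightarrow> k)"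
      and lab: "?l y = w'" "(w' \<noteq> k) = (w \<noteq> i)" for T0 k w'
  proof -
    obtain N P where N: "f y \<in> N" "side_chart X C upper N P" using ts yC unfolding two_sided_def by blast
    then obtain W where W: "openin X W" "f y \<in> W" "\<forall>q\<in>W - C. q \<in> P \<longleftrightarrow> q \<in> upper (f y)"
      using yC unfolding side_chart_def by blast
    obtain T where T: "open T" "T \<inter> {u..v} = {t \<in> {u..v}. f t \<in> N \<inter> W}"
      using continuous_map_open_preimage[OF cont, of "N \<inter> W"] N(2) W(1) unfolding side_chart_def by (metis openin_Int)
    have "y \<in> T" using T N W y by auto
    have "f t \<in> N \<and> ?l t = side_label C P w' (f t)" if t: "t \<in> T \<inter> T0 \<inter> {u..v}" for t
    proof
      have tN: "f t \<in> N \<inter> W" using t T by blast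
      then show "f t \<in> N" by simp
      show "?l t = side_label C P w' (f t)"
      proof (cases "t = y")
        case True
        then show ?thesis using lab(1) yC by (simp only: side_label_def if_True)
      next
        case False
        then have *: "u < t" "t < v" "f t \<in> upper (f y) \<longleftrightarrow> k" using out' t by blast+
        then have "f t \<notin> C" using out by blast
        then have "f t \<in> P \<longleftrightarrow> k" using W(3) tN *(3) by blast
        then have "side_label C P w' (f t) = (w' \<noteq> k)" using \<open>f t \<notin> C\<close> by (simp add: side_label_def)
        then show ?thesis using lab(2) * by simp
      qed
    qed
    then show ?thesis using cut_systemI[OF N(2), of w'] T(1) T0 \<open>y \<in> T\<close>
      by (intro exI[of _ N] exI[of _ "side_label C P w'"] exI[of _ "T \<inter> T0"]) auto
  qed
  consider "y = u" | "y = v" | "u < y" "y < v" using y by fastforce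
  then show "\<exists>N \<sigma> T. (N, \<sigma>) \<in> ?S \<and> open T \<and> y \<in> T \<and> (\<forall>t\<in>T \<inter> {u..v}. f t \<in> N \<and> ?l t = \<sigma> (f t))"
  proof cases
    case 1
    show ?thesis
    proof (rule germ[of "{..<min v (u + e)}" i w])
      fix t assume "t \<in> {..<min v (u + e)}" "t \<in> {u..v}" "t \<noteq> y"
      then show "u < t \<and> t < v \<and> (f t \<in> upper (f y)) = i" using 1 i(2)[of t] by auto
    qed (use 1 ends uv i in auto)
  next
    case 2
    show ?thesis
    proof (rule germ[of "{max u (v - e')<..}" j "w \<noteq> (i \<noteq> j)"])
      fix t assume "t \<in> {max u (v - e')<..}" "t \<in> {u..v}" "t \<noteq> y"
      then show "u < t \<and> t < v \<and> (f t \<in> upper (f y)) = j" using 2 j(2)[of t] by auto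
    qed (use 2 ends uv j in auto)
  next
    case 3
    have "\<forall>t\<in>{u<..<v} \<inter> {u..v}. f t \<in> topspace X - C \<and> ?l t = side_label C {} (w \<noteq> i) (f t)"
      using out cont by (auto simp: side_label_def continuous_map_def)
    then show ?thesis using 3 cut_systemI[OF side_chart_complement[OF C], where upper = upper and w = "w \<noteq> i"]
      by (intro exI[of _ "topspace X - C"] exI[of _ "side_label C {} (w \<noteq> i)"] exI[of _ "{u<..<v}"]) simp
  qed
qed

context oriented_foliation
begin

text \<open>The curve made of a leaf arc from \<open>(0, yp)\<close> to \<open>(0, yq)\<close>, leaving to the right and
  arriving from the left, and of the transversal between them. The upper side is above the arc and
  to the right of the transversal; the formula for points of the transversal is chosen so as to be
  correct also at the two corners, where the curve is L-shaped.\<close>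

definition curve_upper :: "'a chart \<Rightarrow> real \<Rightarrow> real \<Rightarrow> 'a \<Rightarrow> 'a set" where
  "curve_upper c yp yq z = (if z \<in> seg c yp yq then {w \<in> fst c. py c w > yp \<and> (px c w > 0 \<or> py c w > yq)}
     else {w. py (SOME d. d \<in> F \<and> z \<in> fst d) w > py (SOME d. d \<in> F \<and> z \<in> fst d) z})"

text \<open>Around each point the rest of the curve, a closed set kept away from the point by
  injectivity of \<open>a\<close>, is removed. What remains is one plaque at an interior point of
  the arc, and part of the planar model \<open>Bd\<close> at a point of the transversal, corners
  included.\<close>

lemma two_sided_curve:
  assumes c: "c \<in> F" and y: "yp < yq" and uv: "u < v" and a: "pos a u v" "inj_on a {u..v}"
    and ends: "a u = pt c (0, yp)" "a v = pt c (0, yq)"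
    and int: "\<And>t. u < t \<Longrightarrow> t < v \<Longrightarrow> a t \<notin> seg c yp yq"
  shows "two_sided X (a ` {u..v} \<union> seg c yp yq) (curve_upper c yp yq)"
proof -
  define A S C where "A = a ` {u..v}" and "S = seg c yp yq" and "C = A \<union> S"
  define R where "R = {w \<in> fst c. py c w > yp \<and> (px c w > 0 \<or> py c w > yq)}"
  \<comment> \<open>The model in the plane: the ray to the right at height \<open>yp\<close>, the
    segment, and the ray to the left at height \<open>yq\<close>. The region \<open>R\<close> lies
    above and to the right of it.\<close>
  define Bd where "Bd = {w \<in> fst c. (py c w = yp \<and> px c w \<ge> 0) \<or> (px c w = 0 \<and> yp \<le> py c w \<and> py c w \<le> yq)
     \<or> (py c w = yq \<and> px c w \<le> 0)}"
  note pl = planar[OF c]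
  have closed: "closedin X A" "closedin X S" "closedin X C"
    unfolding A_def S_def C_def using pos_image_closed[OF a(1)] seg_closed[OF c] by auto
  have S_iff: "w \<in> S \<longleftrightarrow> w \<in> fst c \<and> px c w = 0 \<and> yp \<le> py c w \<and> py c w \<le> yq" for w
    unfolding S_def using seg_iff[OF c] by auto
  have SBd: "S \<subseteq> Bd" by (auto simp: S_iff Bd_def)
  have ends_c: "a u \<in> fst c" "px c (a u) = 0" "py c (a u) = yp" "a v \<in> fst c" "px c (a v) = 0" "py c (a v) = yq"
    using ends by (simp_all add: pt_in[OF pl] snd_pt[OF pl])
  have plusS: "curve_upper c yp yq z = R" if "z \<in> S" for z using that unfolding curve_upper_def R_def S_def by simp
  have arc: "\<exists>d. d \<in> F \<and> z \<in> fst d \<and> curve_upper c yp yq z = {w. py d w > py d z}" if "z \<in> A" "z \<notin> S" for z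
  proof -
    have "z \<in> topspace X" using that closed(1) closedin_subset by blast
    then have "\<exists>d. d \<in> F \<and> z \<in> fst d" using chart_at by blast
    from someI_ex[OF this] have "(SOME d. d \<in> F \<and> z \<in> fst d) \<in> F" "z \<in> fst (SOME d. d \<in> F \<and> z \<in> fst d)" by simp_all
    then show ?thesis using that unfolding curve_upper_def S_def[symmetric]
      by (intro exI[of _ "SOME d. d \<in> F \<and> z \<in> fst d"]) simp
  qed
  \<comment> \<open>The chart chosen by \<open>SOME\<close> may be replaced by any chart
    \<open>d\<close> at \<open>z\<close>, as both order \<open>py\<close> in the same way near
    \<open>z\<close>.\<close>
  have germ_arc: "\<exists>W. openin X W \<and> z \<in> W \<and> W \<subseteq> fst d \<and> (\<forall>q\<in>W. q \<in> curve_upper c yp yq z \<longleftrightarrow> py d q > py d z)"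
    if z: "z \<in> A" "z \<notin> S" and d: "d \<in> F" "z \<in> fst d" for z d
  proof -
    obtain d' where d': "d' \<in> F" "z \<in> fst d'" "curve_upper c yp yq z = {w. py d' w > py d' z}" using arc[OF z] by blast
    obtain W where W: "openin X W" "z \<in> W" "W \<subseteq> fst d' \<inter> fst d" "same_order d' d W"
      using oriented[OF d'(1) d(1) d'(2) d(2)] unfolding order_compatible_at_def by blast
    have "q \<in> curve_upper c yp yq z \<longleftrightarrow> py d q > py d z" if "q \<in> W" for q
      using same_orderD(1)[OF W(4) W(2) that] d'(3) by simp
    then show ?thesis using W by blast
  qed
  have op: "openin X {w \<in> fst c. Q (px c w) (py c w)}" if "open {z. Q (fst z) (snd z)}" for Q
    using planar_chart_preimage_open[OF pl that] by simp
  have side_S: "\<exists>P. side_chart X C (curve_upper c yp yq) N P"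
    if N: "openin X N" "N \<subseteq> fst c" and NC: "\<And>w. w \<in> N \<Longrightarrow> w \<in> C \<longleftrightarrow> w \<in> Bd" for N
  proof -
    have R: "openin X R" unfolding R_def
      by (rule op) (intro open_Collect_conj open_Collect_disj open_Collect_less continuous_intros)
    \<comment> \<open>The other region of the model: off \<open>Bd\<close> it is the complement of
      \<open>R\<close>, so the lower side is open too.\<close>
    define R' where "R' = {w \<in> fst c. py c w < yp \<or> (px c w < 0 \<and> py c w < yq)}"
    have R': "openin X R'" unfolding R'_def
      by (rule op) (intro open_Collect_conj open_Collect_disj open_Collect_less continuous_intros)
    have NR: "N - R - C = N \<inter> R' - C"
    proof (rule Set.set_eqI)
      fix w show "w \<in> N - R - C \<longleftrightarrow> w \<in> N \<inter> R' - C"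
        using NC[of w] N(2) y unfolding R_def R'_def Bd_def by (auto simp: not_less)
    qed
    show ?thesis
    proof (intro exI[of _ R], unfold side_chart_def, intro conjI ballI)
      show "openin X N" by fact
      show "openin X (N \<inter> R - C)" using N R closed by auto
      show "openin X (N - R - C)" unfolding NR using N R' closed by auto
      fix z assume z: "z \<in> N \<inter> C"
      show "\<exists>W. openin X W \<and> z \<in> W \<and> (\<forall>q\<in>W - C. (q \<in> R) = (q \<in> curve_upper c yp yq z))"
      proof (cases "z \<in> S")
        case True
        then show ?thesis using plusS z N by (intro exI[of _ N]) auto
      next
        case False
        then have zA: "z \<in> A" using z by (auto simp: C_def)
        have zBd: "z \<in> Bd" using NC z by auto
        have zc: "z \<in> fst c" using z N by auto
        obtain W where W: "openin X W" "z \<in> W" "W \<subseteq> fst c" "\<forall>q\<in>W. q \<in> curve_upper c yp yq z \<longleftrightarrow> py c q > py c z"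
          using germ_arc[OF zA False c zc] by blast
        \<comment> \<open>A point of the arc off the transversal lies on one of the two rays; on
          either, being above the plaque coincides nearby with belonging to
          \<open>R\<close>.\<close>
        consider "py c z = yp" "px c z > 0" | "py c z = yq" "px c z < 0"
          using zBd False y unfolding Bd_def S_iff by fastforce
        then show ?thesis
        proof cases
          case 1
          have "openin X {w \<in> fst c. px c w > 0}"
            by (rule op) (intro open_Collect_less continuous_intros)
          then have "openin X (W \<inter> {w \<in> fst c. px c w > 0})" using W by auto
          moreover have "(q \<in> R) = (q \<in> curve_upper c yp yq z)" if "q \<in> W \<inter> {w \<in> fst c. px c w > 0}" for q
            using W(4) that 1 unfolding R_def by auto
          ultimately show ?thesis using W 1 zc by (intro exI[of _ "W \<inter> {w \<in> fst c. px c w > 0}"]) auto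
        next
          case 2
          have "openin X {w \<in> fst c. px c w < 0 \<and> py c w > yp}"
            by (rule op) (intro open_Collect_conj open_Collect_less continuous_intros)
          then have "openin X (W \<inter> {w \<in> fst c. px c w < 0 \<and> py c w > yp})" using W by auto
          moreover have "(q \<in> R) = (q \<in> curve_upper c yp yq z)" if "q \<in> W \<inter> {w \<in> fst c. px c w < 0 \<and> py c w > yp}" for q
            using W(4) that 2 unfolding R_def by auto
          ultimately show ?thesis using W 2 zc y by (intro exI[of _ "W \<inter> {w \<in> fst c. px c w < 0 \<and> py c w > yp}"]) auto
        qed
      qed
    qed
  qed
  have side_A: "\<exists>P. side_chart X C (curve_upper c yp yq) N P"
    if N: "openin X N" "N \<subseteq> fst d" "N \<inter> S = {}" and d: "d \<in> F" and NC: "\<And>w. w \<in> N \<Longrightarrow> w \<in> C \<longleftrightarrow> py d w = y0" for N d y0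
  proof -
    have op: "openin X {w \<in> fst d. Q (py d w)}" if "open {z::real \<times> real. Q (snd z)}" for Q
      using planar_chart_preimage_open[OF planar[OF d] that] by simp
    define P where "P = {w \<in> fst d. y0 < py d w}"
    have P: "openin X P" unfolding P_def by (rule op) (intro open_Collect_less continuous_intros)
    have P': "openin X {w \<in> fst d. py d w < y0}" by (rule op) (intro open_Collect_less continuous_intros)
    have NP: "N - P - C = N \<inter> {w \<in> fst d. py d w < y0} - C"
    proof (rule Set.set_eqI)
      fix w show "w \<in> N - P - C \<longleftrightarrow> w \<in> N \<inter> {w \<in> fst d. py d w < y0} - C"
        using NC[of w] N(2) unfolding P_def by auto
    qed
    show ?thesis
    proof (intro exI[of _ P], unfold side_chart_def, intro conjI ballI)
      show "openin X N" by fact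
      show "openin X (N \<inter> P - C)" using N P closed by auto
      show "openin X (N - P - C)" unfolding NP using N P' closed by auto
      fix z assume z: "z \<in> N \<inter> C"
      then have zA: "z \<in> A" "z \<notin> S" using N(3) by (auto simp: C_def)
      have zd: "z \<in> fst d" "py d z = y0" using z N NC by auto
      obtain W where W: "openin X W" "z \<in> W" "W \<subseteq> fst d" "\<forall>q\<in>W. q \<in> curve_upper c yp yq z \<longleftrightarrow> py d q > py d z"
        using germ_arc[OF zA d zd(1)] by blast
      then show "\<exists>W. openin X W \<and> z \<in> W \<and> (\<forall>q\<in>W - C. (q \<in> P) = (q \<in> curve_upper c yp yq z))"
        using zd(2) unfolding P_def by (intro exI[of _ W]) auto
    qed
  qed
  have disj: "a t \<notin> a ` {r..s}" if "t \<in> {u..v}" "u \<le> r" "s \<le> v" "t < r \<or> s < t" for t r s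
    using inj_onD[OF a(2)] that by fastforce
  have cl: "closedin X (a ` {r..s})" if "u \<le> r" "s \<le> v" for r s
  proof (cases "r \<le> s")
    case True
    then show ?thesis using that by (intro pos_image_closed pos_sub[OF a(1)]) auto
  qed simp
  have uvI: "u \<in> {u..v}" "v \<in> {u..v}" using uv by auto
  have X: "a t \<in> topspace X" if "t \<in> {u..v}" for t using pos_in[OF a(1) that] .
  have nhd: "\<exists>N P. z \<in> N \<and> side_chart X C (curve_upper c yp yq) N P" if zC: "z \<in> C" for z
  proof -
    consider t where "u < t" "t < v" "z = a t" | "z = a u" | "z = a v" | "z \<in> S" "z \<notin> A"
    proof -
      have "z \<in> A \<or> z \<in> S \<and> z \<notin> A" using zC by (auto simp: C_def)
      moreover have "\<exists>t. u < t \<and> t < v \<and> z = a t \<or> z = a u \<or> z = a v" if zA: "z \<in> A"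
      proof -
        obtain t where "t \<in> {u..v}" "z = a t" using zA by (auto simp: A_def)
        then show ?thesis by (metis atLeastAtMost_iff order_le_less)
      qed
      ultimately show thesis using that by blast
    qed
    then show ?thesis
    proof cases
      case (1 t)
      have t: "t \<in> {u..v}" using 1 by auto
      obtain d where d: "d \<in> F" "a t \<in> fst d" using chart_at X[OF t] by blast
      have "a t \<in> topspace X - S" using X[OF t] int[of t] 1 unfolding S_def by auto
      moreover have "openin X (topspace X - S)" using closed by auto
      ultimately obtain e where e: "e > 0" "\<And>r s. u \<le> r \<Longrightarrow> s \<le> v \<Longrightarrow> t - e < r \<Longrightarrow> s < t + e \<Longrightarrow> runs d a {r..s}"
        using pos_local_run[OF a(1) t d] by metis
      define r s where "r = max u (t - e/2)" and "s = min v (t + e/2)"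
      have rs: "u \<le> r" "r < t" "t < s" "s \<le> v" using 1 e(1) by (auto simp: r_def s_def)
      have run: "runs d a {r..s}" by (rule e(2)) (use rs e(1) in \<open>auto simp: r_def s_def\<close>)
      \<comment> \<open>With the arc before \<open>r\<close> and after \<open>s\<close> and the
        transversal removed, the curve meets this box exactly in the plaque of the run.\<close>
      define N where "N = {w \<in> fst d. px d (a r) < px d w \<and> px d w < px d (a s)} - a ` {u..r} - a ` {s..v} - S"
      have "openin X {w \<in> fst d. snd d w \<in> {z. px d (a r) < fst z \<and> fst z < px d (a s)}}"
        by (rule planar_chart_preimage_open[OF planar[OF d(1)]]) (intro open_Collect_conj open_Collect_less continuous_intros)
      then have "openin X N" unfolding N_def using cl[of u r] cl[of s v] rs closed by auto
      moreover have "N \<subseteq> fst d" "N \<inter> S = {}" by (auto simp: N_def)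
      moreover have "w \<in> C \<longleftrightarrow> py d w = py d (a t)" if w: "w \<in> N" for w
      proof
        assume "w \<in> C"
        then have "w \<in> A" using w by (auto simp: C_def N_def)
        then obtain t' where t': "t' \<in> {u..v}" "w = a t'" by (auto simp: A_def)
        then have "t' \<in> {r..s}" using w unfolding N_def by force
        then show "py d w = py d (a t)" unfolding t'(2) by (rule runsD(2)[OF run]) (use rs in auto)
      next
        assume pyw: "py d w = py d (a t)"
        have "\<exists>t'\<in>{r..s}. a t' = w"
        proof (rule run_cover[OF d(1) run])
          show "continuous_map (top_of_set {r..s}) X a" by (rule pos_cont, rule pos_sub[OF a(1)]) (use rs in auto)
          show "py d w = py d (a r)" unfolding pyw by (rule runsD(2)[OF run]) (use rs in auto)
        qed (use rs w in \<open>auto simp: N_def\<close>)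
        then show "w \<in> C" using rs by (auto simp: C_def A_def)
      qed
      ultimately obtain P where "side_chart X C (curve_upper c yp yq) N P" using side_A[OF _ _ _ d(1)] by metis
      moreover have "z \<in> N"
      proof -
        have "px d (a r) < px d (a t)" "px d (a t) < px d (a s)" by (rule runsD(3)[OF run]; use rs in auto)+
        then show ?thesis unfolding N_def 1(3) using disj[OF t, of u r] disj[OF t, of s v] rs d int[of t] 1
          by (simp add: S_def)
      qed
      ultimately show ?thesis by blast
    next
      case 2
      obtain e where e: "e > 0" "\<And>r s. u \<le> r \<Longrightarrow> s \<le> v \<Longrightarrow> u - e < r \<Longrightarrow> s < u + e \<Longrightarrow> runs c a {r..s}"
        using pos_local_run[OF a(1) uvI(1) c ends_c(1) openin_topspace X[OF uvI(1)]] by metis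
      define s where "s = min v (u + e/2)"
      have s: "u < s" "s \<le> v" using uv e(1) by (auto simp: s_def)
      have run: "runs c a {u..s}" by (rule e(2)) (use s e(1) in \<open>auto simp: s_def\<close>)
      have pys: "py c (a t) = yp" if "t \<in> {u..s}" for t
        using runsD(2)[OF run that, of u] s ends_c(3) by auto
      \<comment> \<open>The bound \<open>px c (a s)\<close> keeps to that part of the right ray
        which the run covers, and \<open>py c w < yq\<close> excludes the left ray.\<close>
      define N where "N = {w \<in> fst c. px c w < px c (a s) \<and> py c w < yq} - a ` {s..v}"
      have "openin X {w \<in> fst c. px c w < px c (a s) \<and> py c w < yq}"
        by (rule op) (intro open_Collect_conj open_Collect_less continuous_intros)
      then have "openin X N" unfolding N_def using cl[of s v] s by auto
      moreover have "N \<subseteq> fst c" by (auto simp: N_def)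
      moreover have "w \<in> C \<longleftrightarrow> w \<in> Bd" if w: "w \<in> N" for w
      proof
        assume "w \<in> C"
        then consider "w \<in> S" | "w \<in> A" by (auto simp: C_def)
        then show "w \<in> Bd"
        proof cases
          case 1 then show ?thesis using SBd by blast
        next
          case 2
          then obtain t' where t': "t' \<in> {u..v}" "w = a t'" by (auto simp: A_def)
          then have t's: "t' \<in> {u..s}" using w unfolding N_def by force
          then have "py c w = yp" using pys t' by simp
          moreover have "px c w \<ge> 0" using runsD(3)[OF run, of u t'] t's t' ends_c(2) by (cases "t' = u") auto
          ultimately show ?thesis using w by (auto simp: Bd_def N_def)
        qed
      next
        assume "w \<in> Bd"
        then consider "w \<in> S" | "py c w = yp" "px c w \<ge> 0" using w by (auto simp: Bd_def N_def S_iff)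
        then show "w \<in> C"
        proof cases
          case 1 then show ?thesis by (auto simp: C_def)
        next
          case 2
          have "\<exists>t'\<in>{u..s}. a t' = w"
          proof (rule run_cover[OF c run])
            show "continuous_map (top_of_set {u..s}) X a" by (rule pos_cont, rule pos_sub[OF a(1)]) (use s in auto)
          qed (use s w 2 ends_c in \<open>auto simp: N_def\<close>)
          then show "w \<in> C" using s by (auto simp: C_def A_def)
        qed
      qed
      ultimately obtain P where "side_chart X C (curve_upper c yp yq) N P" using side_S by metis
      moreover have "z \<in> N"
      proof -
        have "px c (a u) < px c (a s)" by (rule runsD(3)[OF run]) (use s in auto)
        then show ?thesis unfolding N_def 2 using disj[OF uvI(1), of s v] s ends_c y by simp
      qed
      ultimately show ?thesis by blast
    next
      case 3
      obtain e where e: "e > 0" "\<And>r s. u \<le> r \<Longrightarrow> s \<le> v \<Longrightarrow> v - e < r \<Longrightarrow> s < v + e \<Longrightarrow> runs c a {r..s}"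
        using pos_local_run[OF a(1) uvI(2) c ends_c(4) openin_topspace X[OF uvI(2)]] by metis
      define s where "s = max u (v - e/2)"
      have s: "s < v" "u \<le> s" using uv e(1) by (auto simp: s_def)
      have run: "runs c a {s..v}" by (rule e(2)) (use s e(1) in \<open>auto simp: s_def\<close>)
      have pys: "py c (a t) = yq" if "t \<in> {s..v}" for t
        using runsD(2)[OF run that, of v] s ends_c(6) by auto
      define N where "N = {w \<in> fst c. px c (a s) < px c w \<and> yp < py c w} - a ` {u..s}"
      have "openin X {w \<in> fst c. px c (a s) < px c w \<and> yp < py c w}"
        by (rule op) (intro open_Collect_conj open_Collect_less continuous_intros)
      then have "openin X N" unfolding N_def using cl[of u s] s by auto
      moreover have "N \<subseteq> fst c" by (auto simp: N_def)
      moreover have "w \<in> C \<longleftrightarrow> w \<in> Bd" if w: "w \<in> N" for w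
      proof
        assume "w \<in> C"
        then consider "w \<in> S" | "w \<in> A" by (auto simp: C_def)
        then show "w \<in> Bd"
        proof cases
          case 1 then show ?thesis using SBd by blast
        next
          case 2
          then obtain t' where t': "t' \<in> {u..v}" "w = a t'" by (auto simp: A_def)
          then have t's: "t' \<in> {s..v}" using w unfolding N_def by force
          then have "py c w = yq" using pys t' by simp
          moreover have "px c w \<le> 0" using runsD(3)[OF run, of t' v] t's t' ends_c(5) by (cases "t' = v") auto
          ultimately show ?thesis using w by (auto simp: Bd_def N_def)
        qed
      next
        assume "w \<in> Bd"
        then consider "w \<in> S" | "py c w = yq" "px c w \<le> 0" using w by (auto simp: Bd_def N_def S_iff)
        then show "w \<in> C"
        proof cases
          case 1 then show ?thesis by (auto simp: C_def)
        next
          case 2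
          have "\<exists>t'\<in>{s..v}. a t' = w"
          proof (rule run_cover[OF c run])
            show "continuous_map (top_of_set {s..v}) X a" by (rule pos_cont, rule pos_sub[OF a(1)]) (use s in auto)
            show "py c w = py c (a s)" using 2 pys[of s] s by auto
          qed (use s w 2 ends_c in \<open>auto simp: N_def\<close>)
          then show "w \<in> C" using s by (auto simp: C_def A_def)
        qed
      qed
      ultimately obtain P where "side_chart X C (curve_upper c yp yq) N P" using side_S by metis
      moreover have "z \<in> N"
      proof -
        have "px c (a s) < px c (a v)" by (rule runsD(3)[OF run]) (use s in auto)
        then show ?thesis unfolding N_def 3 using disj[OF uvI(2), of u s] s ends_c y by simp
      qed
      ultimately show ?thesis by blast
    next
      case 4
      define N where "N = {w \<in> fst c. yp < py c w \<and> py c w < yq} - A"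
      have "openin X {w \<in> fst c. yp < py c w \<and> py c w < yq}"
        by (rule op) (intro open_Collect_conj open_Collect_less continuous_intros)
      then have "openin X N" unfolding N_def using closed by auto
      moreover have "N \<subseteq> fst c" by (auto simp: N_def)
      moreover have "w \<in> C \<longleftrightarrow> w \<in> Bd" if w: "w \<in> N" for w
        using w unfolding N_def C_def Bd_def by (auto simp: S_iff)
      ultimately obtain P where "side_chart X C (curve_upper c yp yq) N P" using side_S by metis
      moreover have "z \<in> N"
      proof -
        have zc: "z \<in> fst c" "px c z = 0" "yp \<le> py c z" "py c z \<le> yq" using 4 by (auto simp: S_iff)
        have "py c z \<noteq> yp"
        proof
          assume "py c z = yp"
          then have "z = a u" using planar_chart_inj[OF pl, of z "a u"] zc ends_c by simp
          then show False using 4 uvI by (auto simp: A_def)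
        qed
        moreover have "py c z \<noteq> yq"
        proof
          assume "py c z = yq"
          then have "z = a v" using planar_chart_inj[OF pl, of z "a v"] zc ends_c by simp
          then show False using 4 uvI by (auto simp: A_def)
        qed
        ultimately show ?thesis using zc 4 by (simp add: N_def)
      qed
      ultimately show ?thesis by blast
    qed
  qed
  have "two_sided X C (curve_upper c yp yq)"
    unfolding two_sided_def by (intro conjI ballI closed(3)) (rule nhd)
  then show ?thesis by (simp only: C_def A_def S_def)
qed

end

subsection \<open>Recurrence in oriented foliations\<close>

text \<open>Independence of two loops mod 2, with \<open>S1\<close> and \<open>S2\<close> as dual
  classes: the first detects only \<beta>, the second only \<alpha>.\<close>

definition independent_loops :: "'a topology \<Rightarrow> 'a \<Rightarrow> bool" where
  "independent_loops X b \<longleftrightarrow> (\<exists>\<alpha> \<beta>. \<exists>S1 S2 :: ('a set \<times> ('a \<Rightarrow> bool)) set.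
     pathin X \<alpha> \<and> \<alpha> 0 = b \<and> \<alpha> 1 = b \<and> pathin X \<beta> \<and> \<beta> 0 = b \<and> \<beta> 1 = b \<and>
     local_system X S1 \<and> local_system X S2 \<and>
     (\<forall>w. transport S1 \<alpha> w w \<and> transport S1 \<beta> w (\<not> w)) \<and>
     (\<forall>w. transport S2 \<alpha> w (\<not> w) \<and> transport S2 \<beta> w w))"

lemma affine_in_interval:
  fixes t u v :: real
  assumes "t \<in> {0..1}" "u \<le> v"
  shows "u + t * (v - u) \<in> {u..v}"
proof -
  have "0 \<le> t * (v - u)" "t * (v - u) \<le> v - u"
    using assms by (auto intro: mult_left_le_one_le)
  then show ?thesis by simp
qed

lemma transport_affine:
  assumes "lift_on S {u..v} f l" "u \<le> v"
  shows "transport S (\<lambda>t. f (u + t * (v - u))) (l u) (l v)"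
proof -
  have "lift_on S {0..1} (f \<circ> (\<lambda>t. u + t * (v - u))) (l \<circ> (\<lambda>t. u + t * (v - u)))"
  proof (rule lift_on_compose[OF assms(1)])
    show "(\<lambda>t. u + t * (v - u)) ` {0..1} \<subseteq> {u..v}"
      using affine_in_interval[OF _ assms(2)] by blast
  qed (auto intro!: continuous_intros)
  then show ?thesis unfolding transport_def comp_def by (intro exI[of _ "\<lambda>t. l (u + t * (v - u))"]) auto
qed

lemma pathin_affine:
  assumes "continuous_map (top_of_set {u..v}) X f" "u \<le> v"
  shows "pathin X (\<lambda>t. f (u + t * (v - u)))"
proof -
  have "continuous_map (top_of_set {0..1}) (top_of_set {u..v}) (\<lambda>t. u + t * (v - u))"
  proof (rule continuous_map_into_subtopology)
    show "(\<lambda>t. u + t * (v - u)) \<in> topspace (top_of_set {0..1}) \<rightarrow> {u..v}"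
      using affine_in_interval[OF _ assms(2)] by auto
  qed (auto intro!: continuous_intros)
  from continuous_map_compose[OF this assms(1)] show ?thesis unfolding pathin_def comp_def .
qed

lemma cut_transport_inside:
  assumes "two_sided X C upper" "pathin X f" "\<And>t. t \<in> {0..1} \<Longrightarrow> f t \<in> C"
  shows "transport (cut_system X C upper) f w w"
  unfolding transport_def using cut_lift_inside[OF assms(1,3), where Y = "{0..1}" and w = w] assms(2)
  unfolding pathin_def by (intro exI[of _ "\<lambda>_. w"]) simp

lemma pt_flip:
  assumes "planar_chart X c" "e1 \<in> unit_sign" "e2 \<in> unit_sign"
  shows "pt (flip e1 e2 c) (e1 * x, e2 * y) = pt c (x, y)"
proof -
  let ?c = "flip e1 e2 c"
  have p: "planar_chart X ?c" by (rule planar_chart_flip[OF assms])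
  have "pt c (x, y) \<in> fst ?c" using pt_in[OF assms(1)] by simp
  then have "pt ?c (snd ?c (pt c (x, y))) = pt c (x, y)" by (rule pt_snd[OF p])
  moreover have "snd ?c (pt c (x, y)) = (e1 * x, e2 * y)"
    by (simp add: prod_eq_iff snd_pt[OF assms(1)])
  ultimately show ?thesis by simp
qed

context oriented_foliation
begin

definition vert :: "'a chart \<Rightarrow> real \<Rightarrow> real \<Rightarrow> real \<Rightarrow> 'a" where
  "vert c y y' t = pt c (0, y + t * (y' - y))"

lemma vert_pathin: "c \<in> F \<Longrightarrow> pathin X (vert c y y')"
proof -
  assume c: "c \<in> F"
  have "continuous_map (top_of_set {0..1}) X (pt c \<circ> (\<lambda>t. (0, y + t * (y' - y))))"
    by (rule continuous_map_compose[OF _ continuous_map_pt[OF planar[OF c]]]) (auto intro!: continuous_intros)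
  then show ?thesis unfolding pathin_def vert_def comp_def .
qed

lemma vert_ends [simp]: "vert c y y' 0 = pt c (0, y)" "vert c y y' 1 = pt c (0, y')"
  by (auto simp: vert_def)

lemma vert_seg:
  assumes c: "c \<in> F" and t: "t \<in> {0..1}" and y: "y1 \<le> y" "y \<le> y2" "y1 \<le> y'" "y' \<le> y2"
  shows "vert c y y' t \<in> seg c y1 y2"
proof -
  have "(1 - t) * y + t * y' \<in> {y1..y2}"
  proof -
    have "y1 = (1 - t) * y1 + t * y1" "y2 = (1 - t) * y2 + t * y2" by (simp_all add: algebra_simps)
    moreover have "(1 - t) * y1 + t * y1 \<le> (1 - t) * y + t * y'" "(1 - t) * y + t * y' \<le> (1 - t) * y2 + t * y2"
      using t y by (auto intro!: add_mono mult_left_mono)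
    ultimately show ?thesis by simp
  qed
  moreover have "y + t * (y' - y) = (1 - t) * y + t * y'" by (simp add: algebra_simps)
  ultimately show ?thesis unfolding vert_def seg_iff[OF c] by (simp add: pt_in[OF planar[OF c]] snd_pt[OF planar[OF c]])
qed

lemma pt_inj: "c \<in> F \<Longrightarrow> pt c z = pt c z' \<longleftrightarrow> z = z'"
  using snd_pt[OF planar] by metis

lemma seg_pt: "c \<in> F \<Longrightarrow> pt c (0, y) \<in> seg c y1 y2 \<longleftrightarrow> y1 \<le> y \<and> y \<le> y2"
  by (simp add: seg_iff pt_in[OF planar] snd_pt[OF planar])

lemma curve_upper_seg:
  assumes c: "c \<in> F" and y: "yp \<le> y" "y \<le> yq"
  shows "curve_upper c yp yq (pt c (0, y)) = {w \<in> fst c. py c w > yp \<and> (px c w > 0 \<or> py c w > yq)}"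
  using seg_pt[OF c, of y yp yq] y unfolding curve_upper_def by simp

lemma pos_start_run:
  assumes a: "pos a u v" "u < v" and c: "c \<in> F" and st: "a u = pt c (0, y)"
  obtains e where "e > 0" "\<And>t. u < t \<Longrightarrow> t < v \<Longrightarrow> t < u + e \<Longrightarrow> a t \<in> fst c \<and> px c (a t) > 0 \<and> py c (a t) = y"
proof -
  have u: "u \<in> {u..v}" using a by simp
  have uc: "a u \<in> fst c" "px c (a u) = 0" "py c (a u) = y" using st by (simp_all add: pt_in[OF planar[OF c]] snd_pt[OF planar[OF c]])
  obtain e where e: "e > 0" "\<And>r s. u \<le> r \<Longrightarrow> s \<le> v \<Longrightarrow> u - e < r \<Longrightarrow> s < u + e \<Longrightarrow> runs c a {r..s}"
    using pos_local_run[OF a(1) u c uc(1) openin_topspace pos_in[OF a(1) u]] by metis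
  show ?thesis
  proof (rule that[OF e(1)])
    fix t assume t: "u < t" "t < v" "t < u + e"
    have r: "runs c a {u..t}" by (rule e(2)) (use t e(1) in auto)
    have "a t \<in> fst c" by (rule runsD(1)[OF r]) (use t in auto)
    moreover have "py c (a t) = py c (a u)" by (rule runsD(2)[OF r]) (use t in auto)
    moreover have "px c (a u) < px c (a t)" by (rule runsD(3)[OF r]) (use t in auto)
    ultimately show "a t \<in> fst c \<and> px c (a t) > 0 \<and> py c (a t) = y" using uc by simp
  qed
qed

lemma pos_end_run:
  assumes a: "pos a u v" "u < v" and c: "c \<in> F" and st: "a v = pt c (0, y)"
  obtains e where "e > 0" "\<And>t. u < t \<Longrightarrow> t < v \<Longrightarrow> v - e < t \<Longrightarrow> a t \<in> fst c \<and> px c (a t) < 0 \<and> py c (a t) = y"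
proof -
  have v: "v \<in> {u..v}" using a by simp
  have vc: "a v \<in> fst c" "px c (a v) = 0" "py c (a v) = y" using st by (simp_all add: pt_in[OF planar[OF c]] snd_pt[OF planar[OF c]])
  obtain e where e: "e > 0" "\<And>r s. u \<le> r \<Longrightarrow> s \<le> v \<Longrightarrow> v - e < r \<Longrightarrow> s < v + e \<Longrightarrow> runs c a {r..s}"
    using pos_local_run[OF a(1) v c vc(1) openin_topspace pos_in[OF a(1) v]] by metis
  show ?thesis
  proof (rule that[OF e(1)])
    fix t assume t: "u < t" "t < v" "v - e < t"
    have r: "runs c a {t..v}" by (rule e(2)) (use t e(1) in auto)
    have "a t \<in> fst c" by (rule runsD(1)[OF r]) (use t in auto)
    moreover have "py c (a t) = py c (a v)" by (rule runsD(2)[OF r]) (use t in auto)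
    moreover have "px c (a t) < px c (a v)" by (rule runsD(3)[OF r]) (use t in auto)
    ultimately show "a t \<in> fst c \<and> px c (a t) < 0 \<and> py c (a t) = y" using vc by simp
  qed
qed

text \<open>The arc \<open>a\<close> climbs from \<open>y0\<close> to \<open>y1\<close> and
  \<open>b\<close> descends from there to \<open>yr\<close>. Seen from \<open>C\<close>, the loop
  \<beta> departs at \<open>y1\<close> to the right, the upper side, and arrives at
  \<open>yr\<close> from the left, the lower side. Seen from \<open>C'\<close>, the loop \<alpha>
  departs down the transversal below \<open>yr\<close> and arrives along \<open>a\<close> at
  \<open>y1\<close> from the left, again on opposite sides. The rest of each loop lies inside the
  curve in question.\<close>

lemma independent_loops_core:
  assumes c: "c \<in> F" and y: "y0 < yr" "yr < y1"
    and a: "pos a u v" "u < v" "a u = pt c (0, y0)" "a v = pt c (0, y1)"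
      "\<And>t. u < t \<Longrightarrow> t < v \<Longrightarrow> a t \<notin> seg c y0 y1"
    and b: "pos b u' v'" "u' < v'" "b u' = pt c (0, y1)" "b v' = pt c (0, yr)"
      "\<And>t. u' < t \<Longrightarrow> t < v' \<Longrightarrow> b t \<notin> seg c y0 y1"
  shows "independent_loops X (pt c (0, y1))"
proof -
  note pl = planar[OF c]
  have segs: "pt c (0, y0) \<in> seg c y0 y1" "pt c (0, yr) \<in> seg c y0 y1" "pt c (0, y1) \<in> seg c y0 y1"
    using seg_pt[OF c] y by auto
  have neq: "pt c (0, y0) \<noteq> pt c (0, yr)" "pt c (0, y0) \<noteq> pt c (0, y1)" "pt c (0, yr) \<noteq> pt c (0, y1)"
    using pt_inj[OF c] y by auto
  have sub: "seg c yr y1 \<subseteq> seg c y0 y1" unfolding seg_def using y by auto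
  have inj_a: "inj_on a {u..v}"
  proof (rule pos_inj[OF a(1)])
    show "a u \<notin> a ` {u<..v}"
    proof
      assume "a u \<in> a ` {u<..v}"
      then obtain t where t: "u < t" "t \<le> v" "a u = a t" by auto
      then show False using a(3,4,5) segs neq by (metis order_le_less)
    qed
  qed
  have inj_b: "inj_on b {u'..v'}"
  proof (rule pos_inj[OF b(1)])
    show "b u' \<notin> b ` {u'<..v'}"
    proof
      assume "b u' \<in> b ` {u'<..v'}"
      then obtain t where t: "u' < t" "t \<le> v'" "b u' = b t" by auto
      then show False using b(3,4,5) segs neq by (metis order_le_less)
    qed
  qed
  \<comment> \<open>From a common point before the end of \<open>a\<close>, both paths followed
    backwards would put the start of one arc on the other. The starts lie on the transversal
    segment, which the interiors of the arcs avoid.\<close>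
  have meet: "a t \<noteq> b s" if t: "u \<le> t" "t < v" and s: "u' \<le> s" "s \<le> v'" for t s
  proof
    assume eq: "a t = b s"
    have "t \<noteq> u"
    proof
      assume "t = u"
      then have "b s = pt c (0, y0)" using eq a(3) by simp
      then show False using b(3,4) b(5)[of s] segs neq s by (metis order_le_less)
    qed
    have "s \<noteq> u'" using eq a(4) b(3) inj_onD[OF inj_a, of t v] t a(2) by auto
    have "a t \<notin> seg c y0 y1" using a(5) t \<open>t \<noteq> u\<close> by auto
    then have "s \<noteq> v'" using eq b(4) segs by auto
    have "a u \<in> b ` {u'..s} \<or> b u' \<in> a ` {u..t}"
      by (rule backward_determinism[OF pos_sub[OF a(1)] pos_sub[OF b(1)] eq]) (use t s in auto)
    then show False
    proof
      assume "a u \<in> b ` {u'..s}"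
      then obtain r where "u' \<le> r" "r < v'" "b r = pt c (0, y0)" using a(3) s \<open>s \<noteq> v'\<close> by force
      then show False using b(3,5) segs neq by (metis order_le_less)
    next
      assume "b u' \<in> a ` {u..t}"
      then obtain r where "u \<le> r" "r < v" "a r = pt c (0, y1)" using b(3) t by force
      then show False using a(3,5) segs neq by (metis order_le_less)
    qed
  qed
  define C where "C = a ` {u..v} \<union> seg c y0 y1"
  have ts1: "two_sided X C (curve_upper c y0 y1)"
    unfolding C_def using two_sided_curve[OF c _ a(2,1) inj_a a(3,4,5)] y by auto
  \<comment> \<open>\<open>b\<close> descends while \<open>two_sided_curve\<close> expects an
    ascending arc, so the second coordinate is negated.\<close>
  let ?F = "flip 1 (-1) ` F" and ?c = "flip 1 (-1) c"
  have s1: "1 \<in> unit_sign" "-1 \<in> unit_sign" by (auto simp: unit_sign_def)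
  interpret G: oriented_foliation X ?F by (rule flip_oriented[OF s1])
  have c': "?c \<in> ?F" using c by auto
  have ptc: "pt ?c (0, - y) = pt c (0, y)" for y using pt_flip[OF pl s1, of 0 y] by simp
  have seg': "seg ?c (- y1) (- yr) = seg c yr y1"
  proof -
    have "{- y1..- yr} = uminus ` {yr..y1}" by simp
    then show ?thesis unfolding seg_def by (simp only: image_image ptc)
  qed
  define C' where "C' = b ` {u'..v'} \<union> seg c yr y1"
  define up' where "up' = G.curve_upper ?c (- y1) (- yr)"
  have ts2: "two_sided X C' up'"
    unfolding C'_def up'_def seg'[symmetric]
  proof (rule G.two_sided_curve[OF c' _ b(2) _ inj_b])
    show "G.pos b u' v'" by (rule pos_flip(1)[OF b(1) s1(2)])
    show "b t \<notin> seg ?c (- y1) (- yr)" if "u' < t" "t < v'" for t using b(5)[OF that] sub seg' by auto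
  qed (use y b ptc in auto)
  define S1 where "S1 = cut_system X C (curve_upper c y0 y1)"
  define S2 where "S2 = cut_system X C' up'"
  have LS: "local_system X S1" "local_system X S2"
    unfolding S1_def S2_def by (rule local_system_cut[OF ts1], rule local_system_cut[OF ts2])
  define a1 where "a1 t = a (u + t * (v - u))" for t
  define b1 where "b1 t = b (u' + t * (v' - u'))" for t
  note aff = affine_in_interval
  have a1: "pathin X a1" "a1 0 = pt c (0, y0)" "a1 1 = pt c (0, y1)"
    unfolding a1_def using pathin_affine[OF pos_cont[OF a(1)]] a by auto
  have b1: "pathin X b1" "b1 0 = pt c (0, y1)" "b1 1 = pt c (0, yr)"
    unfolding b1_def using pathin_affine[OF pos_cont[OF b(1)]] b by auto
  note vp = vert_pathin[OF c]
  \<comment> \<open>\<alpha> is split at \<open>yr\<close>: its first piece runs inside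
    \<open>C'\<close>, and \<open>m\<close>, the descent to \<open>y0\<close> followed by the arc,
    is one excursion from \<open>C'\<close>.\<close>
  define m where "m = concat_loops (vert c yr y0) a1"
  have m: "pathin X m" "m 0 = pt c (0, yr)" "m 1 = pt c (0, y1)"
    unfolding m_def using pathin_concat_loops[OF vp a1(1), of yr y0] a1 by (auto simp: concat_loops_def)
  define \<alpha> where "\<alpha> = concat_loops (vert c y1 yr) m"
  define \<beta> where "\<beta> = concat_loops b1 (vert c yr y1)"
  have \<alpha>: "pathin X \<alpha>" "\<alpha> 0 = pt c (0, y1)" "\<alpha> 1 = pt c (0, y1)"
    unfolding \<alpha>_def using pathin_concat_loops[OF vp m(1), of y1 yr] m by (auto simp: concat_loops_def)
  have \<beta>: "pathin X \<beta>" "\<beta> 0 = pt c (0, y1)" "\<beta> 1 = pt c (0, y1)"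
    unfolding \<beta>_def using pathin_concat_loops[OF b1(1) vp, of yr y1] b1 by (auto simp: concat_loops_def)
  have vC: "vert c y y' t \<in> C" if "t \<in> {0..1}" "y0 \<le> y" "y \<le> y1" "y0 \<le> y'" "y' \<le> y1" for y y' t
    using vert_seg[OF c that] by (simp add: C_def)
  have vC': "vert c y y' t \<in> C'" if "t \<in> {0..1}" "yr \<le> y" "y \<le> y1" "yr \<le> y'" "y' \<le> y1" for y y' t
    using vert_seg[OF c that] by (simp add: C'_def)
  have t1: "transport S1 \<alpha> w w" for w
    unfolding S1_def
  proof (rule cut_transport_inside[OF ts1 \<alpha>(1)])
    fix t :: real assume t: "t \<in> {0..1}"
    have "a1 s \<in> C" if "s \<in> {0..1}" for s unfolding a1_def C_def using aff[OF that, of u v] a(2) by auto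
    moreover have "vert c yr y0 s \<in> C" "vert c y1 yr s \<in> C" if "s \<in> {0..1}" for s using vC[OF that] y by auto
    ultimately have "m s \<in> C" if "s \<in> {0..1}" for s using that unfolding m_def concat_loops_def by auto
    then show "\<alpha> t \<in> C" using t \<open>\<And>s. s \<in> {0..1} \<Longrightarrow> vert c y1 yr s \<in> C\<close> unfolding \<alpha>_def concat_loops_def by auto
  qed
  have t2: "transport S2 \<beta> w w" for w
    unfolding S2_def
  proof (rule cut_transport_inside[OF ts2 \<beta>(1)])
    fix t :: real assume t: "t \<in> {0..1}"
    have "b1 s \<in> C'" if "s \<in> {0..1}" for s unfolding b1_def C'_def using aff[OF that, of u' v'] b(2) by auto
    moreover have "vert c yr y1 s \<in> C'" if "s \<in> {0..1}" for s using vC'[OF that] y by auto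
    ultimately show "\<beta> t \<in> C'" using t unfolding \<beta>_def concat_loops_def by auto
  qed
  have t3: "transport S1 \<beta> w (\<not> w)" for w
    unfolding \<beta>_def
  proof (rule transport_concat[OF LS(1) b1(1) vp])
    show "b1 1 = vert c yr y1 0" using b1 by simp
    show "transport S1 (vert c yr y1) (\<not> w) (\<not> w)"
      unfolding S1_def by (rule cut_transport_inside[OF ts1 vp]) (use vC y in auto)
    obtain e where e: "e > 0" "\<And>t. u' < t \<Longrightarrow> t < v' \<Longrightarrow> t < u' + e \<Longrightarrow> b t \<in> fst c \<and> px c (b t) > 0 \<and> py c (b t) = y1"
      using pos_start_run[OF b(1,2) c b(3)] by blast
    obtain e' where e': "e' > 0" "\<And>t. u' < t \<Longrightarrow> t < v' \<Longrightarrow> v' - e' < t \<Longrightarrow> b t \<in> fst c \<and> px c (b t) < 0 \<and> py c (b t) = yr"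
      using pos_end_run[OF b(1,2) c b(4)] by blast
    have "lift_on S1 {u'..v'} b (\<lambda>t. if t = u' then w else if t = v' then (w \<noteq> (True \<noteq> False)) else (w \<noteq> True))"
      unfolding S1_def
    proof (rule cut_lift_excursion[OF ts1 b(2) pos_cont[OF b(1)] _ _ _ e(1) _ e'(1)])
      show "b u' \<in> C" "b v' \<in> C" using segs b by (auto simp: C_def)
      show "b t \<notin> C" if "u' < t" "t < v'" for t
      proof -
        have "b t \<noteq> a s" if "s \<in> {u..v}" for s
          using meet[of s t] that \<open>u' < t\<close> \<open>t < v'\<close> a(4) b(3) inj_onD[OF inj_b, of t u'] by (cases "s = v") force+
        then have "b t \<notin> a ` {u..v}" by blast
        then show ?thesis using b(5)[OF that] by (auto simp: C_def)
      qed
      show "(b t \<in> curve_upper c y0 y1 (b u')) = True" if "u' < t" "t < v'" "t < u' + e" for t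
        using e(2)[OF that] y unfolding b(3) by (simp add: curve_upper_seg[OF c])
      show "(b t \<in> curve_upper c y0 y1 (b v')) = False" if "u' < t" "t < v'" "v' - e' < t" for t
        using e'(2)[OF that] y unfolding b(4) by (simp add: curve_upper_seg[OF c])
    qed
    from transport_affine[OF this] show "transport S1 b1 w (\<not> w)" using b(2) unfolding b1_def by simp
  qed
  have t4: "transport S2 \<alpha> w (\<not> w)" for w
    unfolding \<alpha>_def
  proof (rule transport_concat[OF LS(2) vp m(1)])
    show "vert c y1 yr 1 = m 0" using m by simp
    show "transport S2 (vert c y1 yr) w w"
      unfolding S2_def by (rule cut_transport_inside[OF ts2 vp]) (use vC' y in auto)
    obtain e' where e': "e' > 0" "\<And>t. u < t \<Longrightarrow> t < v \<Longrightarrow> v - e' < t \<Longrightarrow> a t \<in> fst c \<and> px c (a t) < 0 \<and> py c (a t) = y1"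
      using pos_end_run[OF a(1,2) c a(4)] by blast
    \<comment> \<open>On its second half \<open>m\<close> runs through \<open>a\<close> at speed
      \<open>2 * (v - u)\<close>, which converts the time window \<open>e'\<close> of
      \<open>a\<close>; the bound \<open>1/2\<close> keeps to that half.\<close>
    define e'' where "e'' = min (1/2) (e' / (2 * (v - u)))"
    have e'': "e'' > 0" using e' a(2) by (simp add: e''_def)
    have m_low: "m t = pt c (0, yr + 2 * t * (y0 - yr))" if "t \<le> 1/2" for t
      using that by (simp add: m_def concat_loops_def vert_def)
    have m_high: "m t = a (u + (2 * t - 1) * (v - u))" "u < u + (2 * t - 1) * (v - u)" "u + (2 * t - 1) * (v - u) < v"
      if "1/2 < t" "t < 1" for t
    proof -
      show "m t = a (u + (2 * t - 1) * (v - u))" using that by (simp add: m_def concat_loops_def a1_def)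
      have "0 < (2 * t - 1) * (v - u)" using that a(2) by simp
      then show "u < u + (2 * t - 1) * (v - u)" by simp
      have "(2 * t - 1) * (v - u) < 1 * (v - u)" using that a(2) by (intro mult_strict_right_mono) auto
      then show "u + (2 * t - 1) * (v - u) < v" by simp
    qed
    have low_y: "y0 \<le> yr + 2 * t * (y0 - yr)" "yr + 2 * t * (y0 - yr) < yr" if "0 < t" "t \<le> 1/2" for t
    proof -
      have "(2 * t) * (yr - y0) \<le> 1 * (yr - y0)" using that y by (intro mult_right_mono) auto
      then show "y0 \<le> yr + 2 * t * (y0 - yr)" by (simp add: algebra_simps)
      have "0 < (2 * t) * (yr - y0)" using that y by simp
      then show "yr + 2 * t * (y0 - yr) < yr" by (simp add: algebra_simps)
    qed
    have up_yr: "up' (pt c (0, yr)) = {w \<in> fst c. py c w < y1 \<and> (px c w > 0 \<or> py c w < yr)}"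
      unfolding up'_def ptc[symmetric] using G.curve_upper_seg[OF c', of "-y1" "- yr" "- yr"] y by simp
    have up_y1: "up' (pt c (0, y1)) = {w \<in> fst c. py c w < y1 \<and> (px c w > 0 \<or> py c w < yr)}"
      unfolding up'_def ptc[symmetric] using G.curve_upper_seg[OF c', of "-y1" "- y1" "- yr"] y by simp
    have "lift_on S2 {0..1} m (\<lambda>t. if t = 0 then w else if t = 1 then (w \<noteq> (True \<noteq> False)) else (w \<noteq> True))"
      unfolding S2_def
    proof (rule cut_lift_excursion[OF ts2 _ _ _ _ _ _ _ e''])
      show "continuous_map (top_of_set {0..1}) X m" using m(1) by (simp add: pathin_def)
      show "m 0 \<in> C'" "m 1 \<in> C'" using m seg_pt[OF c] y by (auto simp: C'_def)
      show "m t \<notin> C'" if t: "0 < t" "t < 1" for t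
      proof (cases "t \<le> 1/2")
        case True
        define s where "s = yr + 2 * t * (y0 - yr)"
        have s: "y0 \<le> s" "s < yr" "m t = pt c (0, s)" using low_y[of t] m_low t True by (auto simp: s_def)
        have "m t \<in> seg c y0 y1" "m t \<notin> seg c yr y1" using s seg_pt[OF c] y by auto
        moreover have "m t \<noteq> b r" if "r \<in> {u'..v'}" for r
        proof
          assume eq: "m t = b r"
          then have "b r \<in> seg c y0 y1" using \<open>m t \<in> seg c y0 y1\<close> by simp
          then have "r = u' \<or> r = v'" using b(5)[of r] that by force
          then have "pt c (0, s) = pt c (0, y1) \<or> pt c (0, s) = pt c (0, yr)" using eq s b(3,4) by auto
          then show False using pt_inj[OF c] s y by auto
        qed
        ultimately have "m t \<notin> b ` {u'..v'}" "m t \<notin> seg c yr y1" by blast+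
        then show ?thesis by (simp add: C'_def)
      next
        case False
        define s where "s = u + (2 * t - 1) * (v - u)"
        have s: "u < s" "s < v" "m t = a s" using m_high[of t] t False by (auto simp: s_def)
        then have "m t \<notin> seg c yr y1" using a(5) sub by auto
        moreover have "m t \<noteq> b r" if "r \<in> {u'..v'}" for r using meet[of s r] s that by auto
        ultimately have "m t \<notin> b ` {u'..v'}" "m t \<notin> seg c yr y1" by blast+
        then show ?thesis by (simp add: C'_def)
      qed
      show "(1/2::real) > 0" by simp
      show "(m t \<in> up' (m 0)) = True" if "0 < t" "t < 1" "t < 0 + 1/2" for t
        using low_y[of t] m_low[of t] that y unfolding m(2) up_yr by (simp add: pt_in[OF pl] snd_pt[OF pl])
      show "(m t \<in> up' (m 1)) = False" if t: "0 < t" "t < 1" "1 - e'' < t" for t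
      proof -
        have t2: "1/2 < t" using t unfolding e''_def by auto
        define s where "s = u + (2 * t - 1) * (v - u)"
        have s: "u < s" "s < v" "m t = a s" using m_high[of t] t t2 by (auto simp: s_def)
        have "(1 - t) * (2 * (v - u)) < e'"
        proof -
          have "1 - t < e' / (2 * (v - u))" using t unfolding e''_def by auto
          then show ?thesis using a(2) by (simp add: pos_less_divide_eq)
        qed
        then have "v - e' < s" unfolding s_def by (simp add: algebra_simps)
        then show ?thesis using e'(2)[of s] s unfolding m(3) up_y1 by simp
      qed
    qed simp_all
    then show "transport S2 m w (\<not> w)" unfolding transport_def by (intro exI conjI) (assumption, simp_all)
  qed
  show ?thesis unfolding independent_loops_def
    using \<alpha> \<beta> LS t1 t2 t3 t4 by blast
qed


lemma reach_flip: "e2 \<in> unit_sign \<Longrightarrow> reach p q \<Longrightarrow> oriented_foliation.reach X (flip 1 e2 ` F) p q"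
  "e2 \<in> unit_sign \<Longrightarrow> reach p q \<Longrightarrow> oriented_foliation.reach X (flip (-1) e2 ` F) q p"
proof -
  assume e2: "e2 \<in> unit_sign" and "reach p q"
  then obtain a u v where a: "pos a u v" "a u = p" "a v = q" unfolding reach_def by blast
  have s1: "1 \<in> unit_sign" "-1 \<in> unit_sign" by (auto simp: unit_sign_def)
  interpret A: oriented_foliation X "flip 1 e2 ` F" by (rule flip_oriented[OF s1(1) e2])
  interpret B: oriented_foliation X "flip (-1) e2 ` F" by (rule flip_oriented[OF s1(2) e2])
  show "A.reach p q" unfolding A.reach_def using pos_flip(1)[OF a(1) e2] a(2,3) by blast
  have "(\<lambda>t. a (- t)) (- v) = q" "(\<lambda>t. a (- t)) (- u) = p" using a by simp_all
  then show "B.reach q p" unfolding B.reach_def using pos_flip(2)[OF a(1) e2] by blast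
qed

text \<open>The path from \<open>y1\<close> to \<open>yr\<close> may meet the segment many times.
  After its last visit to an end of the segment, its next return lies strictly inside, and this
  point of return can take the place of \<open>yr\<close>.\<close>

lemma independent_loops_up:
  assumes c: "c \<in> F" and y: "y0 < yr" "yr < y1"
    and a: "pos a u v" "u < v" "a u = pt c (0, y0)" "a v = pt c (0, y1)"
      "\<And>t. u < t \<Longrightarrow> t < v \<Longrightarrow> a t \<notin> seg c y0 y1"
    and r: "reach (pt c (0, y1)) (pt c (0, yr))"
  shows "independent_loops X (pt c (0, y1))"
proof -
  obtain b u' v' where b: "pos b u' v'" "b u' = pt c (0, y1)" "b v' = pt c (0, yr)"
    using r unfolding reach_def by blast
  have neq: "pt c (0, y0) \<noteq> pt c (0, yr)" "pt c (0, y0) \<noteq> pt c (0, y1)" "pt c (0, yr) \<noteq> pt c (0, y1)"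
    using pt_inj[OF c] y by auto
  have segs: "pt c (0, y0) \<in> seg c y0 y1" "pt c (0, yr) \<in> seg c y0 y1" "pt c (0, y1) \<in> seg c y0 y1"
    using seg_pt[OF c] y by auto
  define H where "H = {t \<in> {u'..v'}. b t \<in> seg c y0 y1}"
  have finH: "finite H" unfolding H_def by (rule finite_returns[OF b(1) c])
  have "u' < v'" using pos_le[OF b(1)] b(2,3) neq by (cases "u' = v'") auto
  define E where "E = {t \<in> H. b t = pt c (0, y0) \<or> b t = pt c (0, y1)}"
  have E: "finite E" "u' \<in> E"
    using finite_subset[OF _ finH, of E] segs b \<open>u' < v'\<close> by (auto simp: E_def H_def)
  define s where "s = Max E"
  have sE: "s \<in> E" unfolding s_def by (rule Max_in) (use E in auto)
  have s_max: "t \<le> s" if "t \<in> E" for t unfolding s_def by (rule Max_ge[OF E(1) that])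
  have s: "u' \<le> s" "s < v'" using sE neq b(3) by (auto simp: E_def H_def order_le_less)
  define W where "W = {t \<in> H. s < t}"
  have W: "finite W" "v' \<in> W"
    using finite_subset[OF _ finH, of W] segs b s by (auto simp: W_def H_def)
  define w where "w = Min W"
  have wW: "w \<in> W" unfolding w_def by (rule Min_in) (use W in auto)
  have w_min: "w \<le> t" if "t \<in> W" for t unfolding w_def by (rule Min_le[OF W(1) that])
  have w: "s < w" "w \<le> v'" "b w \<in> seg c y0 y1" using wW by (auto simp: W_def H_def)
  have "w \<notin> E" using s_max[of w] w by auto
  obtain yw where yw: "b w = pt c (0, yw)" "y0 \<le> yw" "yw \<le> y1" using w(3) unfolding seg_def by auto
  have "yw \<noteq> y0" "yw \<noteq> y1" using \<open>w \<notin> E\<close> yw wW by (auto simp: E_def W_def)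
  then have yw': "y0 < yw" "yw < y1" using yw by auto
  have b': "pos b s w" by (rule pos_sub[OF b(1)]) (use s w in auto)
  have gap: "b t \<notin> seg c y0 y1" if "s < t" "t < w" for t
  proof
    assume "b t \<in> seg c y0 y1"
    then have "t \<in> W" using that s w by (auto simp: W_def H_def)
    then show False using w_min[of t] that by simp
  qed
  \<comment> \<open>If the excursion started at \<open>y0\<close>, it would follow \<open>a\<close>
    by determinism. Then it would pass \<open>y1\<close> before its return, or \<open>a\<close>
    would meet the segment at an interior time.\<close>
  have "b s \<noteq> pt c (0, y0)"
  proof
    assume bs: "b s = pt c (0, y0)"
    have "a v \<in> b ` {s..w} \<or> b w \<in> a ` {u..v}"
      by (rule forward_determinism[OF a(1) b']) (simp add: bs a(3))
    then show False
    proof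
      assume "a v \<in> b ` {s..w}"
      then obtain t where t: "s \<le> t" "t \<le> w" "b t = pt c (0, y1)" using a(4) by force
      have "t \<noteq> s" "t \<noteq> w" using t bs yw yw' pt_inj[OF c] y by auto
      then show False using gap[of t] t segs by auto
    next
      assume "b w \<in> a ` {u..v}"
      then obtain t where t: "u \<le> t" "t \<le> v" "a t = pt c (0, yw)" using yw by force
      have "t \<noteq> u" "t \<noteq> v" using t a(3,4) yw' pt_inj[OF c] y by auto
      then show False using a(5)[of t] t w(3) yw by auto
    qed
  qed
  then have "b s = pt c (0, y1)" using sE by (auto simp: E_def)
  then show ?thesis
    using independent_loops_core[OF c yw' a b' w(1) _ yw(1) gap] by blast
qed

text \<open>\<open>e\<close> is the sign of \<open>y1 - y0\<close>; multiplying the second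
  coordinate by it makes the arc ascend.\<close>

lemma independent_loops_forward:
  assumes c: "c \<in> F" and e: "e \<in> unit_sign" and y: "e * y0 < e * yr" "e * yr < e * y1"
    and a: "pos a u v" "u < v" "a u = pt c (0, y0)" "a v = pt c (0, y1)"
      "\<And>t. u < t \<Longrightarrow> t < v \<Longrightarrow> a t \<notin> seg c (min y0 y1) (max y0 y1)"
    and r: "reach (pt c (0, y1)) (pt c (0, yr))"
  shows "independent_loops X (pt c (0, y1))"
proof -
  have s1: "1 \<in> unit_sign" by (auto simp: unit_sign_def)
  let ?F = "flip 1 e ` F" and ?c = "flip 1 e c"
  interpret G: oriented_foliation X ?F by (rule flip_oriented[OF s1 e])
  have c': "?c \<in> ?F" using c by auto
  have ptc: "pt ?c (0, e * y) = pt c (0, y)" for y using pt_flip[OF planar[OF c] s1 e, of 0 y] by simp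
  have segc: "seg ?c (e * y0) (e * y1) \<subseteq> seg c (min y0 y1) (max y0 y1)"
  proof
    fix q assume "q \<in> seg ?c (e * y0) (e * y1)"
    then have "q \<in> fst c" "px c q = 0" "e * y0 \<le> e * py c q" "e * py c q \<le> e * y1"
      using G.seg_iff[OF c'] by auto
    then show "q \<in> seg c (min y0 y1) (max y0 y1)"
      using e unfolding seg_iff[OF c] by (auto elim!: unit_sign_cases)
  qed
  have "independent_loops X (pt ?c (0, e * y1))"
  proof (rule G.independent_loops_up[OF c' y])
    show "G.pos a u v" by (rule pos_flip(1)[OF a(1) e])
    show "G.reach (pt ?c (0, e * y1)) (pt ?c (0, e * yr))" unfolding ptc by (rule reach_flip(1)[OF e r])
    show "a t \<notin> seg ?c (e * y0) (e * y1)" if "u < t" "t < v" for t using a(5)[OF that] segc by blast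
  qed (use a ptc in auto)
  then show ?thesis by (simp only: ptc)
qed

text \<open>Reversing the transversals or the leaves reduces all four relative positions of the three
  points of return to the one treated above.\<close>

lemma recurrent_independent_loops:
  assumes c: "c \<in> F" and al: "al < be"
    and dense: "\<And>y1 y2. al \<le> y1 \<Longrightarrow> y1 < y2 \<Longrightarrow> y2 \<le> be \<Longrightarrow>
      \<exists>y. y1 < y \<and> y < y2 \<and> (p, pt c (0, y)) \<in> same_leaf F"
  shows "\<exists>b\<in>fst c. independent_loops X b"
proof -
  have sym: "(q, p) \<in> same_leaf F" if "(p, q) \<in> same_leaf F" for p q
    using that sym_trancl[of "{(p, q). \<exists>P\<in>plaques F. p \<in> P \<and> q \<in> P}"]
    unfolding same_leaf_def by (auto simp: sym_def)
  have trans: "(p, r) \<in> same_leaf F" if "(p, q) \<in> same_leaf F" "(q, r) \<in> same_leaf F" for p q r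
    using that unfolding same_leaf_def by (rule trancl_trans)
  define mid where "mid = (al + be) / 2"
  have mid: "al < mid" "mid < be" using al by (auto simp: mid_def)
  obtain z1 where z1: "al < z1" "z1 < mid" "(p, pt c (0, z1)) \<in> same_leaf F" using dense[of al mid] mid by auto
  obtain z2 where z2: "mid < z2" "z2 < be" "(p, pt c (0, z2)) \<in> same_leaf F" using dense[of mid be] mid by auto
  have "(pt c (0, z1), pt c (0, z2)) \<in> same_leaf F" using trans[OF sym[OF z1(3)] z2(3)] .
  from same_leaf_reach[OF this] obtain a u v where a: "pos a u v"
    and ends: "a u = pt c (0, z1) \<and> a v = pt c (0, z2) \<or> a u = pt c (0, z2) \<and> a v = pt c (0, z1)"
    unfolding reach_def by blast
  have "z1 \<noteq> z2" using z1 z2 by simp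
  then have neq: "a u \<noteq> a v" using ends pt_inj[OF c] by auto
  have ends_seg: "a u \<in> seg c al be" "a v \<in> seg c al be" using ends seg_pt[OF c] z1 z2 mid by auto
  have au: "(p, a u) \<in> same_leaf F" using ends z1 z2 by auto
  have uv: "u < v" using pos_le[OF a] neq by (cases "u = v") auto
  define H where "H = {t \<in> {u..v}. a t \<in> seg c al be}"
  have finH: "finite H" unfolding H_def by (rule finite_returns[OF a c])
  \<comment> \<open>The leaf may pass through \<open>a u\<close> repeatedly. From the last such time
    to the next return there is an arc with distinct ends on the segment and interior off
    it.\<close>
  define E where "E = {t \<in> H. a t = a u}"
  have E: "finite E" "u \<in> E"
    using finite_subset[OF _ finH, of E] ends_seg uv by (auto simp: E_def H_def)
  define s where "s = Max E"
  have sE: "s \<in> E" unfolding s_def by (rule Max_in) (use E in auto)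
  have s_max: "t \<le> s" if "t \<in> E" for t unfolding s_def by (rule Max_ge[OF E(1) that])
  have s: "u \<le> s" "s < v" "a s = a u" using sE neq by (auto simp: E_def H_def order_le_less)
  define W where "W = {t \<in> H. s < t}"
  have W: "finite W" "v \<in> W"
    using finite_subset[OF _ finH, of W] ends_seg s by (auto simp: W_def H_def)
  define w where "w = Min W"
  have wW: "w \<in> W" unfolding w_def by (rule Min_in) (use W in auto)
  have w_min: "w \<le> t" if "t \<in> W" for t unfolding w_def by (rule Min_le[OF W(1) that])
  have w: "s < w" "w \<le> v" "a w \<in> seg c al be" using wW by (auto simp: W_def H_def)
  have "w \<notin> E" using s_max[of w] w by auto
  then have aw: "a w \<noteq> a s" using wW s by (auto simp: E_def W_def)
  obtain y0 where y0: "a s = pt c (0, y0)" "al \<le> y0" "y0 \<le> be" using ends_seg(1) s(3) unfolding seg_def by auto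
  obtain y1 where y1: "a w = pt c (0, y1)" "al \<le> y1" "y1 \<le> be" using w(3) unfolding seg_def by auto
  have "y0 \<noteq> y1" using aw y0 y1 by auto
  have a': "pos a s w" by (rule pos_sub[OF a]) (use s w in auto)
  have gap: "a t \<notin> seg c al be" if "s < t" "t < w" for t
  proof
    assume "a t \<in> seg c al be"
    then have "t \<in> W" using that s w by (auto simp: W_def H_def)
    then show False using w_min[of t] that by simp
  qed
  have gap': "a t \<notin> seg c (min y0 y1) (max y0 y1)" if "s < t" "t < w" for t
  proof -
    have "{min y0 y1..max y0 y1} \<subseteq> {al..be}" using y0 y1 by auto
    then have "seg c (min y0 y1) (max y0 y1) \<subseteq> seg c al be" unfolding seg_def by (rule image_mono)
    then show ?thesis using gap[OF that] by blast
  qed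
  have "\<exists>e\<in>unit_sign. e * y0 < e * y1"
    using \<open>y0 \<noteq> y1\<close> by (cases "y0 < y1") (auto simp: unit_sign_def)
  then obtain e where e: "e \<in> unit_sign" "e * y0 < e * y1" by blast
  \<comment> \<open>The heights \<open>y0\<close> and \<open>y1\<close> are dictated by the leaf,
    which is why \<open>dense\<close> speaks of every subinterval.\<close>
  have "\<exists>y. min y0 y1 < y \<and> y < max y0 y1 \<and> (p, pt c (0, y)) \<in> same_leaf F"
    by (rule dense) (use y0 y1 \<open>y0 \<noteq> y1\<close> in auto)
  then obtain yr where yr: "min y0 y1 < yr" "yr < max y0 y1" "(p, pt c (0, yr)) \<in> same_leaf F" by blast
  have eyr: "e * y0 < e * yr" "e * yr < e * y1" using e yr(1,2) by (auto elim!: unit_sign_cases)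
  let ?r = "pt c (0, yr)"
  have "reach (a u) ?r \<or> reach ?r (a u)" using same_leaf_reach[OF trans[OF sym[OF au] yr(3)]] .
  moreover have "reach (a u) (a w)" using pos_reach[OF a order_refl, of w] s w by auto
  ultimately have "reach (a w) ?r \<or> reach ?r (a w)" using reach_forth reach_trans by blast
  then show ?thesis
  proof
    assume "reach (a w) ?r"
    then have "independent_loops X (pt c (0, y1))"
      using independent_loops_forward[OF c e(1) eyr a' w(1) y0(1) y1(1) gap'] y1 by simp
    then show ?thesis using pt_in[OF planar[OF c]] by blast
  next
    \<comment> \<open>Here the third point precedes \<open>a w\<close>. It is not on the arc, so on
      the way back from \<open>a w\<close> one meets \<open>a s\<close> first, and the third point
      precedes \<open>a s\<close> as well. With the leaves reversed, the arc runs from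
      \<open>y1\<close> to \<open>y0\<close> and the third point comes after it.\<close>
    assume "reach ?r (a w)"
    then obtain b u' v' where b: "pos b u' v'" "b u' = ?r" "b v' = a w" unfolding reach_def by blast
    have "a s \<in> b ` {u'..v'} \<or> b u' \<in> a ` {s..w}"
      by (rule backward_determinism[OF a' b(1)]) (simp add: b)
    moreover have "b u' \<notin> a ` {s..w}"
    proof
      assume "b u' \<in> a ` {s..w}"
      then obtain t where t: "s \<le> t" "t \<le> w" "a t = ?r" using b(2) by force
      have "yr \<noteq> y0" "yr \<noteq> y1" using yr by auto
      then have "t \<noteq> s" "t \<noteq> w" using t y0 y1 pt_inj[OF c] by auto
      moreover have "?r \<in> seg c (min y0 y1) (max y0 y1)" using seg_pt[OF c] yr by auto
      ultimately show False using gap'[of t] t by auto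
    qed
    ultimately obtain t where "t \<in> {u'..v'}" "b t = a s" by force
    then have rs: "reach ?r (a s)" using pos_reach[OF b(1) order_refl, of t] b by auto
    have s1: "1 \<in> unit_sign" "-1 \<in> unit_sign" by (auto simp: unit_sign_def)
    let ?F = "flip (-1) 1 ` F" and ?c = "flip (-1) 1 c"
    interpret G: oriented_foliation X ?F by (rule flip_oriented[OF s1(2,1)])
    have c': "?c \<in> ?F" using c by auto
    have ptc: "pt ?c (0, y) = pt c (0, y)" for y using pt_flip[OF planar[OF c] s1(2,1), of 0 y] by simp
    have segc: "seg ?c y y' = seg c y y'" for y y' unfolding seg_def ptc ..
    have "- e \<in> unit_sign" using e by (auto simp: unit_sign_def)
    have "independent_loops X (pt ?c (0, y0))"
    proof (rule G.independent_loops_forward[OF c' \<open>- e \<in> unit_sign\<close>])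
      show "G.pos (\<lambda>t. a (- t)) (- w) (- s)" by (rule pos_flip(2)[OF a' s1(1)])
      show "G.reach (pt ?c (0, y0)) (pt ?c (0, yr))"
        using reach_flip(2)[OF s1(1) rs] y0 by (simp only: ptc)
      show "a (- t) \<notin> seg ?c (min y1 y0) (max y1 y0)" if "- w < t" "t < - s" for t
        using gap'[of "- t"] that by (simp add: segc min.commute max.commute)
      show "- e * y1 < - e * yr" "- e * yr < - e * y0" using eyr by simp_all
    qed (use w y0 y1 ptc in auto)
    then show ?thesis using pt_in[OF planar[OF c]] ptc by metis
  qed
qed

end

subsection \<open>From foliated to order compatibility\<close>

lemma connected_constant_sign:
  fixes f :: "'a::topological_space \<Rightarrow> real"
  assumes "connected S" "continuous_on S f" "\<And>z. z \<in> S \<Longrightarrow> f z \<noteq> 0"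
  shows "\<exists>e\<in>unit_sign. \<forall>z\<in>S. e * f z > 0"
proof (cases "\<exists>z\<in>S. f z > 0")
  case True
  then obtain z where z: "z \<in> S" "f z > 0" by blast
  have "f w > 0" if w: "w \<in> S" for w
  proof (rule ccontr)
    assume "\<not> f w > 0"
    then have "f w \<le> 0" by simp
    have "connected (f ` S)" using assms by (intro connected_continuous_image)
    then have "0 \<in> f ` S" using connectedD_interval[of "f ` S" "f w" "f z" 0] z w \<open>f w \<le> 0\<close> by auto
    then show False using assms(3) by auto
  qed
  then show ?thesis by (intro bexI[of _ 1]) (auto simp: unit_sign_def)
next
  case False
  then have "f w < 0" if "w \<in> S" for w using assms(3)[OF that] that by force
  then show ?thesis by (intro bexI[of _ "-1"]) (auto simp: unit_sign_def)
qed

lemma foliated_compatibleD: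
  assumes "foliated_compatible X c d" "p \<in> fst c" "p \<in> fst d"
  shows "\<exists>W g. openin X W \<and> p \<in> W \<and> W \<subseteq> fst c \<inter> fst d \<and> (\<forall>q\<in>W. py d q = g (py c q))"
proof -
  have "\<forall>p\<in>fst c \<inter> fst d. \<exists>W g. openin X W \<and> p \<in> W \<and> W \<subseteq> fst c \<inter> fst d \<and> (\<forall>q\<in>W. py d q = g (py c q))"
    using assms(1) by (cases c, cases d) (simp add: foliated_compatible_def)
  from bspec[OF this, of p] show ?thesis using assms(2,3) by simp
qed

text \<open>In a product box at \<open>p\<close>, compatibility in both directions makes
  \<open>py d\<close> an injective function of \<open>py c\<close>, and on each plaque
  \<open>px d\<close> is injective because the chart \<open>d\<close> is. Differences of values at
  ordered pairs then never vanish, and they keep their sign because the set of such pairs is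
  convex.\<close>

lemma foliated_compatible_order:
  assumes c: "planar_chart M c" and d: "planar_chart M d" and p: "p \<in> fst c" "p \<in> fst d"
    and cd: "foliated_compatible M c d" and dc: "foliated_compatible M d c"
  shows "\<exists>e1\<in>unit_sign. \<exists>e2\<in>unit_sign. order_compatible_at M p c (flip e1 e2 d)"
proof -
  obtain W1 g where W1: "openin M W1" "p \<in> W1" "W1 \<subseteq> fst c \<inter> fst d" "\<forall>q\<in>W1. py d q = g (py c q)"
    using foliated_compatibleD[OF cd p] by (elim exE conjE)
  obtain W2 g' where W2: "openin M W2" "p \<in> W2" "\<forall>q\<in>W2. py c q = g' (py d q)"
    using foliated_compatibleD[OF dc p(2,1)] by (elim exE conjE)
  define W where "W = W1 \<inter> W2"
  have W: "openin M W" "p \<in> W" using W1 W2 by (auto simp: W_def)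
  have "openin euclidean {z \<in> topspace euclidean. pt c z \<in> W}"
    by (rule openin_continuous_map_preimage[OF continuous_map_pt[OF c] W(1)])
  then have "open {z. pt c z \<in> W}" by simp
  moreover have "snd c p \<in> {z. pt c z \<in> W}" using pt_snd[OF c p(1)] W by simp
  ultimately obtain A B where AB: "open A" "open B" "snd c p \<in> A \<times> B" "A \<times> B \<subseteq> {z. pt c z \<in> W}"
    by (metis open_prod_elim)
  obtain r1 where r1: "r1 > 0" "ball (px c p) r1 \<subseteq> A" using AB openE[of A "px c p"] by (auto simp: mem_Times_iff)
  obtain r2 where r2: "r2 > 0" "ball (py c p) r2 \<subseteq> B" using AB openE[of B "py c p"] by (auto simp: mem_Times_iff)
  define I where "I = ball (px c p) r1"
  define J where "J = ball (py c p) r2"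
  have IJ: "px c p \<in> I" "py c p \<in> J" "open I" "open J" "convex I" "convex J" using r1 r2 by (auto simp: I_def J_def)
  have in_W: "pt c (x, y) \<in> W" if "x \<in> I" "y \<in> J" for x y
    using that r1 r2 AB(4) unfolding I_def J_def by blast
  define V where "V = pt c ` (I \<times> J)"
  have V: "openin M V" "p \<in> V" "V \<subseteq> fst c \<inter> fst d"
  proof -
    show "openin M V" unfolding V_def using IJ by (intro planar_chart_image_open[OF c] open_Times)
    have "p = pt c (px c p, py c p)" using pt_snd[OF c p(1)] by simp
    then show "p \<in> V" unfolding V_def using IJ by (metis SigmaI image_eqI)
    show "V \<subseteq> fst c \<inter> fst d" unfolding V_def using in_W W1 by (auto simp: W_def)
  qed
  have V_coord: "px c q \<in> I" "py c q \<in> J" "pt c (px c q, py c q) = q" "q \<in> W" if "q \<in> V" for q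
    using that in_W by (auto simp: V_def snd_pt[OF c])
  define H where "H z = snd d (pt c z)" for z
  have H_cont: "continuous_on (I \<times> J) (\<lambda>z. fst (H z))" "continuous_on (I \<times> J) (\<lambda>z. snd (H z))"
  proof -
    have 1: "continuous_map (top_of_set (I \<times> J)) M (pt c)"
      using continuous_map_pt[OF c] continuous_map_from_subtopology by blast
    have 2: "pt c z \<in> fst d" if "z \<in> I \<times> J" for z using that V(3) unfolding V_def by blast
    show "continuous_on (I \<times> J) (\<lambda>z. fst (H z))" "continuous_on (I \<times> J) (\<lambda>z. snd (H z))"
      unfolding H_def by (rule planar_chart_continuous[OF d 1 2]; assumption)+
  qed
  have H_snd: "snd (H (x, y)) = g y" if "x \<in> I" "y \<in> J" for x y
    using bspec[OF W1(4), of "pt c (x, y)"] in_W[OF that] by (simp add: H_def W_def snd_pt[OF c])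
  have pyd: "py d q = g (py c q)" if "q \<in> V" for q
    using V_coord(4)[OF that] bspec[OF W1(4), of q] by (simp add: W_def)
  have g_inj: "y = y'" if "y \<in> J" "y' \<in> J" "g y = g y'" for y y'
  proof -
    have "py d (pt c (px c p, y)) = py d (pt c (px c p, y'))"
      using H_snd[OF IJ(1)] that by (simp add: H_def)
    moreover have "y = g' (py d (pt c (px c p, y)))" "y' = g' (py d (pt c (px c p, y')))"
      using bspec[OF W2(3), of "pt c (px c p, y)"] bspec[OF W2(3), of "pt c (px c p, y')"] in_W[OF IJ(1)] that
      by (simp_all add: W_def snd_pt[OF c])
    ultimately show ?thesis by simp
  qed
  define SY where "SY = (J \<times> J) \<inter> {z. inner (1, -1) z < (0::real)}"
  have SY: "z \<in> SY \<longleftrightarrow> fst z \<in> J \<and> snd z \<in> J \<and> fst z < snd z" for z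
    by (cases z) (auto simp: SY_def)
  have "\<exists>e\<in>unit_sign. \<forall>z\<in>SY. e * (snd (H (px c p, snd z)) - snd (H (px c p, fst z))) > 0"
  proof (rule connected_constant_sign)
    show "connected SY" unfolding SY_def
      by (intro convex_connected convex_Int convex_Times convex_halfspace_lt IJ)
    have 1: "continuous_on SY (\<lambda>z. snd (H (px c p, snd z)))"
      by (rule continuous_on_compose2[OF H_cont(2)]) (auto intro!: continuous_intros simp: SY IJ)
    have 2: "continuous_on SY (\<lambda>z. snd (H (px c p, fst z)))"
      by (rule continuous_on_compose2[OF H_cont(2)]) (auto intro!: continuous_intros simp: SY IJ)
    show "continuous_on SY (\<lambda>z. snd (H (px c p, snd z)) - snd (H (px c p, fst z)))"
      by (rule continuous_on_diff[OF 1 2])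
    show "snd (H (px c p, snd z)) - snd (H (px c p, fst z)) \<noteq> 0" if "z \<in> SY" for z
      using that g_inj[of "snd z" "fst z"] H_snd[OF IJ(1)] unfolding SY by auto
  qed
  then obtain e2 where e2: "e2 \<in> unit_sign" "\<forall>z\<in>SY. e2 * (snd (H (px c p, snd z)) - snd (H (px c p, fst z))) > 0"
    by blast
  have e2': "e2 * g y < e2 * g y'" if "y \<in> J" "y' \<in> J" "y < y'" for y y'
    using bspec[OF e2(2), of "(y, y')"] that H_snd[OF IJ(1)] by (simp add: SY right_diff_distrib)
  \<comment> \<open>The height is carried along as a third coordinate so that a single sign serves
    all plaques of the box.\<close>
  define SX where "SX = (I \<times> I \<times> J) \<inter> {z. inner (1, -1, 0) z < (0::real)}"
  have SX: "z \<in> SX \<longleftrightarrow> fst z \<in> I \<and> fst (snd z) \<in> I \<and> snd (snd z) \<in> J \<and> fst z < fst (snd z)" for z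
    by (cases z) (auto simp: SX_def)
  have "\<exists>e\<in>unit_sign. \<forall>z\<in>SX. e * (fst (H (fst (snd z), snd (snd z))) - fst (H (fst z, snd (snd z)))) > 0"
  proof (rule connected_constant_sign)
    show "connected SX" unfolding SX_def
      by (intro convex_connected convex_Int convex_Times convex_halfspace_lt IJ)
    have 1: "continuous_on SX (\<lambda>z. fst (H (fst (snd z), snd (snd z))))"
      by (rule continuous_on_compose2[OF H_cont(1)]) (auto intro!: continuous_intros simp: SX IJ)
    have 2: "continuous_on SX (\<lambda>z. fst (H (fst z, snd (snd z))))"
      by (rule continuous_on_compose2[OF H_cont(1)]) (auto intro!: continuous_intros simp: SX IJ)
    show "continuous_on SX (\<lambda>z. fst (H (fst (snd z), snd (snd z))) - fst (H (fst z, snd (snd z))))"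
      by (rule continuous_on_diff[OF 1 2])
    show "fst (H (fst (snd z), snd (snd z))) - fst (H (fst z, snd (snd z))) \<noteq> 0" if z: "z \<in> SX" for z
    proof
      assume "fst (H (fst (snd z), snd (snd z))) - fst (H (fst z, snd (snd z))) = 0"
      then have "px d (pt c (fst (snd z), snd (snd z))) = px d (pt c (fst z, snd (snd z)))" by (simp add: H_def)
      moreover have "py d (pt c (fst (snd z), snd (snd z))) = py d (pt c (fst z, snd (snd z)))"
        using H_snd[of "fst (snd z)" "snd (snd z)"] H_snd[of "fst z" "snd (snd z)"] z by (simp add: H_def SX)
      moreover have "pt c (fst (snd z), snd (snd z)) \<in> fst d" "pt c (fst z, snd (snd z)) \<in> fst d"
      proof -
        have *: "pt c w \<in> fst d" if "w \<in> I \<times> J" for w using that V(3) unfolding V_def by blast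
        show "pt c (fst (snd z), snd (snd z)) \<in> fst d" "pt c (fst z, snd (snd z)) \<in> fst d"
          using *[of "(fst (snd z), snd (snd z))"] *[of "(fst z, snd (snd z))"] z
          by (simp_all add: SX mem_Times_iff)
      qed
      ultimately have "pt c (fst (snd z), snd (snd z)) = pt c (fst z, snd (snd z))"
        using planar_chart_inj[OF d] by blast
      then have "(fst (snd z), snd (snd z)) = (fst z, snd (snd z))" using snd_pt[OF c] by metis
      then show False using z unfolding SX by (metis Pair_inject less_irrefl)
    qed
  qed
  then obtain e1 where e1: "e1 \<in> unit_sign"
    "\<forall>z\<in>SX. e1 * (fst (H (fst (snd z), snd (snd z))) - fst (H (fst z, snd (snd z)))) > 0"
    by blast
  have e1': "e1 * fst (H (x, y)) < e1 * fst (H (x', y))" if "x \<in> I" "x' \<in> I" "y \<in> J" "x < x'" for x x' y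
    using bspec[OF e1(2), of "(x, x', y)"] that by (simp add: SX right_diff_distrib)
  have pxd: "px d q = fst (H (px c q, py c q))" if "q \<in> V" for q
    using V_coord(3)[OF that] by (simp add: H_def)
  have "same_order c (flip e1 e2 d) V"
    unfolding same_order_def
  proof (intro ballI conjI impI)
    fix q r assume qr: "q \<in> V" "r \<in> V"
    note q = V_coord[OF qr(1)] and r = V_coord[OF qr(2)]
    show "(py c q < py c r) = (py (flip e1 e2 d) q < py (flip e1 e2 d) r)"
      using e2'[OF q(2) r(2)] e2'[OF r(2) q(2)] pyd[OF qr(1)] pyd[OF qr(2)]
      by (cases "py c q" "py c r" rule: linorder_cases) auto
    assume eq: "py c q = py c r"
    show "(px c q < px c r) = (px (flip e1 e2 d) q < px (flip e1 e2 d) r)"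
      using e1'[OF q(1) r(1) q(2)] e1'[OF r(1) q(1) q(2)] pxd[OF qr(1)] pxd[OF qr(2)] eq
      by (cases "px c q" "px c r" rule: linorder_cases) auto
  qed
  then have "order_compatible_at M p c (flip e1 e2 d)"
    unfolding order_compatible_at_def using V by (intro exI[of _ V]) auto
  then show ?thesis using e1(1) e2(1) by blast
qed

text \<open>Every neighbourhood of \<open>p\<close> contains a point to the right of
  \<open>p\<close> on its plaque and one above \<open>p\<close>, and a sign change reverses one of
  these orders. Hence the four flips of a chart have distinct germs.\<close>

lemma order_compatible_at_flip_trivial:
  assumes c: "planar_chart M c" and e: "e1 \<in> unit_sign" "e2 \<in> unit_sign"
    and oc: "order_compatible_at M p c (flip e1 e2 c)"
  shows "e1 = 1 \<and> e2 = 1"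
proof -
  obtain W where W: "openin M W" "p \<in> W" "W \<subseteq> fst c" "same_order c (flip e1 e2 c) W"
    using oc unfolding order_compatible_at_def by auto
  have "openin euclidean {z \<in> topspace euclidean. pt c z \<in> W}"
    by (rule openin_continuous_map_preimage[OF continuous_map_pt[OF c] W(1)])
  then have o: "open {z. pt c z \<in> W}" by simp
  have p: "p \<in> fst c" using W by blast
  have "snd c p \<in> {z. pt c z \<in> W}" using pt_snd[OF c p] W by simp
  then obtain A B where AB: "open A" "open B" "snd c p \<in> A \<times> B" "A \<times> B \<subseteq> {z. pt c z \<in> W}"
    using o by (metis open_prod_elim)
  obtain r1 where r1: "r1 > 0" "ball (px c p) r1 \<subseteq> A" using AB openE[of A "px c p"] by (auto simp: mem_Times_iff)
  obtain r2 where r2: "r2 > 0" "ball (py c p) r2 \<subseteq> B" using AB openE[of B "py c p"] by (auto simp: mem_Times_iff)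
  have "(px c p + r1/2, py c p) \<in> A \<times> B" "(px c p, py c p + r2/2) \<in> A \<times> B"
    using r1 r2 AB(3) by (auto simp: mem_Times_iff dist_real_def subset_iff)
  then have q: "pt c (px c p + r1/2, py c p) \<in> W" "pt c (px c p, py c p + r2/2) \<in> W" using AB(4) by blast+
  have "e1 * px c p < e1 * (px c p + r1/2)"
    using same_orderD(3)[OF W(4) W(2) q(1)] r1 by (simp add: snd_pt[OF c])
  moreover have "e2 * py c p < e2 * (py c p + r2/2)"
    using same_orderD(1)[OF W(4) W(2) q(2)] r2 by (simp add: snd_pt[OF c])
  ultimately show ?thesis using e r1 r2 by (auto elim!: unit_sign_cases)
qed

text \<open>If one of the sets misses a subinterval, the remaining ones are jointly dense there.
  This picks one of the four sheets over a transversal.\<close>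

lemma finite_dense_union:
  fixes P :: "'e \<Rightarrow> real \<Rightarrow> bool"
  assumes "finite E" "a < b" "\<And>y1 y2. a \<le> y1 \<Longrightarrow> y1 < y2 \<Longrightarrow> y2 \<le> b \<Longrightarrow> \<exists>y. y1 < y \<and> y < y2 \<and> (\<exists>e\<in>E. P e y)"
  shows "\<exists>e\<in>E. \<exists>al be. al < be \<and> (\<forall>y1 y2. al \<le> y1 \<longrightarrow> y1 < y2 \<longrightarrow> y2 \<le> be \<longrightarrow> (\<exists>y. y1 < y \<and> y < y2 \<and> P e y))"
  using assms
proof (induction E arbitrary: a b rule: finite_induct)
  case empty
  then show ?case by (metis empty_iff order_refl)
next
  case (insert e E)
  show ?case
  proof (cases "\<forall>y1 y2. a \<le> y1 \<longrightarrow> y1 < y2 \<longrightarrow> y2 \<le> b \<longrightarrow> (\<exists>y. y1 < y \<and> y < y2 \<and> P e y)")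
    case True
    then show ?thesis using insert.prems(1) by blast
  next
    case False
    then obtain y1 y2 where y: "a \<le> y1" "y1 < y2" "y2 \<le> b" "\<And>y. y1 < y \<Longrightarrow> y < y2 \<Longrightarrow> \<not> P e y" by blast
    have "\<exists>e\<in>E. \<exists>al be. al < be \<and> (\<forall>y1 y2. al \<le> y1 \<longrightarrow> y1 < y2 \<longrightarrow> y2 \<le> be \<longrightarrow> (\<exists>y. y1 < y \<and> y < y2 \<and> P e y))"
    proof (rule insert.IH[OF y(2)])
      fix z1 z2 assume z: "y1 \<le> z1" "z1 < z2" "z2 \<le> y2"
      then obtain z where "z1 < z" "z < z2" "\<exists>e\<in>insert e E. P e z"
        using insert.prems(2)[of z1 z2] y by auto
      then show "\<exists>y. z1 < y \<and> y < z2 \<and> (\<exists>e\<in>E. P e y)" using y(4)[of z] z by auto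
    qed
    then show ?thesis by blast
  qed
qed

subsection \<open>The orientation cover\<close>

locale foliated_surface =
  fixes M :: "'a topology" and F :: "'a chart set"
  assumes Hausdorff_M: "Hausdorff_space M" and foliation: "foliation M F"
begin

definition signed_charts :: "'a chart set" where
  "signed_charts = {flip e1 e2 c | e1 e2 c. e1 \<in> unit_sign \<and> e2 \<in> unit_sign \<and> c \<in> F}"

text \<open>The points of the orientation cover over \<open>m\<close> are the four classes of signed charts at
  \<open>m\<close> that order both coordinates in the same way.\<close>

definition germ :: "'a \<Rightarrow> 'a chart \<Rightarrow> 'a chart set" where
  "germ m c = {d \<in> signed_charts. m \<in> fst d \<and> order_compatible_at M m c d}"

definition sheet :: "'a chart \<Rightarrow> ('a \<times> 'a chart set) set" where
  "sheet c = (\<lambda>m. (m, germ m c)) ` fst c"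

text \<open>The final topology for the sections \<open>m \<mapsto> (m, germ m c)\<close>. That the
  sheets are open is then a consequence of \<open>openin_agree\<close>.\<close>

definition cover_topology :: "('a \<times> 'a chart set) topology" where
  "cover_topology = topology (\<lambda>W. W \<subseteq> \<Union> (sheet ` signed_charts) \<and>
     (\<forall>c\<in>signed_charts. openin M {m \<in> fst c. (m, germ m c) \<in> W}))"

definition lift_chart :: "'a chart \<Rightarrow> ('a \<times> 'a chart set) chart" where
  "lift_chart c = (sheet c, \<lambda>z. snd c (fst z))"

lemma planar_F: "c \<in> F \<Longrightarrow> planar_chart M c"
  using foliation unfolding foliation_def by blast

lemma planar_signed: "c \<in> signed_charts \<Longrightarrow> planar_chart M c"
  unfolding signed_charts_def using planar_F planar_chart_flip by blast

lemma open_signed: "c \<in> signed_charts \<Longrightarrow> openin M (fst c)"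
  using planar_signed planar_chart_open by blast

lemma unit_sign_mult: "e \<in> unit_sign \<Longrightarrow> e' \<in> unit_sign \<Longrightarrow> e * e' \<in> unit_sign"
  by (auto simp: unit_sign_def)

lemma flip_signed: "c \<in> signed_charts \<Longrightarrow> e1 \<in> unit_sign \<Longrightarrow> e2 \<in> unit_sign \<Longrightarrow> flip e1 e2 c \<in> signed_charts"
proof -
  assume "c \<in> signed_charts" and e: "e1 \<in> unit_sign" "e2 \<in> unit_sign"
  then obtain s1 s2 c0 where c: "s1 \<in> unit_sign" "s2 \<in> unit_sign" "c0 \<in> F" "c = flip s1 s2 c0"
    unfolding signed_charts_def by blast
  then have "flip e1 e2 c = flip (e1 * s1) (e2 * s2) c0" by (simp add: flip_flip)
  then show ?thesis unfolding signed_charts_def using unit_sign_mult[OF e(1) c(1)] unit_sign_mult[OF e(2) c(2)] c(3) by blast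
qed

lemma F_signed: "c \<in> F \<Longrightarrow> c \<in> signed_charts"
proof -
  assume "c \<in> F"
  moreover have "1 \<in> unit_sign" "flip 1 1 c = c" by (auto simp: unit_sign_def)
  ultimately show ?thesis unfolding signed_charts_def by (metis (mono_tags, lifting) mem_Collect_eq)
qed

text \<open>The germs over \<open>m\<close> are therefore exactly those of the four flips of any
  single chart at \<open>m\<close>.\<close>

lemma signed_compatible:
  assumes "c \<in> signed_charts" "d \<in> signed_charts" "m \<in> fst c" "m \<in> fst d"
  shows "\<exists>e1\<in>unit_sign. \<exists>e2\<in>unit_sign. order_compatible_at M m c (flip e1 e2 d)"
proof -
  obtain s1 s2 c0 where c: "s1 \<in> unit_sign" "s2 \<in> unit_sign" "c0 \<in> F" "c = flip s1 s2 c0"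
    using assms(1) unfolding signed_charts_def by blast
  obtain t1 t2 d0 where d: "t1 \<in> unit_sign" "t2 \<in> unit_sign" "d0 \<in> F" "d = flip t1 t2 d0"
    using assms(2) unfolding signed_charts_def by blast
  have m: "m \<in> fst c0" "m \<in> fst d0" using assms c d by auto
  have "foliated_compatible M c0 d0" "foliated_compatible M d0 c0"
    using foliation c d unfolding foliation_def by blast+
  then obtain e1 e2 where e: "e1 \<in> unit_sign" "e2 \<in> unit_sign" "order_compatible_at M m c0 (flip e1 e2 d0)"
    using foliated_compatible_order[OF planar_F[OF c(3)] planar_F[OF d(3)] m] by blast
  have "order_compatible_at M m c (flip s1 s2 (flip e1 e2 d0))"
    unfolding c(4) by (rule order_compatible_at_flip[OF e(3) c(1,2)])
  moreover have "flip s1 s2 (flip e1 e2 d0) = flip (s1 * e1 * t1) (s2 * e2 * t2) d"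
    unfolding d(4) flip_flip using d(1,2) by (auto simp: unit_sign_def)
  moreover have "s1 * e1 * t1 \<in> unit_sign" "s2 * e2 * t2 \<in> unit_sign" using unit_sign_mult c d e by blast+
  ultimately show ?thesis by metis
qed

lemma germ_eq_iff:
  assumes c: "c \<in> signed_charts" "m \<in> fst c" and d: "d \<in> signed_charts" "m \<in> fst d"
  shows "germ m c = germ m d \<longleftrightarrow> order_compatible_at M m c d"
proof
  assume "germ m c = germ m d"
  moreover have "d \<in> germ m d"
    unfolding germ_def using d order_compatible_at_refl[OF open_signed[OF d(1)] d(2)] by simp
  ultimately have "d \<in> germ m c" by simp
  then show "order_compatible_at M m c d" unfolding germ_def by simp
next
  assume oc: "order_compatible_at M m c d"
  show "germ m c = germ m d"
    unfolding germ_def using order_compatible_at_trans[OF oc] order_compatible_at_trans[OF order_compatible_at_sym[OF oc]]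
    by blast
qed

text \<open>For the second set: where \<open>c\<close> disagrees with \<open>d\<close>, it agrees
  with a proper flip of \<open>d\<close> throughout a neighbourhood, and agreement with
  \<open>d\<close> at a point of it would make \<open>d\<close> compatible with its own
  flip.\<close>

lemma openin_agree:
  assumes "c \<in> signed_charts" "d \<in> signed_charts"
  shows "openin M {m \<in> fst c \<inter> fst d. order_compatible_at M m c d}"
    "openin M {m \<in> fst c \<inter> fst d. \<not> order_compatible_at M m c d}"
proof -
  have oI: "openin M (fst c \<inter> fst d)" by (intro openin_Int open_signed assms)
  have near: "\<exists>W. openin M W \<and> m \<in> W \<and> W \<subseteq> fst c \<inter> fst d \<and> (\<forall>q\<in>W. order_compatible_at M q c d')"
    if m: "m \<in> fst c \<inter> fst d" and oc: "order_compatible_at M m c d'" for m d'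
  proof -
    obtain W where W: "openin M W" "m \<in> W" "\<forall>q\<in>W. order_compatible_at M q c d'"
      using order_compatible_at_nhd[OF oc] by blast
    then show ?thesis using m oI by (intro exI[of _ "W \<inter> (fst c \<inter> fst d)"]) auto
  qed
  show "openin M {m \<in> fst c \<inter> fst d. order_compatible_at M m c d}"
  proof (subst openin_subopen, rule ballI)
    fix m assume "m \<in> {m \<in> fst c \<inter> fst d. order_compatible_at M m c d}"
    then have m: "m \<in> fst c \<inter> fst d" "order_compatible_at M m c d" by auto
    obtain W where "openin M W" "m \<in> W" "W \<subseteq> fst c \<inter> fst d" "\<forall>q\<in>W. order_compatible_at M q c d"
      using near[OF m] by blast
    then show "\<exists>T. openin M T \<and> m \<in> T \<and> T \<subseteq> {m \<in> fst c \<inter> fst d. order_compatible_at M m c d}"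
      by (intro exI[of _ W]) blast
  qed
  show "openin M {m \<in> fst c \<inter> fst d. \<not> order_compatible_at M m c d}"
  proof (subst openin_subopen, rule ballI)
    fix m assume "m \<in> {m \<in> fst c \<inter> fst d. \<not> order_compatible_at M m c d}"
    then have m: "m \<in> fst c \<inter> fst d" "\<not> order_compatible_at M m c d" by auto
    obtain e1 e2 where e: "e1 \<in> unit_sign" "e2 \<in> unit_sign" "order_compatible_at M m c (flip e1 e2 d)"
      using signed_compatible[OF assms] m(1) by blast
    have nontriv: "\<not> (e1 = 1 \<and> e2 = 1)" using e(3) m(2) by auto
    obtain W where W: "openin M W" "m \<in> W" "W \<subseteq> fst c \<inter> fst d" "\<forall>q\<in>W. order_compatible_at M q c (flip e1 e2 d)"
      using near[OF m(1) e(3)] by blast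
    have "\<not> order_compatible_at M q c d" if "q \<in> W" for q
    proof
      assume oc: "order_compatible_at M q c d"
      have "order_compatible_at M q d (flip e1 e2 d)"
        by (rule order_compatible_at_trans[OF order_compatible_at_sym[OF oc] bspec[OF W(4) that]])
      then show False using order_compatible_at_flip_trivial[OF planar_signed[OF assms(2)] e(1,2)] nontriv by blast
    qed
    then show "\<exists>T. openin M T \<and> m \<in> T \<and> T \<subseteq> {m \<in> fst c \<inter> fst d. \<not> order_compatible_at M m c d}"
      using W by (intro exI[of _ W]) blast
  qed
qed

lemma openin_cover: "openin cover_topology W \<longleftrightarrow> W \<subseteq> \<Union> (sheet ` signed_charts) \<and>
     (\<forall>c\<in>signed_charts. openin M {m \<in> fst c. (m, germ m c) \<in> W})"
proof -
  let ?O = "\<lambda>W. W \<subseteq> \<Union> (sheet ` signed_charts) \<and> (\<forall>c\<in>signed_charts. openin M {m \<in> fst c. (m, germ m c) \<in> W})"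
  have "istopology ?O"
    unfolding istopology_def
  proof (intro conjI allI impI)
    fix S T assume ST: "?O S" "?O T"
    then show "S \<inter> T \<subseteq> \<Union> (sheet ` signed_charts)" by blast
    show "\<forall>c\<in>signed_charts. openin M {m \<in> fst c. (m, germ m c) \<in> S \<inter> T}"
    proof
      fix c assume c: "c \<in> signed_charts"
      have "{m \<in> fst c. (m, germ m c) \<in> S \<inter> T} = {m \<in> fst c. (m, germ m c) \<in> S} \<inter> {m \<in> fst c. (m, germ m c) \<in> T}" by blast
      then show "openin M {m \<in> fst c. (m, germ m c) \<in> S \<inter> T}" using ST c by auto
    qed
  next
    fix K assume K: "\<forall>S\<in>K. ?O S"
    then show "\<Union> K \<subseteq> \<Union> (sheet ` signed_charts)" by blast
    show "\<forall>c\<in>signed_charts. openin M {m \<in> fst c. (m, germ m c) \<in> \<Union> K}"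
    proof
      fix c assume c: "c \<in> signed_charts"
      have "{m \<in> fst c. (m, germ m c) \<in> \<Union> K} = (\<Union>S\<in>K. {m \<in> fst c. (m, germ m c) \<in> S})" by blast
      then show "openin M {m \<in> fst c. (m, germ m c) \<in> \<Union> K}" using K c by auto
    qed
  qed
  then show ?thesis unfolding cover_topology_def by (simp add: topology_inverse')
qed

lemma sheet_iff: "z \<in> sheet c \<longleftrightarrow> fst z \<in> fst c \<and> snd z = germ (fst z) c"
  unfolding sheet_def by (cases z) auto

lemma openin_section_image:
  assumes c: "c \<in> signed_charts" and V: "openin M V" "V \<subseteq> fst c"
  shows "openin cover_topology ((\<lambda>m. (m, germ m c)) ` V)"
  unfolding openin_cover
proof (intro conjI ballI)
  show "(\<lambda>m. (m, germ m c)) ` V \<subseteq> \<Union> (sheet ` signed_charts)" using c V unfolding sheet_def by blast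
  fix d assume d: "d \<in> signed_charts"
  have "{m \<in> fst d. (m, germ m d) \<in> (\<lambda>m. (m, germ m c)) ` V} = V \<inter> {m \<in> fst c \<inter> fst d. order_compatible_at M m c d}"
  proof (rule Set.set_eqI)
    fix m
    show "m \<in> {m \<in> fst d. (m, germ m d) \<in> (\<lambda>m. (m, germ m c)) ` V} \<longleftrightarrow> m \<in> V \<inter> {m \<in> fst c \<inter> fst d. order_compatible_at M m c d}"
      using germ_eq_iff[OF c _ d, of m] V(2) by auto
  qed
  then show "openin M {m \<in> fst d. (m, germ m d) \<in> (\<lambda>m. (m, germ m c)) ` V}"
    using V(1) openin_agree(1)[OF c d] by auto
qed

lemma openin_sheet: "c \<in> signed_charts \<Longrightarrow> openin cover_topology (sheet c)"
  unfolding sheet_def by (rule openin_section_image) (auto simp: open_signed)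

lemma topspace_cover: "topspace cover_topology = \<Union> (sheet ` signed_charts)"
proof
  show "topspace cover_topology \<subseteq> \<Union> (sheet ` signed_charts)"
    using openin_topspace[of cover_topology] unfolding openin_cover by blast
  show "\<Union> (sheet ` signed_charts) \<subseteq> topspace cover_topology"
    using openin_sheet openin_subset by blast
qed

lemma openin_fst_preimage:
  assumes "openin M V"
  shows "openin cover_topology {z \<in> topspace cover_topology. fst z \<in> V}"
  unfolding openin_cover topspace_cover
proof (intro conjI ballI)
  fix c assume c: "c \<in> signed_charts"
  have "{m \<in> fst c. (m, germ m c) \<in> {z \<in> \<Union> (sheet ` signed_charts). fst z \<in> V}} = fst c \<inter> V"
    using c by (auto simp: sheet_iff)
  then show "openin M {m \<in> fst c. (m, germ m c) \<in> {z \<in> \<Union> (sheet ` signed_charts). fst z \<in> V}}"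
    using open_signed[OF c] assms by auto
qed blast

lemma signed_in_M: "c \<in> signed_charts \<Longrightarrow> fst c \<subseteq> topspace M"
  using open_signed openin_subset by blast

lemma continuous_map_fst_cover: "continuous_map cover_topology M fst"
  unfolding continuous_map_def
proof (intro conjI allI impI)
  show "fst \<in> topspace cover_topology \<rightarrow> topspace M"
    using signed_in_M by (fastforce simp: topspace_cover sheet_iff)
qed (rule openin_fst_preimage)

lemma continuous_map_section:
  assumes c: "c \<in> signed_charts"
  shows "continuous_map (subtopology M (fst c)) cover_topology (\<lambda>m. (m, germ m c))"
  unfolding continuous_map_def
proof (intro conjI allI impI)
  show "(\<lambda>m. (m, germ m c)) \<in> topspace (subtopology M (fst c)) \<rightarrow> topspace cover_topology"
    using c by (auto simp: topspace_cover sheet_iff)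
  fix W assume "openin cover_topology W"
  then have "openin M {m \<in> fst c. (m, germ m c) \<in> W}" using c unfolding openin_cover by blast
  moreover have "{m \<in> topspace (subtopology M (fst c)). (m, germ m c) \<in> W} = {m \<in> fst c. (m, germ m c) \<in> W}"
    using signed_in_M[OF c] by auto
  ultimately show "openin (subtopology M (fst c)) {m \<in> topspace (subtopology M (fst c)). (m, germ m c) \<in> W}"
    using openin_open_subtopology[OF open_signed[OF c]] by (metis (no_types, lifting) mem_Collect_eq subsetI)
qed

lemma planar_lift_chart:
  assumes c: "c \<in> signed_charts"
  shows "planar_chart cover_topology (lift_chart c)"
proof -
  note pl = planar_signed[OF c]
  have hm: "homeomorphic_map (subtopology M (fst c)) euclidean (snd c)"
    using pl unfolding planar_chart_def by (auto simp: case_prod_unfold)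
  have "homeomorphic_maps (subtopology cover_topology (sheet c)) euclidean (\<lambda>z. snd c (fst z)) (\<lambda>z. (pt c z, germ (pt c z) c))"
    unfolding homeomorphic_maps_def
  proof (intro conjI ballI)
    have "continuous_map (subtopology cover_topology (sheet c)) (subtopology M (fst c)) fst"
      using continuous_map_fst_cover by (auto simp: continuous_map_in_subtopology sheet_iff intro: continuous_map_from_subtopology)
    from continuous_map_compose[OF this homeomorphic_imp_continuous_map[OF hm]]
    show "continuous_map (subtopology cover_topology (sheet c)) euclidean (\<lambda>z. snd c (fst z))" by (simp only: comp_def)
    have "continuous_map euclidean (subtopology M (fst c)) (pt c)"
      using continuous_map_pt[OF pl] pt_in[OF pl] by (auto simp: continuous_map_in_subtopology)
    from continuous_map_compose[OF this continuous_map_section[OF c]]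
    have "continuous_map euclidean cover_topology (\<lambda>z. (pt c z, germ (pt c z) c))" by (simp only: comp_def)
    then show "continuous_map euclidean (subtopology cover_topology (sheet c)) (\<lambda>z. (pt c z, germ (pt c z) c))"
      using pt_in[OF pl] by (auto simp: continuous_map_in_subtopology sheet_iff)
    show "(pt c (snd c (fst z)), germ (pt c (snd c (fst z))) c) = z" if "z \<in> topspace (subtopology cover_topology (sheet c))" for z
      using that pt_snd[OF pl, of "fst z"] by (auto simp: sheet_iff prod_eq_iff)
    show "snd c (fst (pt c y, germ (pt c y) c)) = y" for y by (simp add: snd_pt[OF pl])
  qed
  then have "homeomorphic_map (subtopology cover_topology (sheet c)) euclidean (\<lambda>z. snd c (fst z))"
    unfolding homeomorphic_map_maps by blast
  then show ?thesis
    unfolding planar_chart_def lift_chart_def using openin_sheet[OF c] by simp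
qed

text \<open>Two points over the same \<open>m\<close> come from charts that disagree at
  \<open>m\<close>, hence on an open set \<open>G\<close>, over which their sections are
  disjoint.\<close>

lemma Hausdorff_cover: "Hausdorff_space cover_topology"
  unfolding Hausdorff_space_def
proof (intro allI impI)
  fix z z' assume zz: "z \<in> topspace cover_topology \<and> z' \<in> topspace cover_topology \<and> z \<noteq> z'"
  show "\<exists>U V. openin cover_topology U \<and> openin cover_topology V \<and> z \<in> U \<and> z' \<in> V \<and> disjnt U V"
  proof (cases "fst z = fst z'")
    case False
    have "fst z \<in> topspace M" "fst z' \<in> topspace M"
      using zz continuous_map_fst_cover by (auto simp: continuous_map_def)
    then obtain U V where UV: "openin M U" "openin M V" "fst z \<in> U" "fst z' \<in> V" "disjnt U V"
      using Hausdorff_M False unfolding Hausdorff_space_def by blast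
    show ?thesis
    proof (intro exI conjI)
      show "openin cover_topology {z \<in> topspace cover_topology. fst z \<in> U}"
        "openin cover_topology {z \<in> topspace cover_topology. fst z \<in> V}" using openin_fst_preimage UV by blast+
      show "disjnt {z \<in> topspace cover_topology. fst z \<in> U} {z \<in> topspace cover_topology. fst z \<in> V}"
        using UV(5) by (auto simp: disjnt_iff)
    qed (use zz UV in auto)
  next
    case True
    obtain c where c: "c \<in> signed_charts" "fst z \<in> fst c" "snd z = germ (fst z) c"
      using zz unfolding topspace_cover by (auto simp: sheet_iff)
    obtain d where d: "d \<in> signed_charts" "fst z' \<in> fst d" "snd z' = germ (fst z') d"
      using zz unfolding topspace_cover by (auto simp: sheet_iff)
    have "germ (fst z) c \<noteq> germ (fst z) d" using zz c d True by (auto simp: prod_eq_iff)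
    then have ncomp: "\<not> order_compatible_at M (fst z) c d" using germ_eq_iff c d True by metis
    define G where "G = {m \<in> fst c \<inter> fst d. \<not> order_compatible_at M m c d}"
    have G: "openin M G" "G \<subseteq> fst c" "G \<subseteq> fst d" "fst z \<in> G"
      using openin_agree(2)[OF c(1) d(1)] ncomp c d True by (auto simp: G_def)
    show ?thesis
    proof (intro exI conjI)
      show "openin cover_topology ((\<lambda>m. (m, germ m c)) ` G)" "openin cover_topology ((\<lambda>m. (m, germ m d)) ` G)"
        using openin_section_image c d G by blast+
      show "z \<in> (\<lambda>m. (m, germ m c)) ` G" "z' \<in> (\<lambda>m. (m, germ m d)) ` G"
        using G(4) c(3) d(3) True by (auto simp: image_iff prod_eq_iff)
      show "disjnt ((\<lambda>m. (m, germ m c)) ` G) ((\<lambda>m. (m, germ m d)) ` G)"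
        using germ_eq_iff[OF c(1) _ d(1)] by (auto simp: disjnt_iff G_def)
    qed
  qed
qed

text \<open>A point of the cover includes its germ, so any two lifted charts through it agree in
  both orders.\<close>

lemma oriented_cover: "oriented_foliation cover_topology (lift_chart ` signed_charts)"
proof
  show "Hausdorff_space cover_topology" by (rule Hausdorff_cover)
  show "planar_chart cover_topology c" if "c \<in> lift_chart ` signed_charts" for c
    using that planar_lift_chart by blast
  show "\<Union> (fst ` lift_chart ` signed_charts) = topspace cover_topology"
    unfolding topspace_cover lift_chart_def by (simp add: image_image)
  show "order_compatible_at cover_topology p c d"
    if cd: "c \<in> lift_chart ` signed_charts" "d \<in> lift_chart ` signed_charts" "p \<in> fst c" "p \<in> fst d" for c d p
  proof -
    obtain c' where c: "c' \<in> signed_charts" "c = lift_chart c'" using cd(1) by blast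
    obtain d' where d: "d' \<in> signed_charts" "d = lift_chart d'" using cd(2) by blast
    have p: "fst p \<in> fst c'" "snd p = germ (fst p) c'" "fst p \<in> fst d'" "snd p = germ (fst p) d'"
      using cd(3,4) c d by (auto simp: lift_chart_def sheet_iff)
    then have "order_compatible_at M (fst p) c' d'" using germ_eq_iff[OF c(1) _ d(1)] by metis
    then obtain W where W: "openin M W" "fst p \<in> W" "W \<subseteq> fst c' \<inter> fst d'" "same_order c' d' W"
      unfolding order_compatible_at_def by blast
    then have oc: "order_compatible_at M m c' d'" if "m \<in> W" for m using that unfolding order_compatible_at_def by blast
    show ?thesis unfolding order_compatible_at_def
    proof (intro exI conjI)
      show "openin cover_topology ((\<lambda>m. (m, germ m c')) ` W)" using openin_section_image[OF c(1) W(1)] W(3) by blast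
      show "p \<in> (\<lambda>m. (m, germ m c')) ` W" using W(2) p(2) by (auto simp: image_iff prod_eq_iff)
      have "germ m c' = germ m d'" if "m \<in> W" for m using oc[OF that] germ_eq_iff[OF c(1) _ d(1)] W(3) that by blast
      then show "(\<lambda>m. (m, germ m c')) ` W \<subseteq> fst c \<inter> fst d"
        using W(3) unfolding c d lift_chart_def by (auto simp: sheet_iff)
      show "same_order c d ((\<lambda>m. (m, germ m c')) ` W)"
        using W(4) unfolding same_order_def c d lift_chart_def by simp
    qed
  qed
qed

text \<open>A plaque lifts through any prescribed germ over one of its points: some flip of its
  chart represents the germ, and the sheet of this flip contains a lift of the whole plaque.\<close>

lemma same_leaf_lift:
  assumes "(p, q) \<in> same_leaf F" "(p, K) \<in> topspace cover_topology"
  shows "\<exists>K'. ((p, K), (q, K')) \<in> same_leaf (lift_chart ` signed_charts) \<and> (q, K') \<in> topspace cover_topology"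
proof -
  have plaque_step: "\<exists>K'. ((\<exists>P\<in>plaques (lift_chart ` signed_charts). (p, K) \<in> P \<and> (q, K') \<in> P) \<and> (q, K') \<in> topspace cover_topology)"
    if pq: "\<exists>P\<in>plaques F. p \<in> P \<and> q \<in> P" and K: "(p, K) \<in> topspace cover_topology" for p q K
  proof -
    obtain U \<phi> y where "(U, \<phi>) \<in> F" "p \<in> U" "q \<in> U" "snd (\<phi> p) = y" "snd (\<phi> q) = y"
      using pq unfolding plaques_def by auto
    then obtain c where c: "c \<in> F" "p \<in> fst c" "q \<in> fst c" "py c p = py c q" by (metis fst_conv snd_conv)
    obtain d where d: "d \<in> signed_charts" "p \<in> fst d" "K = germ p d"
      using K unfolding topspace_cover by (auto simp: sheet_iff)
    obtain e1 e2 where e: "e1 \<in> unit_sign" "e2 \<in> unit_sign" "order_compatible_at M p d (flip e1 e2 c)"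
      using signed_compatible[OF d(1) F_signed[OF c(1)] d(2) c(2)] by blast
    define c1 where "c1 = flip e1 e2 c"
    have c1: "c1 \<in> signed_charts" "p \<in> fst c1" "q \<in> fst c1" "py c1 p = py c1 q"
      unfolding c1_def using flip_signed[OF F_signed[OF c(1)] e(1,2)] c by auto
    have "K = germ p c1" unfolding d(3) using germ_eq_iff[OF d(1,2) c1(1,2)] e(3) by (simp add: c1_def)
    then have in_sheet: "(p, K) \<in> sheet c1" "(q, germ q c1) \<in> sheet c1" using c1 by (auto simp: sheet_iff)
    let ?P = "{z \<in> sheet c1. snd (snd c1 (fst z)) = py c1 p}"
    have "(sheet c1, \<lambda>z. snd c1 (fst z)) \<in> lift_chart ` signed_charts"
      using c1(1) unfolding lift_chart_def by blast
    then have "?P \<in> plaques (lift_chart ` signed_charts)" unfolding plaques_def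
      by (intro CollectI exI[of _ "sheet c1"] exI[of _ "\<lambda>z. snd c1 (fst z)"] exI[of _ "py c1 p"]) simp
    moreover have "(p, K) \<in> ?P" "(q, germ q c1) \<in> ?P" using in_sheet c1(4) by auto
    moreover have "(q, germ q c1) \<in> topspace cover_topology" using in_sheet c1(1) unfolding topspace_cover by blast
    ultimately show ?thesis
      by (intro exI[of _ "germ q c1"] conjI bexI[of _ ?P])
  qed
  show ?thesis
    using assms(1) unfolding same_leaf_def
  proof (induction rule: trancl_induct)
    case (base q)
    then have "\<exists>P\<in>plaques F. p \<in> P \<and> q \<in> P" by simp
    from plaque_step[OF this assms(2)] show ?case by blast
  next
    case (step q r)
    then obtain K' where K': "((p, K), (q, K')) \<in> {(p, q). \<exists>P\<in>plaques (lift_chart ` signed_charts). p \<in> P \<and> q \<in> P}\<^sup>+"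
      "(q, K') \<in> topspace cover_topology" by blast
    have "\<exists>P\<in>plaques F. q \<in> P \<and> r \<in> P" using step.hyps by simp
    from plaque_step[OF this K'(2)] obtain K'' where K'':
      "((q, K'), (r, K'')) \<in> {(p, q). \<exists>P\<in>plaques (lift_chart ` signed_charts). p \<in> P \<and> q \<in> P}"
      "(r, K'') \<in> topspace cover_topology" by blast
    show ?case using trancl_into_trancl[OF K'(1) K''(1)] K''(2) by blast
  qed
qed

end

subsection \<open>Pushing local systems down the orientation cover\<close>

text \<open>Conjugation with a straight path in the chart. It brings the loops over the prescribed
  point \<open>x\<close>, whereas the recurrence argument finds a base point of its own.\<close>

lemma independent_loops_move:
  assumes pl: "planar_chart X c" and b: "b \<in> fst c" and z: "z \<in> fst c" and il: "independent_loops X b"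
  shows "independent_loops X z"
proof -
  obtain \<alpha> \<beta> and S1 S2 :: "('a set \<times> ('a \<Rightarrow> bool)) set" where
    \<alpha>: "pathin X \<alpha>" "\<alpha> 0 = b" "\<alpha> 1 = b" and \<beta>: "pathin X \<beta>" "\<beta> 0 = b" "\<beta> 1 = b" and
    LS: "local_system X S1" "local_system X S2" and
    t1: "\<And>w. transport S1 \<alpha> w w" "\<And>w. transport S1 \<beta> w (\<not> w)" and
    t2: "\<And>w. transport S2 \<alpha> w (\<not> w)" "\<And>w. transport S2 \<beta> w w"
    using il unfolding independent_loops_def by blast
  define \<delta> where "\<delta> t = pt c (snd c b + t *\<^sub>R (snd c z - snd c b))" for t :: real
  have \<delta>: "pathin X \<delta>" "\<delta> 0 = b" "\<delta> 1 = z"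
  proof -
    have "continuous_map (top_of_set {0..1}) X (pt c \<circ> (\<lambda>t::real. snd c b + t *\<^sub>R (snd c z - snd c b)))"
      by (rule continuous_map_compose[OF _ continuous_map_pt[OF pl]]) (auto intro!: continuous_intros)
    then show "pathin X \<delta>" unfolding pathin_def \<delta>_def comp_def .
    show "\<delta> 0 = b" "\<delta> 1 = z" using pt_snd[OF pl] b z by (simp_all add: \<delta>_def)
  qed
  define \<delta>' where "\<delta>' t = \<delta> (1 - t)" for t
  have \<delta>': "pathin X \<delta>'" "\<delta>' 0 = z" "\<delta>' 1 = b"
    unfolding \<delta>'_def using pathin_reverse[OF \<delta>(1)] \<delta> by simp_all
  define cj where "cj \<gamma> = concat_loops \<delta>' (concat_loops \<gamma> \<delta>)" for \<gamma>
  have cj: "pathin X (cj \<gamma>)" "cj \<gamma> 0 = z" "cj \<gamma> 1 = z" if "pathin X \<gamma>" "\<gamma> 0 = b" "\<gamma> 1 = b" for \<gamma>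
  proof -
    have 1: "pathin X (concat_loops \<gamma> \<delta>)" using pathin_concat_loops[OF that(1) \<delta>(1)] that \<delta> by simp
    have "concat_loops \<gamma> \<delta> 0 = b" using that by (simp add: concat_loops_def)
    then show "pathin X (cj \<gamma>)" unfolding cj_def using pathin_concat_loops[OF \<delta>'(1) 1] \<delta>' by simp
    show "cj \<gamma> 0 = z" "cj \<gamma> 1 = z" using \<delta> \<delta>' by (simp_all add: cj_def concat_loops_def)
  qed
  have tr: "transport S (cj \<gamma>) w (w \<noteq> i)"
    if S: "local_system X S" and \<gamma>: "pathin X \<gamma>" "\<gamma> 0 = b" "\<gamma> 1 = b" and t: "\<And>w. transport S \<gamma> w (w \<noteq> i)"
    for S :: "('a set \<times> ('a \<Rightarrow> bool)) set" and \<gamma> i w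
  proof -
    have fib: "w \<in> fibre S (\<delta> 0)" for w using transport_fibre1[OF t, of w] \<gamma> \<delta> by simp
    obtain \<rho> where \<rho>: "\<And>w. transport S \<delta> w (\<rho> w)" using transport_exists[OF S \<delta>(1) fib] by metis
    \<comment> \<open>Transport along \<delta> is injective on \<open>bool\<close>, hence a
      bijection, and so it commutes with the addition of \<open>i\<close>.\<close>
    have "\<rho> True \<noteq> \<rho> False"
      using transport_unique'[OF S \<delta>(1) \<rho>[of True]] \<rho>[of False] by metis
    then obtain w0 where w0: "\<rho> w0 = w" by (metis (full_types))
    have \<rho>i: "\<rho> (w0 \<noteq> i) = (w \<noteq> i)" using \<open>\<rho> True \<noteq> \<rho> False\<close> w0 by (cases w0; cases i) auto
    have "transport S \<delta>' w w0" using transport_reverse[OF \<rho>[of w0]] w0 unfolding \<delta>'_def by simp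
    moreover have "transport S (concat_loops \<gamma> \<delta>) w0 (w \<noteq> i)"
      using transport_concat[OF S \<gamma>(1) \<delta>(1) _ t[of w0] \<rho>] \<gamma> \<delta> \<rho>i by simp
    moreover have "pathin X (concat_loops \<gamma> \<delta>)" using pathin_concat_loops[OF \<gamma>(1) \<delta>(1)] \<gamma> \<delta> by simp
    moreover have "\<delta>' 1 = concat_loops \<gamma> \<delta> 0" using \<delta>' \<gamma> by (simp add: concat_loops_def)
    ultimately show ?thesis unfolding cj_def using transport_concat[OF S \<delta>'(1)] by blast
  qed
  have "transport S1 (cj \<alpha>) w w" "transport S1 (cj \<beta>) w (\<not> w)" for w
    using tr[OF LS(1) \<alpha>, of False w] tr[OF LS(1) \<beta>, of True w] t1 by simp_all
  moreover have "transport S2 (cj \<alpha>) w (\<not> w)" "transport S2 (cj \<beta>) w w" for w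
    using tr[OF LS(2) \<alpha>, of True w] tr[OF LS(2) \<beta>, of False w] t2 by simp_all
  ultimately show ?thesis
    unfolding independent_loops_def using cj[OF \<alpha>] cj[OF \<beta>] LS by blast
qed

section \<open>Composition of a cover with the orientation cover\<close>

context foliated_surface
begin

text \<open>A fibre point of the composite over \<open>m\<close> is a germ at \<open>m\<close>
  together with a fibre point over the corresponding point of the orientation cover.\<close>

definition push_section :: "'a chart \<Rightarrow> ('a \<times> 'a chart set) set \<Rightarrow> ('a \<times> 'a chart set \<Rightarrow> 'f) \<Rightarrow>
    'a set \<times> ('a \<Rightarrow> 'a chart set \<times> 'f)" where
  "push_section c N \<sigma> = ({m \<in> fst c. (m, germ m c) \<in> N}, \<lambda>m. (germ m c, \<sigma> (m, germ m c)))"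

definition push_system :: "(('a \<times> 'a chart set) set \<times> ('a \<times> 'a chart set \<Rightarrow> 'f)) set \<Rightarrow>
    ('a set \<times> ('a \<Rightarrow> 'a chart set \<times> 'f)) set" where
  "push_system S = {push_section c N \<sigma> | c N \<sigma>. c \<in> signed_charts \<and> (N, \<sigma>) \<in> S}"

text \<open>A composite of covers need not be a cover in general. Here there are at most four sheets
  over \<open>m\<close>, so the projections of evenly covered sets, one in each sheet, can be
  intersected.\<close>

lemma local_system_push:
  assumes S: "local_system cover_topology S"
  shows "local_system M (push_system S)"
proof -
  have open_pull: "openin M {m \<in> fst c. (m, germ m c) \<in> W}" if "c \<in> signed_charts" "openin cover_topology W" for c W
    using that unfolding openin_cover by blast
  have pushE: "\<exists>c N0 \<sigma>0. c \<in> signed_charts \<and> (N0, \<sigma>0) \<in> S \<and> N = {m \<in> fst c. (m, germ m c) \<in> N0} \<and>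
      \<sigma> = (\<lambda>m. (germ m c, \<sigma>0 (m, germ m c)))" if "(N, \<sigma>) \<in> push_system S" for N \<sigma>
    using that unfolding push_system_def push_section_def by auto
  have cmp: "openin M {m \<in> N \<inter> N'. \<sigma> m = \<sigma>' m} \<and> openin M {m \<in> N \<inter> N'. \<sigma> m \<noteq> \<sigma>' m}"
    if m1: "(N, \<sigma>) \<in> push_system S" and m2: "(N', \<sigma>') \<in> push_system S" for N \<sigma> N' \<sigma>'
  proof -
    obtain c N0 \<sigma>0 where c: "c \<in> signed_charts" and s: "(N0, \<sigma>0) \<in> S" and N: "N = {m \<in> fst c. (m, germ m c) \<in> N0}"
      and \<sigma>: "\<sigma> = (\<lambda>m. (germ m c, \<sigma>0 (m, germ m c)))" using pushE[OF m1] by (elim exE conjE)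
    obtain d N1 \<sigma>1 where d: "d \<in> signed_charts" and s': "(N1, \<sigma>1) \<in> S" and N': "N' = {m \<in> fst d. (m, germ m d) \<in> N1}"
      and \<sigma>': "\<sigma>' = (\<lambda>m. (germ m d, \<sigma>1 (m, germ m d)))" using pushE[OF m2] by (elim exE conjE)
    have oNN: "openin M (N \<inter> N')"
      unfolding N N' by (intro openin_Int open_pull c d local_system_open[OF S s] local_system_open[OF S s'])
    define E1 where "E1 = {z \<in> N0 \<inter> N1. \<sigma>0 z = \<sigma>1 z} \<inter> sheet d"
    define E2 where "E2 = {z \<in> N0 \<inter> N1. \<sigma>0 z \<noteq> \<sigma>1 z} \<inter> sheet d"
    have E: "openin cover_topology E1" "openin cover_topology E2"
      unfolding E1_def E2_def
      by (intro openin_Int openin_sheet d local_system_eq[OF S s s'] local_system_neq[OF S s s'])+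
    have eq: "{m \<in> N \<inter> N'. \<sigma> m = \<sigma>' m} = {m \<in> fst c. (m, germ m c) \<in> E1}"
    proof (rule Set.set_eqI)
      fix m show "m \<in> {m \<in> N \<inter> N'. \<sigma> m = \<sigma>' m} \<longleftrightarrow> m \<in> {m \<in> fst c. (m, germ m c) \<in> E1}"
      proof (cases "germ m c = germ m d")
        case True
        then show ?thesis unfolding N N' \<sigma> \<sigma>' E1_def by (auto simp: sheet_iff)
      next
        case False
        then show ?thesis unfolding N N' \<sigma> \<sigma>' E1_def by (auto simp: sheet_iff)
      qed
    qed
    \<comment> \<open>Pushed sections differ either in the germ or, on a common sheet, in the fibre
      name of the upper cover.\<close>
    have neq: "{m \<in> N \<inter> N'. \<sigma> m \<noteq> \<sigma>' m} =
      (N \<inter> N' \<inter> {m \<in> fst c \<inter> fst d. \<not> order_compatible_at M m c d}) \<union> {m \<in> fst c. (m, germ m c) \<in> E2}"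
    proof (rule Set.set_eqI)
      fix m show "m \<in> {m \<in> N \<inter> N'. \<sigma> m \<noteq> \<sigma>' m} \<longleftrightarrow>
        m \<in> (N \<inter> N' \<inter> {m \<in> fst c \<inter> fst d. \<not> order_compatible_at M m c d}) \<union> {m \<in> fst c. (m, germ m c) \<in> E2}"
      proof (cases "m \<in> fst c \<inter> fst d")
        case in_cd: True
        then have g: "germ m c = germ m d \<longleftrightarrow> order_compatible_at M m c d" using germ_eq_iff[OF c _ d] by blast
        show ?thesis
        proof (cases "germ m c = germ m d")
          case True
          then show ?thesis using in_cd g unfolding N N' \<sigma> \<sigma>' E2_def by (auto simp: sheet_iff)
        next
          case False
          then show ?thesis using in_cd g unfolding N N' \<sigma> \<sigma>' E2_def by (auto simp: sheet_iff)
        qed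
      next
        case False
        then show ?thesis unfolding N N' \<sigma> \<sigma>' E2_def by (auto simp: sheet_iff)
      qed
    qed
    show ?thesis
      unfolding eq neq by (intro conjI openin_Un openin_Int[OF oNN] open_pull c E openin_agree(2) d)
  qed
  have even: "\<exists>N. openin M N \<and> m \<in> N \<and> evenly_covers (push_system S) N" if m: "m \<in> topspace M" for m
  proof -
    obtain c where c: "c \<in> F" "m \<in> fst c" using m foliation unfolding foliation_def by blast
    note cs = F_signed[OF c(1)]
    define I where "I = unit_sign \<times> unit_sign"
    have finI: "finite I" "I \<noteq> {}" by (auto simp: I_def unit_sign_def)
    define ch where "ch e = flip (fst e) (snd e) c" for e
    have ch: "ch e \<in> signed_charts" "fst (ch e) = fst c" if "e \<in> I" for e
      using that flip_signed[OF cs] by (auto simp: I_def ch_def)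
    have "\<exists>N. openin cover_topology N \<and> (m, germ m (ch e)) \<in> N \<and> evenly_covers S N" if e: "e \<in> I" for e
    proof -
      have "(m, germ m (ch e)) \<in> topspace cover_topology"
        unfolding topspace_cover using ch[OF e] c(2) by (auto simp: sheet_iff)
      then show ?thesis using local_system_even[OF S] by metis
    qed
    then obtain No where No: "\<And>e. e \<in> I \<Longrightarrow> openin cover_topology (No e)" "\<And>e. e \<in> I \<Longrightarrow> (m, germ m (ch e)) \<in> No e"
      "\<And>e. e \<in> I \<Longrightarrow> evenly_covers S (No e)" by metis
    define N where "N = (\<Inter>e\<in>I. {m' \<in> fst (ch e). (m', germ m' (ch e)) \<in> No e})"
    have "openin M N" unfolding N_def
      by (rule openin_INT2[OF finI]) (rule open_pull[OF ch(1) No(1)])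
    moreover have "m \<in> N" unfolding N_def by (rule INT_I) (simp add: ch(2) No(2) c(2))
    moreover have "evenly_covers (push_system S) N"
      unfolding evenly_covers_def
    proof (intro allI impI)
      fix N1 \<sigma>1 m' assume 1: "(N1, \<sigma>1) \<in> push_system S" and m': "m' \<in> N1 \<inter> N"
      obtain d N0 \<sigma>0 where d: "d \<in> signed_charts" and s: "(N0, \<sigma>0) \<in> S" and N1: "N1 = {m \<in> fst d. (m, germ m d) \<in> N0}"
        and \<sigma>1: "\<sigma>1 = (\<lambda>m. (germ m d, \<sigma>0 (m, germ m d)))" using pushE[OF 1] by (elim exE conjE)
      have md: "m' \<in> fst d" "(m', germ m' d) \<in> N0" using m' N1 by auto
      obtain e0 where "e0 \<in> I" using finI by blast
      have mc: "m' \<in> fst c" using m' ch(2)[OF \<open>e0 \<in> I\<close>] \<open>e0 \<in> I\<close> unfolding N_def by auto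
      obtain e1 e2 where e: "e1 \<in> unit_sign" "e2 \<in> unit_sign" "order_compatible_at M m' d (flip e1 e2 c)"
        using signed_compatible[OF d cs md(1) mc] by blast
      define e where "e = (e1, e2)"
      have eI: "e \<in> I" using e by (simp add: e_def I_def)
      have g: "germ m' d = germ m' (ch e)"
        using germ_eq_iff[OF d md(1) ch(1)[OF eI]] ch(2)[OF eI] mc e(3) by (simp add: ch_def e_def)
      have mN: "(m', germ m' (ch e)) \<in> No e" using m' eI unfolding N_def by blast
      have mN0: "(m', germ m' (ch e)) \<in> N0" using md(2) g by simp
      obtain N2 \<sigma>2 where 2: "(N2, \<sigma>2) \<in> S" "No e \<subseteq> N2" "\<sigma>2 (m', germ m' (ch e)) = \<sigma>0 (m', germ m' (ch e))"
        using evenly_coversE[OF No(3)[OF eI] s mN0 mN] by metis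
      have "push_section (ch e) N2 \<sigma>2 \<in> push_system S" unfolding push_system_def using ch(1)[OF eI] 2(1) by blast
      then have mem: "({m \<in> fst (ch e). (m, germ m (ch e)) \<in> N2}, \<lambda>m. (germ m (ch e), \<sigma>2 (m, germ m (ch e)))) \<in> push_system S"
        by (simp only: push_section_def)
      have sub: "N \<subseteq> {m \<in> fst (ch e). (m, germ m (ch e)) \<in> N2}" using 2(2) eI unfolding N_def by blast
      have val: "(\<lambda>m. (germ m (ch e), \<sigma>2 (m, germ m (ch e)))) m' = \<sigma>1 m'" using 2(3) g by (simp add: \<sigma>1)
      show "\<exists>N2 \<sigma>2. (N2, \<sigma>2) \<in> push_system S \<and> N \<subseteq> N2 \<and> \<sigma>2 m' = \<sigma>1 m'"
        using mem sub val by (intro exI conjI)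
    qed
    ultimately show ?thesis by blast
  qed
  show ?thesis unfolding local_system_def
  proof (intro conjI allI impI ballI)
    fix N \<sigma> assume NS: "(N, \<sigma>) \<in> push_system S"
    obtain c N0 \<sigma>0 where c: "c \<in> signed_charts" and s: "(N0, \<sigma>0) \<in> S" and N: "N = {m \<in> fst c. (m, germ m c) \<in> N0}"
      using pushE[OF NS] by (elim exE conjE)
    show "openin M N" unfolding N by (rule open_pull[OF c local_system_open[OF S s]])
    fix N' \<sigma>' assume NS': "(N', \<sigma>') \<in> push_system S"
    show "openin M {m \<in> N \<inter> N'. \<sigma> m = \<sigma>' m}" "openin M {m \<in> N \<inter> N'. \<sigma> m \<noteq> \<sigma>' m}"
      using cmp[OF NS NS'] by blast+
  qed (rule even)
qed

lemma transport_push: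
  assumes \<gamma>: "pathin cover_topology \<gamma>" and t: "transport S \<gamma> v w"
  shows "transport (push_system S) (fst \<circ> \<gamma>) (snd (\<gamma> 0), v) (snd (\<gamma> 1), w)"
proof -
  obtain l where l: "lift_on S {0..1} \<gamma> l" "l 0 = v" "l 1 = w" using t unfolding transport_def by blast
  have cont: "continuous_map (top_of_set {0..1}) cover_topology \<gamma>" using \<gamma> unfolding pathin_def .
  have "lift_on (push_system S) {0..1} (fst \<circ> \<gamma>) (\<lambda>t. (snd (\<gamma> t), l t))"
  proof (rule lift_onI)
    fix y :: real assume y: "y \<in> {0..1}"
    obtain N \<sigma> T where N: "(N, \<sigma>) \<in> S" "open T" "y \<in> T"
      "\<And>z. z \<in> T \<Longrightarrow> z \<in> {0..1} \<Longrightarrow> \<gamma> z \<in> N" "\<And>z. z \<in> T \<Longrightarrow> z \<in> {0..1} \<Longrightarrow> l z = \<sigma> (\<gamma> z)"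
      using lift_onE[OF l(1) y] by metis
    have "\<gamma> y \<in> topspace cover_topology" using cont y by (auto simp: continuous_map_def)
    then obtain c where c: "c \<in> signed_charts" "\<gamma> y \<in> sheet c" unfolding topspace_cover by blast
    obtain T' where T': "open T'" "T' \<inter> {0..1} = {y \<in> {0..1}. \<gamma> y \<in> sheet c}"
      using continuous_map_open_preimage[OF cont openin_sheet[OF c(1)]] by blast
    have mem: "({m \<in> fst c. (m, germ m c) \<in> N}, \<lambda>m. (germ m c, \<sigma> (m, germ m c))) \<in> push_system S"
      unfolding push_system_def push_section_def using c(1) N(1) by blast
    show "\<exists>N \<sigma> T. (N, \<sigma>) \<in> push_system S \<and> open T \<and> y \<in> T \<and>
      (\<forall>z\<in>T \<inter> {0..1}. (fst \<circ> \<gamma>) z \<in> N \<and> (snd (\<gamma> z), l z) = \<sigma> ((fst \<circ> \<gamma>) z))"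
    proof (intro exI[of _ "{m \<in> fst c. (m, germ m c) \<in> N}"] exI[of _ "\<lambda>m. (germ m c, \<sigma> (m, germ m c))"]
        exI[of _ "T \<inter> T'"] conjI ballI)
      show "({m \<in> fst c. (m, germ m c) \<in> N}, \<lambda>m. (germ m c, \<sigma> (m, germ m c))) \<in> push_system S" by (rule mem)
      show "open (T \<inter> T')" using N T' by auto
      show "y \<in> T \<inter> T'" using N(3) c(2) T'(2) y by auto
      fix z assume z: "z \<in> T \<inter> T' \<inter> {0..1}"
      then have "z \<in> {y \<in> {0..1}. \<gamma> y \<in> sheet c}" unfolding T'(2)[symmetric] by blast
      then have "\<gamma> z \<in> sheet c" by simp
      then have g: "fst (\<gamma> z) \<in> fst c" "snd (\<gamma> z) = germ (fst (\<gamma> z)) c" by (simp_all add: sheet_iff)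
      then have pr: "(fst (\<gamma> z), germ (fst (\<gamma> z)) c) = \<gamma> z" by (simp add: prod_eq_iff)
      show "(fst \<circ> \<gamma>) z \<in> {m \<in> fst c. (m, germ m c) \<in> N}" using g pr N(4)[of z] z by simp
      show "(snd (\<gamma> z), l z) = (germ ((fst \<circ> \<gamma>) z) c, \<sigma> ((fst \<circ> \<gamma>) z, germ ((fst \<circ> \<gamma>) z) c))"
        using g pr N(5)[of z] z by simp
    qed
  qed
  then show ?thesis unfolding transport_def using l(2,3) by (intro exI[of _ "\<lambda>t. (snd (\<gamma> t), l t)"]) simp
qed

text \<open>Density of the leaf passes to the transversal \<open>px c0 = 0\<close>, since the plaque
  through a leaf point crosses it at the same height. Each of these points lifts to the leaf of
  \<open>(p, K0)\<close> on one of four sheets, and over some interval one sheet receives a dense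
  set.\<close>

lemma dense_leaf_independent_loops:
  assumes L: "L \<in> leaves M F" "M closure_of L = topspace M" and x: "x \<in> topspace M"
  shows "\<exists>c\<in>signed_charts. x \<in> fst c \<and> independent_loops cover_topology (x, germ x c)"
proof -
  obtain p where p: "p \<in> topspace M" "L = same_leaf F `` {p}" using L(1) unfolding leaves_def quotient_def by auto
  obtain c0 where c0: "c0 \<in> F" "x \<in> fst c0" using x foliation unfolding foliation_def by blast
  note pl = planar_F[OF c0(1)]
  have dense: "\<exists>y. y1 < y \<and> y < y2 \<and> (p, pt c0 (0, y)) \<in> same_leaf F" if "y1 < y2" for y1 y2
  proof -
    define V where "V = {q \<in> fst c0. snd c0 q \<in> {z. y1 < snd z \<and> snd z < y2}}"
    have V: "openin M V" unfolding V_def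
      by (rule planar_chart_preimage_open[OF pl]) (intro open_Collect_conj open_Collect_less continuous_intros)
    have "pt c0 (0, (y1 + y2) / 2) \<in> V" using that by (simp add: V_def pt_in[OF pl] snd_pt[OF pl])
    moreover have "V \<subseteq> topspace M" using V openin_subset by blast
    ultimately have "pt c0 (0, (y1 + y2) / 2) \<in> M closure_of L" using L(2) by auto
    then obtain q where q: "q \<in> L" "q \<in> V"
      using V \<open>pt c0 (0, (y1 + y2) / 2) \<in> V\<close> unfolding in_closure_of by blast
    have "\<exists>P\<in>plaques F. q \<in> P \<and> pt c0 (0, py c0 q) \<in> P"
    proof (rule bexI)
      show "{r \<in> fst c0. snd (snd c0 r) = py c0 q} \<in> plaques F"
        unfolding plaques_def using c0(1)
        by (intro CollectI exI[of _ "fst c0"] exI[of _ "snd c0"] exI[of _ "py c0 q"]) simp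
    qed (use q in \<open>simp add: V_def pt_in[OF pl] snd_pt[OF pl]\<close>)
    then have "(q, pt c0 (0, py c0 q)) \<in> {(p, q). \<exists>P\<in>plaques F. p \<in> P \<and> q \<in> P}" by simp
    moreover have "(p, q) \<in> same_leaf F" using q(1) p(2) by simp
    ultimately have "(p, pt c0 (0, py c0 q)) \<in> same_leaf F" unfolding same_leaf_def by (rule_tac trancl_into_trancl)
    then show ?thesis using q(2) by (auto simp: V_def)
  qed
  obtain d where d: "d \<in> F" "p \<in> fst d" using p(1) foliation unfolding foliation_def by blast
  define K0 where "K0 = germ p d"
  have K0: "(p, K0) \<in> topspace cover_topology"
    unfolding topspace_cover K0_def using F_signed[OF d(1)] d(2) by (auto simp: sheet_iff)
  let ?F = "lift_chart ` signed_charts"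
  interpret G: oriented_foliation cover_topology ?F by (rule oriented_cover)
  define I where "I = unit_sign \<times> unit_sign"
  have finI: "finite I" by (auto simp: I_def unit_sign_def)
  define ch where "ch e = flip (fst e) (snd e) c0" for e
  have ch: "ch e \<in> signed_charts" "fst (ch e) = fst c0" if "e \<in> I" for e
    using that flip_signed[OF F_signed[OF c0(1)]] by (auto simp: I_def ch_def)
  define P where "P e y \<longleftrightarrow> ((p, K0), (pt c0 (0, y), germ (pt c0 (0, y)) (ch e))) \<in> same_leaf ?F" for e y
  have "\<exists>e\<in>I. \<exists>al be. al < be \<and> (\<forall>y1 y2. al \<le> y1 \<longrightarrow> y1 < y2 \<longrightarrow> y2 \<le> be \<longrightarrow> (\<exists>y. y1 < y \<and> y < y2 \<and> P e y))"
  proof (rule finite_dense_union[OF finI, of 0 1])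
    fix y1 y2 :: real assume "y1 < y2"
    then obtain y where y: "y1 < y" "y < y2" "(p, pt c0 (0, y)) \<in> same_leaf F" using dense by blast
    obtain K' where K': "((p, K0), (pt c0 (0, y), K')) \<in> same_leaf ?F" "(pt c0 (0, y), K') \<in> topspace cover_topology"
      using same_leaf_lift[OF y(3) K0] by blast
    obtain d' where d': "d' \<in> signed_charts" "pt c0 (0, y) \<in> fst d'" "K' = germ (pt c0 (0, y)) d'"
      using K'(2) unfolding topspace_cover by (auto simp: sheet_iff)
    obtain e1 e2 where e: "e1 \<in> unit_sign" "e2 \<in> unit_sign" "order_compatible_at M (pt c0 (0, y)) d' (flip e1 e2 c0)"
      using signed_compatible[OF d'(1) F_signed[OF c0(1)] d'(2) pt_in[OF pl]] by blast
    have eI: "(e1, e2) \<in> I" using e by (simp add: I_def)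
    have "K' = germ (pt c0 (0, y)) (ch (e1, e2))"
      unfolding d'(3) using germ_eq_iff[OF d'(1,2) ch(1)[OF eI]] ch(2)[OF eI] pt_in[OF pl] e(3) by (simp add: ch_def)
    then have "P (e1, e2) y" using K'(1) by (simp add: P_def)
    then show "\<exists>y. y1 < y \<and> y < y2 \<and> (\<exists>e\<in>I. P e y)" using y eI by blast
  qed simp
  then obtain e al be where e: "e \<in> I" "al < be"
    and De: "\<And>y1 y2. al \<le> y1 \<Longrightarrow> y1 < y2 \<Longrightarrow> y2 \<le> be \<Longrightarrow> \<exists>y. y1 < y \<and> y < y2 \<and> P e y" by blast
  define c where "c = ch e"
  have c: "c \<in> signed_charts" "fst c = fst c0" using ch[OF e(1)] by (simp_all add: c_def)
  have e12: "fst e \<in> unit_sign" "snd e \<in> unit_sign" using e(1) by (auto simp: I_def)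
  have ptc: "pt c (0, snd e * y) = pt c0 (0, y)" for y
    using pt_flip[OF pl e12, of 0 y] by (simp add: c_def ch_def)
  have cF: "lift_chart c \<in> ?F" using c by blast
  have pt_lift: "pt (lift_chart c) z = (pt c z, germ (pt c z) c)" for z
  proof -
    have "(pt c z, germ (pt c z) c) \<in> fst (lift_chart c)"
      using pt_in[OF planar_signed[OF c(1)]] by (simp add: lift_chart_def sheet_iff)
    then have "pt (lift_chart c) (snd (lift_chart c) (pt c z, germ (pt c z) c)) = (pt c z, germ (pt c z) c)"
      by (rule pt_snd[OF planar_lift_chart[OF c(1)]])
    moreover have "snd (lift_chart c) (pt c z, germ (pt c z) c) = z"
      by (simp add: lift_chart_def snd_pt[OF planar_signed[OF c(1)]])
    ultimately show ?thesis by simp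
  qed
  have P_lift: "((p, K0), pt (lift_chart c) (0, snd e * y)) \<in> same_leaf ?F" if "P e y" for y
    using that unfolding P_def c_def[symmetric] by (simp only: pt_lift ptc)
  \<comment> \<open>The sheet belongs to a flip \<open>c\<close> of \<open>c0\<close>; if it negates
    the second coordinate, the interval is reflected.\<close>
  have "\<exists>al be. al < be \<and> (\<forall>y1 y2. al \<le> y1 \<longrightarrow> y1 < y2 \<longrightarrow> y2 \<le> be \<longrightarrow>
      (\<exists>y. y1 < y \<and> y < y2 \<and> ((p, K0), pt (lift_chart c) (0, y)) \<in> same_leaf ?F))"
  proof (rule unit_sign_cases[OF e12(2)])
    assume s: "snd e = 1"
    show ?thesis
    proof (rule exI[of _ al], rule exI[of _ be], intro conjI allI impI)
      fix y1 y2 assume "al \<le> y1" "y1 < y2" "y2 \<le> be"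
      then obtain y where "y1 < y" "y < y2" "P e y" using De by blast
      then show "\<exists>y. y1 < y \<and> y < y2 \<and> ((p, K0), pt (lift_chart c) (0, y)) \<in> same_leaf ?F"
        using P_lift[of y] s by auto
    qed (rule e(2))
  next
    assume s: "snd e = -1"
    show ?thesis
    proof (rule exI[of _ "- be"], rule exI[of _ "- al"], intro conjI allI impI)
      show "- be < - al" using e(2) by simp
      fix y1 y2 assume "- be \<le> y1" "y1 < y2" "y2 \<le> - al"
      then obtain y where "- y2 < y" "y < - y1" "P e y" using De[of "- y2" "- y1"] by auto
      then show "\<exists>y. y1 < y \<and> y < y2 \<and> ((p, K0), pt (lift_chart c) (0, y)) \<in> same_leaf ?F"
        using P_lift[of y] s by (intro exI[of _ "- y"]) auto
    qed
  qed
  then obtain al' be' where al': "al' < be'"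
    and dense': "\<And>y1 y2. al' \<le> y1 \<Longrightarrow> y1 < y2 \<Longrightarrow> y2 \<le> be' \<Longrightarrow>
      \<exists>y. y1 < y \<and> y < y2 \<and> ((p, K0), pt (lift_chart c) (0, y)) \<in> same_leaf ?F" by blast
  obtain b where b: "b \<in> fst (lift_chart c)" "independent_loops cover_topology b"
    using G.recurrent_independent_loops[OF cF al' dense'] by blast
  have "(x, germ x c) \<in> fst (lift_chart c)" using c c0 by (simp add: lift_chart_def sheet_iff)
  then have "independent_loops cover_topology (x, germ x c)"
    by (rule independent_loops_move[OF planar_lift_chart[OF c(1)] b(1) _ b(2)])
  then show ?thesis using c c0 by blast
qed

end

theorem proposition6p6:
  fixes M :: "'a topology" and x :: 'a
  assumes "surface M"
    and "x \<in> topspace M"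
    and "fundamental_group M x \<cong> integer_group"
  shows "\<not> (\<exists>F. transitive_foliation M F)"
proof
  assume "\<exists>F. transitive_foliation M F"
  then obtain F L where F: "foliation M F" and L: "L \<in> leaves M F" "M closure_of L = topspace M"
    unfolding transitive_foliation_def by blast
  interpret foliated_surface M F
    using assms(1) F unfolding surface_def by unfold_locales auto
  obtain c where c: "c \<in> signed_charts" "x \<in> fst c" "independent_loops cover_topology (x, germ x c)"
    using dense_leaf_independent_loops[OF L assms(2)] by blast
  define z where "z = (x, germ x c)"
  obtain \<alpha> \<beta> and S1 S2 :: "(('a \<times> 'a chart set) set \<times> ('a \<times> 'a chart set \<Rightarrow> bool)) set" where
    \<alpha>: "pathin cover_topology \<alpha>" "\<alpha> 0 = z" "\<alpha> 1 = z" and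
    \<beta>: "pathin cover_topology \<beta>" "\<beta> 0 = z" "\<beta> 1 = z" and
    LS: "local_system cover_topology S1" "local_system cover_topology S2" and
    t1: "\<And>w. transport S1 \<alpha> w w" "\<And>w. transport S1 \<beta> w (\<not> w)" and
    t2: "\<And>w. transport S2 \<alpha> w (\<not> w)" "\<And>w. transport S2 \<beta> w w"
    using c(3) unfolding independent_loops_def z_def by blast
  have proj: "pathin M (fst \<circ> \<gamma>)" if "pathin cover_topology \<gamma>" for \<gamma>
    using that continuous_map_compose[OF _ continuous_map_fst_cover] unfolding pathin_def by blast
  show False
  proof (rule infinite_cyclic_parity[OF assms(3) local_system_push[OF LS(1)] local_system_push[OF LS(2)]])
    show "pathin M (fst \<circ> \<alpha>)" "pathin M (fst \<circ> \<beta>)" using proj \<alpha> \<beta> by blast+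
    show "(fst \<circ> \<alpha>) 0 = x" "(fst \<circ> \<alpha>) 1 = x" "(fst \<circ> \<beta>) 0 = x" "(fst \<circ> \<beta>) 1 = x"
      using \<alpha> \<beta> by (simp_all add: z_def)
    \<comment> \<open>Of the fibre over \<open>x\<close>, only the two points over the germ of
      \<open>c\<close> are followed. The loops \<alpha> and \<beta> are closed in the orientation
      cover, so their projections preserve this germ.\<close>
    show "inj (Pair (germ x c) :: bool \<Rightarrow> _)" "inj (Pair (germ x c) :: bool \<Rightarrow> _)" by (auto simp: inj_def)
    show "transport (push_system S1) (fst \<circ> \<alpha>) (germ x c, w) (germ x c, w)" for w
      using transport_push[OF \<alpha>(1) t1(1)[of w]] \<alpha> by (simp add: z_def)
    show "transport (push_system S1) (fst \<circ> \<beta>) (germ x c, w) (germ x c, \<not> w)" for w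
      using transport_push[OF \<beta>(1) t1(2)[of w]] \<beta> by (simp add: z_def)
    show "transport (push_system S2) (fst \<circ> \<alpha>) (germ x c, w) (germ x c, \<not> w)" for w
      using transport_push[OF \<alpha>(1) t2(1)[of w]] \<alpha> by (simp add: z_def)
    show "transport (push_system S2) (fst \<circ> \<beta>) (germ x c, w) (germ x c, w)" for w
      using transport_push[OF \<beta>(1) t2(2)[of w]] \<beta> by (simp add: z_def)
  qed
qed

end
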